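(* Let $\gamma>1$, let $r\in\mathcal{I}_0=(-1,2\gamma-1)$ and let $\mathbf{T}$ denote either $\mathbf{L}^{( *,\mu_r)}\mathbf{L}$ or $\mathbf{L}\mathbf{L}^{( *,\mu_r)}$, acting on $L^2(M_\gamma,\mu_r)$. Then $\mathbf{T}$ admits an orthogonal basis of eigenfunctions and its spectrum is given by $$\{0\}\cup\{C_{\mu_r}(\gamma,k):k=0,1,2,\dots\},$$ where $$C_{\mu_r}(\gamma,k)=\frac{\Gamma\big(\frac{2k+1+r}{\gamma}\big)\,\Gamma\big(2k+2-\frac{2k+1+r}{\gamma}\big)}{\Gamma(k+1)^2}\Big(\frac{\gamma}{2}\Big)^{2k+2}(\gamma-1)^{-\left(2k+2-\frac{2k+1+r}{\gamma}\right)}.$$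
   Context: For $\gamma>1$ let $M_\gamma=\{(\zeta_1,\zeta_2)\in\mathbb{C}^2:\operatorname{Im}\zeta_2=|\zeta_1|^\gamma\}$, parametrized up to a null set by $(s,\alpha,\theta)\in\mathbb{R}\times(0,\infty)\times[0,2\pi)$ via $\zeta=(\alpha e^{i\theta},\,s+i\alpha^\gamma)$. For $r\in\mathbb{R}$, $\mu_r$ is the measure $\alpha^{r}\,ds\,d\alpha\,d\theta$ on $M_\gamma$. Each $f\in L^2(M_\gamma,\mu_r)$ has a partial Fourier expansion $f=\sum_{k\in\mathbb{Z}}f_k(s,\alpha)e^{ik\theta}$. The Leray transform of $M_\gamma$ is formally $$\mathbf{L}f(z)=\frac{\gamma^2}{8\pi^2 i}\int_{M_\gamma}f(\zeta)\frac{|\zeta_1|^{\gamma-2}\,d\zeta_2\wedge d\bar\zeta_1\wedge d\zeta_1}{[\gamma\bar\zeta_1|\zeta_1|^{\gamma-2}(\zeta_1-z_1)+i(\zeta_2-z_2)]^2};$$ for $z=(\alpha_ze^{i\theta_z},s_z+i\alpha_z^\gamma)\in M_\gamma$ it is understood as $\mathbf{L}f=\sum_{k\ge0}\mathbf{L}_kf$, where, with $A=(\gamma-1)\alpha_\zeta^\gamma+\alpha_z^\gamma+i(s_\zeta-s_z)$ and $B=\gamma\alpha_z\alpha_\zeta^{\gamma-1}$, $$\mathbf{L}_kf(s_z,\alpha_z,\theta_z)=e^{ik\theta_z}\,\frac{\gamma^2(k+1)}{2\pi}\int_0^\infty\!\int_{-\infty}^\infty\frac{B^k}{A^{k+2}}f_k(s_\zeta,\alpha_\zeta)\,\alpha_\zeta^{\gamma-1}\,ds_\zeta\,d\alpha_\zeta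 .$$ For $r\in(-1,2\gamma-1)$, $\mathbf{L}$ is a bounded operator on $L^2(M_\gamma,\mu_r)$, and $\mathbf{L}^{( *,\mu_r)}$ denotes its Hilbert space adjoint with respect to $\langle f,g\rangle_{\mu_r}=\int_{M_\gamma}f\bar g\,d\mu_r$.
   Formalization: The spectrum is closed, so it can contain the limit of the C(γ,k), which need not be in the printed set (e.g. γ=2, r=0, limit 1); the formal theorem states that the set of eigenvalues equals the printed set and that the spectrum equals its closure. *)

theory Defs
  imports "HOL-Analysis.Analysis"
begin

text \<open>
  Elements of the Hilbert space are represented by functions; two representatives denote the same
  element iff they agree almost everywhere, so identities between elements and between operators
  are stated with \<^const>\<open>almost_everywhere\<close>.
\<close>

definition L2 :: "'a measure \<Rightarrow> ('a \<Rightarrow> complex) set" where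
  "L2 M = {f \<in> borel_measurable M. integrable M (\<lambda>x. (cmod (f x))\<^sup>2)}"

definition L2_inner :: "'a measure \<Rightarrow> ('a \<Rightarrow> complex) \<Rightarrow> ('a \<Rightarrow> complex) \<Rightarrow> complex" where
  "L2_inner M f g = (LINT x|M. f x * cnj (g x))"

definition norm_L2 :: "'a measure \<Rightarrow> ('a \<Rightarrow> complex) \<Rightarrow> real" where
  "norm_L2 M f = sqrt (LINT x|M. (cmod (f x))\<^sup>2)"

text \<open>
  Convergence of a series in norm.  Membership of the terms is required explicitly because the
  Bochner integral, hence \<^const>\<open>norm_L2\<close>, is 0 on functions that are not square-integrable.
\<close>

definition L2_sums :: "'a measure \<Rightarrow> (nat \<Rightarrow> 'a \<Rightarrow> complex) \<Rightarrow> ('a \<Rightarrow> complex) \<Rightarrow> bool" where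
  "L2_sums M u g \<longleftrightarrow> (\<forall>k. u k \<in> L2 M) \<and> g \<in> L2 M \<and>
     (\<lambda>n. norm_L2 M (\<lambda>x. (\<Sum>k<n. u k x) - g x)) \<longlonglongrightarrow> 0"

definition L2_bounded_operator ::
    "'a measure \<Rightarrow> (('a \<Rightarrow> complex) \<Rightarrow> 'a \<Rightarrow> complex) \<Rightarrow> bool" where
  "L2_bounded_operator M R \<longleftrightarrow>
     (\<forall>f\<in>L2 M. R f \<in> L2 M) \<and>
     (\<forall>f\<in>L2 M. \<forall>g\<in>L2 M. \<forall>a b. AE x in M. R (\<lambda>y. a * f y + b * g y) x = a * R f x + b * R g x) \<and>
     (\<exists>K. \<forall>f\<in>L2 M. norm_L2 M (R f) \<le> K * norm_L2 M f)"

definition L2_adjoint ::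
    "'a measure \<Rightarrow> (('a \<Rightarrow> complex) \<Rightarrow> 'a \<Rightarrow> complex) \<Rightarrow> ('a \<Rightarrow> complex) \<Rightarrow> 'a \<Rightarrow> complex" where
  "L2_adjoint M T g =
     (SOME h. h \<in> L2 M \<and> (\<forall>f\<in>L2 M. L2_inner M (T f) g = L2_inner M f h))"

definition L2_eigenfunction ::
    "'a measure \<Rightarrow> (('a \<Rightarrow> complex) \<Rightarrow> 'a \<Rightarrow> complex) \<Rightarrow> complex \<Rightarrow> ('a \<Rightarrow> complex) \<Rightarrow> bool" where
  "L2_eigenfunction M T c f \<longleftrightarrow>
     f \<in> L2 M \<and> \<not> (AE x in M. f x = 0) \<and> (AE x in M. T f x = c * f x)"

definition L2_point_spectrum ::
    "'a measure \<Rightarrow> (('a \<Rightarrow> complex) \<Rightarrow> 'a \<Rightarrow> complex) \<Rightarrow> complex set" where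
  "L2_point_spectrum M T = {c. \<exists>f. L2_eigenfunction M T c f}"

definition L2_spectrum ::
    "'a measure \<Rightarrow> (('a \<Rightarrow> complex) \<Rightarrow> 'a \<Rightarrow> complex) \<Rightarrow> complex set" where
  "L2_spectrum M T = {c. \<not> (\<exists>R. L2_bounded_operator M R \<and>
     (\<forall>f\<in>L2 M. (AE x in M. R (\<lambda>y. T f y - c * f y) x = f x) \<and>
                (AE x in M. T (R f) x - c * R f x = f x)))}"

text \<open>
  Orthogonal basis in the Hilbert space sense: the finite linear combinations are dense.
\<close>

definition L2_orthogonal_basis :: "'a measure \<Rightarrow> ('a \<Rightarrow> complex) set \<Rightarrow> bool" where
  "L2_orthogonal_basis M B \<longleftrightarrow>
     B \<subseteq> L2 M \<and>
     (\<forall>b\<in>B. \<not> (AE x in M. b x = 0)) \<and>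
     (\<forall>b\<in>B. \<forall>b'\<in>B. b \<noteq> b' \<longrightarrow> L2_inner M b b' = 0) \<and>
     (\<forall>f\<in>L2 M. \<forall>e>0. \<exists>F c. finite F \<and> F \<subseteq> B \<and>
        norm_L2 M (\<lambda>x. f x - (\<Sum>b\<in>F. c b * b x)) < e)"


definition hypersurface :: "real \<Rightarrow> (complex \<times> complex) set" where
  "hypersurface \<gamma> = {(\<zeta>1, \<zeta>2). Im \<zeta>2 = cmod \<zeta>1 powr \<gamma>}"

definition param :: "real \<Rightarrow> real \<times> real \<times> real \<Rightarrow> complex \<times> complex" where
  "param \<gamma> = (\<lambda>(s, \<alpha>, \<theta>). (of_real \<alpha> * cis \<theta>, Complex s (\<alpha> powr \<gamma>)))"

definition param_domain :: "(real \<times> real \<times> real) set" where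
  "param_domain = UNIV \<times> {0<..} \<times> {0..<2 * pi}"

definition mu :: "real \<Rightarrow> real \<Rightarrow> (complex \<times> complex) measure" where
  "mu \<gamma> r = distr
     (density (restrict_space lborel param_domain) (\<lambda>(s, \<alpha>, \<theta>). ennreal (\<alpha> powr r)))
     (restrict_space borel (hypersurface \<gamma>)) (param \<gamma>)"

definition fourier_coeff ::
    "real \<Rightarrow> (complex \<times> complex \<Rightarrow> complex) \<Rightarrow> int \<Rightarrow> real \<Rightarrow> real \<Rightarrow> complex" where
  "fourier_coeff \<gamma> f k s \<alpha> =
     (LINT \<theta>:{0..<2 * pi}|lborel. f (param \<gamma> (s, \<alpha>, \<theta>)) * cis (- of_int k * \<theta>)) / of_real (2 * pi)"

text \<open>
  On the hypersurface, a point \<open>(z1, z2)\<close> with coordinates \<open>s\<^sub>z, \<alpha>\<^sub>z, \<theta>\<^sub>z\<close> has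
  \<open>s\<^sub>z = Re z2\<close>, \<open>\<alpha>\<^sub>z = cmod z1\<close>, and \<open>exp (\<i> k \<theta>\<^sub>z) = sgn z1 ^ k\<close>.
\<close>

definition leray_mode ::
    "real \<Rightarrow> nat \<Rightarrow> (complex \<times> complex \<Rightarrow> complex) \<Rightarrow> complex \<times> complex \<Rightarrow> complex" where
  "leray_mode \<gamma> k f = (\<lambda>(z1, z2).
     sgn z1 ^ k * of_real (\<gamma>\<^sup>2 * (real k + 1) / (2 * pi)) *
     (LINT \<alpha>:{0<..}|lborel. LINT s|lborel.
        (let A = Complex ((\<gamma> - 1) * \<alpha> powr \<gamma> + cmod z1 powr \<gamma>) (s - Re z2);
             B = complex_of_real (\<gamma> * cmod z1 * \<alpha> powr (\<gamma> - 1))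
         in B ^ k / A ^ (k + 2) * fourier_coeff \<gamma> f (int k) s \<alpha> * of_real (\<alpha> powr (\<gamma> - 1)))))"

text \<open>
  The kernel of the Leray integral is singular on the hypersurface itself, so the transform is understood as the sum
  of its Fourier modes, which converges in norm; the limit is unique up to a null set.
\<close>

definition leray ::
    "real \<Rightarrow> real \<Rightarrow> (complex \<times> complex \<Rightarrow> complex) \<Rightarrow> complex \<times> complex \<Rightarrow> complex" where
  "leray \<gamma> r f = (SOME g. L2_sums (mu \<gamma> r) (\<lambda>k. leray_mode \<gamma> k f) g)"

definition leray_adjoint ::
    "real \<Rightarrow> real \<Rightarrow> (complex \<times> complex \<Rightarrow> complex) \<Rightarrow> complex \<times> complex \<Rightarrow> complex" where
  "leray_adjoint \<gamma> r = L2_adjoint (mu \<gamma> r) (leray \<gamma> r)"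

definition leray_const :: "real \<Rightarrow> real \<Rightarrow> nat \<Rightarrow> real" where
  "leray_const r \<gamma> k =
     Gamma ((2 * real k + 1 + r) / \<gamma>) * Gamma (2 * real k + 2 - (2 * real k + 1 + r) / \<gamma>)
       / (Gamma (real k + 1))\<^sup>2
     * (\<gamma> / 2) ^ (2 * k + 2)
     * (\<gamma> - 1) powr (- (2 * real k + 2 - (2 * real k + 1 + r) / \<gamma>))"

end

theory Submission
  imports Defs "HOL-Real_Asymp.Real_Asymp"
begin

text \<open>
  Write \<open>L\<^sub>k\<close> for the \<open>k\<close>-th Fourier mode of the Leray transform, \<open>L\<^sub>k\<^sup>*\<close> for its adjoint with respect to
  \<open>\<mu>\<^sub>r\<close> and \<open>C\<^sub>k\<close> for \<open>leray_const r \<gamma> k\<close>. A Fourier transform in \<open>s\<close> would turn \<open>L\<^sub>k\<close>, for every frequency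
  \<open>t > 0\<close>, into an operator of rank one from \<open>\<alpha> powr ((\<gamma> - 1) * (k + 1) - r) * exp (- t * (\<gamma> - 1) * \<alpha> powr \<gamma>)\<close>
  to \<open>\<alpha> ^ k * exp (- t * \<alpha> powr \<gamma>)\<close>, and by homogeneity the norm of this operator does not depend on \<open>t\<close>.
  So \<open>L\<^sub>k\<close> is a multiple of a partial isometry. The Fourier transform can be avoided, because this
  property is equivalent to the identity \<open>L\<^sub>k L\<^sub>k\<^sup>* L\<^sub>k = C\<^sub>k L\<^sub>k\<close> between integral operators, which is a statement
  about their kernels (\<open>compose_three_mode_kernels\<close>).

  \<^item> The Schur test with a power of \<open>\<alpha>\<close> as weight shows that the kernels, with absolute values, define
    bounded operators (\<open>mode_kernel_schur\<close>). Hence they may be composed by Fubini's theorem.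
  \<^item> The integrals in \<open>s\<close> are convolutions of powers of \<open>1 / (a + \<i> s)\<close>, which follow from a partial fraction
    recursion (\<open>convolution_integral\<close>). The remaining radial integrals separate after a Laplace transform
    and give the two Gamma factors of \<open>C\<^sub>k\<close> (\<open>laplace_powr_integral\<close>).
  \<^item> The angular factors \<open>exp (\<i> k \<theta>)\<close> make different modes orthogonal (\<open>compose_different_modes\<close>).

  Consequently \<open>P\<^sub>k = L\<^sub>k\<^sup>* L\<^sub>k / C\<^sub>k\<close> are mutually orthogonal projections, and so are \<open>L\<^sub>k L\<^sub>k\<^sup>* / C\<^sub>k\<close>. By Stirling's
  formula the \<open>C\<^sub>k\<close> are bounded (\<open>leray_const_bounded\<close>). Therefore the series that defines the Leray transform
  converges, and \<open>L\<^sup>* L\<close> and \<open>L L\<^sup>*\<close> are the sums of the operators \<open>C\<^sub>k P\<^sub>k\<close> for one or the other family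
  (\<open>L2_modes.spectral_theorem\<close>). For such an operator the eigenvalues are the \<open>C\<^sub>k\<close> together with 0, which
  occurs because functions of negative frequency in \<open>\<theta>\<close> are annihilated, and the resolvent is explicit away
  from their closure. Zorn's lemma gives a maximal orthogonal set of suitable eigenfunctions, and Riesz--Fischer
  completeness shows that it is a basis (\<open>L2_diagonal_operator.orthogonal_basis\<close>).
\<close>

section \<open>The Hilbert space of square-integrable functions\<close>

lemma borel_measurable_cnj_fun [measurable]: "cnj \<in> borel_measurable borel"
  by (intro borel_measurable_continuous_onI continuous_intros)

lemma nn_integral_Cauchy_Schwarz:
  fixes u v :: "'a \<Rightarrow> ennreal"
  assumes [measurable]: "u \<in> borel_measurable M" "v \<in> borel_measurable M"
  shows "(\<integral>\<^sup>+x. u x * v x \<partial>M)\<^sup>2 \<le> (\<integral>\<^sup>+x. (u x)\<^sup>2 \<partial>M) * (\<integral>\<^sup>+x. (v x)\<^sup>2 \<partial>M)"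
    (is "?I\<^sup>2 \<le> ?X * ?Y")
proof -
  have *: "?I = 0" if "?X = 0 \<or> ?Y = 0"
  proof -
    have "AE x in M. u x * v x = 0"
      using that by (auto simp: nn_integral_0_iff_AE elim: eventually_mono)
    then show ?thesis by (simp add: nn_integral_0_iff_AE)
  qed
  consider "?X = 0 \<or> ?Y = 0" | "?X \<noteq> 0" "?Y \<noteq> 0" "?X = \<infinity> \<or> ?Y = \<infinity>"
    | "?X \<noteq> 0" "?Y \<noteq> 0" "?X \<noteq> \<infinity>" "?Y \<noteq> \<infinity>" by blast
  then show ?thesis
  proof cases
    case 1 then show ?thesis using * by simp
  next
    case 2 then show ?thesis by (auto simp: ennreal_mult_eq_top_iff)
  next
    case 3
    obtain a where a: "?X = ennreal a" "a > 0"
      using 3 by (cases ?X) (auto simp: less_le)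
    obtain b where b: "?Y = ennreal b" "b > 0"
      using 3 by (cases ?Y) (auto simp: less_le)
    (* The best weight in 2 p q <= l p^2 + q^2 / l, which makes both integrals equal. *)
    define l where "l = sqrt (b / a)"
    have l: "l > 0" "l * l = b / a" using a b by (auto simp: l_def)
    have amgm: "2 * (p * q) \<le> ennreal l * p\<^sup>2 + ennreal (1/l) * q\<^sup>2" for p q :: ennreal
    proof (cases "p = \<infinity> \<or> q = \<infinity>")
      case True
      then show ?thesis
        using l by (auto simp: power2_eq_square ennreal_mult_eq_top_iff ennreal_mult_top ennreal_top_mult)
    next
      case False
      then obtain x y where xy: "p = ennreal x" "q = ennreal y" "x \<ge> 0" "y \<ge> 0"
        by (cases p; cases q) auto
      have "0 \<le> (l * x - y)\<^sup>2 / l" using l by simp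
      also have "\<dots> = l * x\<^sup>2 + (1/l) * y\<^sup>2 - 2 * (x * y)"
        using l by (simp add: field_simps power2_eq_square)
      finally have "2 * (x * y) \<le> l * x\<^sup>2 + (1/l) * y\<^sup>2" by simp
      then show ?thesis using l xy
        by (auto simp: ennreal_mult[symmetric] ennreal_power ennreal_plus[symmetric] ennreal_leI
            simp del: ennreal_plus ennreal_numeral simp flip: ennreal_numeral)
    qed
    have "2 * ?I = (\<integral>\<^sup>+x. 2 * (u x * v x) \<partial>M)" by (simp add: nn_integral_cmult)
    also have "\<dots> \<le> (\<integral>\<^sup>+x. ennreal l * (u x)\<^sup>2 + ennreal (1/l) * (v x)\<^sup>2 \<partial>M)"
      by (intro nn_integral_mono amgm)
    also have "\<dots> = ennreal l * ?X + ennreal (1/l) * ?Y"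
      by (simp add: nn_integral_add nn_integral_cmult)
    also have "\<dots> = ennreal (l * a + b / l)"
      using a b l by (simp add: ennreal_mult[symmetric] ennreal_plus[symmetric] del: ennreal_plus)
    also have "l * a + b / l = 2 * (l * a)"
      using l a b by (simp add: field_simps)
    finally have I2: "2 * ?I \<le> ennreal (2 * (l * a))" .
    then have "?I \<noteq> \<infinity>" by (auto simp: ennreal_mult_top top_unique)
    then obtain i where i: "?I = ennreal i" "i \<ge> 0" by (cases ?I) auto
    have "ennreal (2 * i) \<le> ennreal (2 * (l * a))"
      using I2 i by (simp add: ennreal_mult)
    then have "i \<le> l * a" using l a i by (subst (asm) ennreal_le_iff) auto
    then have "i\<^sup>2 \<le> (l * a)\<^sup>2" using i by (intro power_mono) auto
    also have "\<dots> = a * b" using l a by (simp add: power2_eq_square field_simps)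
    finally show ?thesis using a b i by (simp add: ennreal_power ennreal_mult[symmetric] ennreal_leI)
  qed
qed

lemma L2_measurable [measurable_dest]: "f \<in> L2 M \<Longrightarrow> f \<in> borel_measurable M"
  and L2_integrable: "f \<in> L2 M \<Longrightarrow> integrable M (\<lambda>x. (cmod (f x))\<^sup>2)"
  by (auto simp: L2_def)

lemma L2_iff_nn_integral:
  "f \<in> L2 M \<longleftrightarrow> f \<in> borel_measurable M \<and> (\<integral>\<^sup>+x. ennreal ((cmod (f x))\<^sup>2) \<partial>M) < \<infinity>"
  by (auto simp: L2_def integrable_iff_bounded)

lemma norm_L2_nonneg [simp]: "0 \<le> norm_L2 M f"
  by (simp add: norm_L2_def)

lemma norm_L2_sq: "(norm_L2 M f)\<^sup>2 = (LINT x|M. (cmod (f x))\<^sup>2)"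
  by (simp add: norm_L2_def)

lemma nn_integral_eq_norm_L2:
  "f \<in> L2 M \<Longrightarrow> (\<integral>\<^sup>+x. ennreal ((cmod (f x))\<^sup>2) \<partial>M) = ennreal ((norm_L2 M f)\<^sup>2)"
  by (subst nn_integral_eq_integral[OF L2_integrable]) (auto simp: norm_L2_sq)

lemma norm_L2_le_nn_integral:
  assumes "f \<in> borel_measurable M" "(\<integral>\<^sup>+x. ennreal ((cmod (f x))\<^sup>2) \<partial>M) \<le> ennreal (K\<^sup>2)" "K \<ge> 0"
  shows "f \<in> L2 M" "norm_L2 M f \<le> K"
proof -
  show f: "f \<in> L2 M" using assms by (auto simp: L2_iff_nn_integral less_top[symmetric] top_unique)
  then show "norm_L2 M f \<le> K"
    using assms nn_integral_eq_norm_L2[OF f] by (simp add: ennreal_le_iff power2_le_iff_abs_le)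
qed

lemma L2_zero [simp]: "(\<lambda>x. 0) \<in> L2 M"
  by (simp add: L2_def)

lemma L2_cong_AE:
  assumes "f \<in> L2 M" "g \<in> borel_measurable M" "AE x in M. f x = g x"
  shows "g \<in> L2 M"
proof -
  have "integrable M (\<lambda>x. (cmod (g x))\<^sup>2)"
    using assms L2_measurable[OF assms(1)] by (subst integrable_cong_AE[of _ _ "\<lambda>x. (cmod (f x))\<^sup>2"])
      (auto simp: L2_def elim: eventually_mono)
  then show ?thesis using assms by (simp add: L2_def)
qed

lemma L2_add:
  assumes "f \<in> L2 M" "g \<in> L2 M" shows "(\<lambda>x. f x + g x) \<in> L2 M"
proof -
  note [measurable] = L2_measurable[OF assms(1)] L2_measurable[OF assms(2)]
  have "integrable M (\<lambda>x. (cmod (f x + g x))\<^sup>2)"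
  proof (rule Bochner_Integration.integrable_bound)
    show "integrable M (\<lambda>x. 2 * (cmod (f x))\<^sup>2 + 2 * (cmod (g x))\<^sup>2)"
      using assms by (auto simp: L2_def)
    have "(cmod (f x + g x))\<^sup>2 \<le> 2 * (cmod (f x))\<^sup>2 + 2 * (cmod (g x))\<^sup>2" for x
    proof -
      have "(cmod (f x + g x))\<^sup>2 \<le> (cmod (f x) + cmod (g x))\<^sup>2"
        by (intro power_mono norm_triangle_ineq) auto
      also have "\<dots> \<le> 2 * (cmod (f x))\<^sup>2 + 2 * (cmod (g x))\<^sup>2"
        using sum_squares_bound[of "cmod (f x)" "cmod (g x)"] by (simp add: power2_sum)
      finally show ?thesis .
    qed
    then show "AE x in M. norm ((cmod (f x + g x))\<^sup>2) \<le> norm (2 * (cmod (f x))\<^sup>2 + 2 * (cmod (g x))\<^sup>2)"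
      by auto
  qed auto
  then show ?thesis by (simp add: L2_def)
qed

lemma L2_scale: "f \<in> L2 M \<Longrightarrow> (\<lambda>x. c * f x) \<in> L2 M"
  by (auto simp: L2_def norm_mult power_mult_distrib)

lemma L2_diff: "f \<in> L2 M \<Longrightarrow> g \<in> L2 M \<Longrightarrow> (\<lambda>x. f x - g x) \<in> L2 M"
  using L2_add[of f M "\<lambda>x. -1 * g x"] L2_scale[of g M "-1"] by simp

lemma L2_sum: "(\<And>i. i \<in> A \<Longrightarrow> f i \<in> L2 M) \<Longrightarrow> (\<lambda>x. \<Sum>i\<in>A. f i x) \<in> L2 M"
  by (induction A rule: infinite_finite_induct) (auto intro: L2_add)

lemma L2_mult_integrable:
  assumes "f \<in> L2 M" "g \<in> L2 M" shows "integrable M (\<lambda>x. f x * cnj (g x))"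
proof (rule Bochner_Integration.integrable_bound)
  show "integrable M (\<lambda>x. (cmod (f x))\<^sup>2 + (cmod (g x))\<^sup>2)" using assms by (auto simp: L2_def)
  show "(\<lambda>x. f x * cnj (g x)) \<in> borel_measurable M"
    using assms[THEN L2_measurable] by measurable
  have "cmod (f x) * cmod (g x) \<le> (cmod (f x))\<^sup>2 + (cmod (g x))\<^sup>2" for x
    using sum_squares_bound[of "cmod (f x)" "cmod (g x)"]
      mult_nonneg_nonneg[OF norm_ge_zero norm_ge_zero, of "f x" "g x"] by linarith
  then show "AE x in M. norm (f x * cnj (g x)) \<le> norm ((cmod (f x))\<^sup>2 + (cmod (g x))\<^sup>2)"
    by (auto simp: norm_mult)
qed

lemma L2_inner_cnj: "cnj (L2_inner M f g) = L2_inner M g f"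
  unfolding L2_inner_def Bochner_Integration.integral_cnj[symmetric] by (simp add: mult.commute)

lemma L2_inner_add_left:
  "\<lbrakk>f \<in> L2 M; g \<in> L2 M; h \<in> L2 M\<rbrakk> \<Longrightarrow> L2_inner M (\<lambda>x. f x + g x) h = L2_inner M f h + L2_inner M g h"
  unfolding L2_inner_def by (simp add: ring_distribs L2_mult_integrable)

lemma L2_inner_diff_left:
  "\<lbrakk>f \<in> L2 M; g \<in> L2 M; h \<in> L2 M\<rbrakk> \<Longrightarrow> L2_inner M (\<lambda>x. f x - g x) h = L2_inner M f h - L2_inner M g h"
  unfolding L2_inner_def by (simp add: ring_distribs L2_mult_integrable)

lemma L2_inner_scale_left: "L2_inner M (\<lambda>x. c * f x) h = c * L2_inner M f h"
  unfolding L2_inner_def by (simp add: mult.assoc)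

lemma L2_inner_scale_right: "L2_inner M f (\<lambda>x. c * h x) = cnj c * L2_inner M f h"
  unfolding L2_inner_def by (simp add: mult.left_commute)

lemma L2_inner_add_right:
  "\<lbrakk>f \<in> L2 M; g \<in> L2 M; h \<in> L2 M\<rbrakk> \<Longrightarrow> L2_inner M h (\<lambda>x. f x + g x) = L2_inner M h f + L2_inner M h g"
  using L2_inner_add_left[of f M g h] by (metis L2_inner_cnj complex_cnj_add)

lemma L2_inner_zero [simp]: "L2_inner M (\<lambda>x. 0) h = 0" "L2_inner M h (\<lambda>x. 0) = 0"
  by (simp_all add: L2_inner_def)

lemma L2_inner_sum_left:
  assumes "\<And>i. i \<in> A \<Longrightarrow> f i \<in> L2 M" "h \<in> L2 M"
  shows "L2_inner M (\<lambda>x. \<Sum>i\<in>A. f i x) h = (\<Sum>i\<in>A. L2_inner M (f i) h)"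
  using assms
  by (induction A rule: infinite_finite_induct) (auto simp: L2_inner_add_left L2_sum)

lemma L2_inner_sum_right:
  assumes "\<And>i. i \<in> A \<Longrightarrow> f i \<in> L2 M" "h \<in> L2 M"
  shows "L2_inner M h (\<lambda>x. \<Sum>i\<in>A. f i x) = (\<Sum>i\<in>A. L2_inner M h (f i))"
  using assms
  by (induction A rule: infinite_finite_induct) (auto simp: L2_inner_add_right L2_sum)

lemma L2_inner_self: "L2_inner M f f = complex_of_real ((norm_L2 M f)\<^sup>2)"
proof -
  have "L2_inner M f f = (LINT x|M. complex_of_real ((cmod (f x))\<^sup>2))"
    unfolding L2_inner_def by (simp add: complex_norm_square del: of_real_power)
  then show ?thesis unfolding norm_L2_sq by (simp only: integral_complex_of_real)
qed

lemma L2_inner_cong: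
  assumes "f \<in> borel_measurable M" "f' \<in> borel_measurable M" "g \<in> borel_measurable M" "g' \<in> borel_measurable M"
    and "AE x in M. f x = f' x" "AE x in M. g x = g' x"
  shows "L2_inner M f g = L2_inner M f' g'"
  unfolding L2_inner_def using assms
  by (intro integral_cong_AE) (measurable, auto elim: eventually_elim2)

lemma norm_L2_cong:
  assumes "f \<in> borel_measurable M" "f' \<in> borel_measurable M" "AE x in M. f x = f' x"
  shows "norm_L2 M f = norm_L2 M f'"
proof -
  have "(LINT x|M. (cmod (f x))\<^sup>2) = (LINT x|M. (cmod (f' x))\<^sup>2)"
    using assms by (intro integral_cong_AE) (measurable, auto elim: eventually_mono)
  then show ?thesis by (simp add: norm_L2_def)
qed

lemma norm_L2_eq_0_iff:
  assumes "f \<in> L2 M" shows "norm_L2 M f = 0 \<longleftrightarrow> (AE x in M. f x = 0)"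
proof -
  have "norm_L2 M f = 0 \<longleftrightarrow> (LINT x|M. (cmod (f x))\<^sup>2) = 0" by (simp add: norm_L2_def)
  also have "\<dots> \<longleftrightarrow> (AE x in M. (cmod (f x))\<^sup>2 = 0)"
    using assms by (intro integral_nonneg_eq_0_iff_AE) (auto simp: L2_def)
  finally show ?thesis by simp
qed

lemma norm_L2_scale: "norm_L2 M (\<lambda>x. c * f x) = cmod c * norm_L2 M f"
  by (simp add: norm_L2_def norm_mult power_mult_distrib real_sqrt_mult)

lemma norm_L2_minus_commute: "norm_L2 M (\<lambda>x. f x - g x) = norm_L2 M (\<lambda>x. g x - f x)"
  by (simp add: norm_L2_def norm_minus_commute)

lemma L2_Cauchy_Schwarz:
  assumes f: "f \<in> L2 M" and g: "g \<in> L2 M"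
  shows "cmod (L2_inner M f g) \<le> norm_L2 M f * norm_L2 M g"
proof -
  note [measurable] = L2_measurable[OF f] L2_measurable[OF g]
  let ?I = "LINT x|M. cmod (f x * cnj (g x))"
  have int: "integrable M (\<lambda>x. f x * cnj (g x))" by (rule L2_mult_integrable[OF f g])
  have "ennreal ?I = (\<integral>\<^sup>+x. ennreal (cmod (f x)) * ennreal (cmod (g x)) \<partial>M)"
    using integrable_norm[OF int] by (subst nn_integral_eq_integral[symmetric]) (simp_all add: norm_mult ennreal_mult)
  then have "(ennreal ?I)\<^sup>2 \<le> (\<integral>\<^sup>+x. (ennreal (cmod (f x)))\<^sup>2 \<partial>M) * (\<integral>\<^sup>+x. (ennreal (cmod (g x)))\<^sup>2 \<partial>M)"
    using nn_integral_Cauchy_Schwarz[of "\<lambda>x. ennreal (cmod (f x))" M "\<lambda>x. ennreal (cmod (g x))"] by simp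
  also have "\<dots> = ennreal ((norm_L2 M f * norm_L2 M g)\<^sup>2)"
    by (simp add: ennreal_power nn_integral_eq_norm_L2[OF f] nn_integral_eq_norm_L2[OF g]
        ennreal_mult[symmetric] power_mult_distrib)
  finally have "?I\<^sup>2 \<le> (norm_L2 M f * norm_L2 M g)\<^sup>2"
    by (simp add: ennreal_power)
  then have "?I \<le> norm_L2 M f * norm_L2 M g"
    by (rule power2_le_imp_le) simp
  moreover have "cmod (L2_inner M f g) \<le> ?I"
    unfolding L2_inner_def by (rule integral_norm_bound)
  ultimately show ?thesis by simp
qed

lemma norm_L2_add_sq:
  assumes "f \<in> L2 M" "g \<in> L2 M"
  shows "(norm_L2 M (\<lambda>x. f x + g x))\<^sup>2 = (norm_L2 M f)\<^sup>2 + (norm_L2 M g)\<^sup>2 + 2 * Re (L2_inner M f g)"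
proof -
  have "complex_of_real ((norm_L2 M (\<lambda>x. f x + g x))\<^sup>2) =
      complex_of_real ((norm_L2 M f)\<^sup>2) + complex_of_real ((norm_L2 M g)\<^sup>2) + (L2_inner M f g + cnj (L2_inner M f g))"
    using assms unfolding L2_inner_cnj
    by (simp add: L2_inner_self[symmetric] L2_inner_add_left L2_inner_add_right L2_add del: of_real_power)
  then have "Re (complex_of_real ((norm_L2 M (\<lambda>x. f x + g x))\<^sup>2)) =
      Re (complex_of_real ((norm_L2 M f)\<^sup>2) + complex_of_real ((norm_L2 M g)\<^sup>2) + (L2_inner M f g + cnj (L2_inner M f g)))"
    by simp
  then show ?thesis by (simp del: of_real_power)
qed

lemma norm_L2_triangle:
  assumes "f \<in> L2 M" "g \<in> L2 M"
  shows "norm_L2 M (\<lambda>x. f x + g x) \<le> norm_L2 M f + norm_L2 M g"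
proof (rule power2_le_imp_le)
  have "Re (L2_inner M f g) \<le> norm_L2 M f * norm_L2 M g"
    using L2_Cauchy_Schwarz[OF assms] complex_Re_le_cmod order_trans by blast
  then show "(norm_L2 M (\<lambda>x. f x + g x))\<^sup>2 \<le> (norm_L2 M f + norm_L2 M g)\<^sup>2"
    using norm_L2_add_sq[OF assms] by (simp add: power2_sum)
qed simp

lemma norm_L2_triangle_diff:
  assumes "f \<in> L2 M" "g \<in> L2 M" "h \<in> L2 M"
  shows "norm_L2 M (\<lambda>x. f x - h x) \<le> norm_L2 M (\<lambda>x. f x - g x) + norm_L2 M (\<lambda>x. g x - h x)"
  using norm_L2_triangle[of "\<lambda>x. f x - g x" M "\<lambda>x. g x - h x"] assms by (simp add: L2_diff)

lemma norm_L2_diff_sq: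
  assumes "f \<in> L2 M" "g \<in> L2 M"
  shows "(norm_L2 M (\<lambda>x. f x - g x))\<^sup>2 = (norm_L2 M f)\<^sup>2 + (norm_L2 M g)\<^sup>2 - 2 * Re (L2_inner M f g)"
  using norm_L2_add_sq[of f M "\<lambda>x. -1 * g x"] assms L2_scale[of g M "-1"]
    L2_inner_scale_right[of M f "-1" g] norm_L2_scale[of M "-1" g]
  by simp

text \<open>
  Elements of the Hilbert space are recognized by their inner products; this turns identities
  between operators into algebra with adjoints.
\<close>

lemma L2_eqI_inner:
  assumes f: "f \<in> L2 M" and g: "g \<in> L2 M" and eq: "\<And>h. h \<in> L2 M \<Longrightarrow> L2_inner M f h = L2_inner M g h"
  shows "AE x in M. f x = g x"
proof -
  have d: "(\<lambda>x. f x - g x) \<in> L2 M" using f g by (rule L2_diff)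
  have "complex_of_real ((norm_L2 M (\<lambda>x. f x - g x))\<^sup>2) = 0"
    unfolding L2_inner_self[symmetric] using eq[OF d] f g d by (simp add: L2_inner_diff_left)
  then have "norm_L2 M (\<lambda>x. f x - g x) = 0" by simp
  then show ?thesis using norm_L2_eq_0_iff[OF d] by simp
qed

text \<open>
  Riesz--Fischer. Along a subsequence \<open>s\<close> whose increments \<open>D j\<close> have norm at most \<open>(1/2) ^ j\<close>, the function
  \<open>\<Sum>j. 2 ^ j * (cmod (D j x))\<^sup>2\<close> has finite integral. Where it is finite, the subsequence converges
  pointwise, and Fatou's lemma identifies the pointwise limit as the limit in norm.
\<close>

lemma L2_complete:
  assumes F: "\<And>n. F n \<in> L2 M"
    and Cauchy: "\<And>e. e > 0 \<Longrightarrow> \<exists>N. \<forall>m\<ge>N. \<forall>n\<ge>N. norm_L2 M (\<lambda>x. F m x - F n x) < e"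
  shows "\<exists>g\<in>L2 M. (\<lambda>n. norm_L2 M (\<lambda>x. F n x - g x)) \<longlonglongrightarrow> 0"
proof -
  note [measurable] = L2_measurable[OF F]
  have "\<exists>N. \<forall>j. (\<forall>m\<ge>N j. \<forall>n\<ge>N j. norm_L2 M (\<lambda>x. F m x - F n x) < (1/2)^j)"
    using Cauchy[of "(1/2)^_"] by (intro choice allI) auto
  then obtain N where N: "\<And>j m n. m \<ge> N j \<Longrightarrow> n \<ge> N j \<Longrightarrow> norm_L2 M (\<lambda>x. F m x - F n x) < (1/2)^j"
    by blast
  define s where "s j = (\<Sum>i\<le>j. N i) + j" for j
  have sN: "s j \<ge> N j" for j
  proof -
    have "N j \<le> (\<Sum>i\<le>j. N i)" by (rule member_le_sum) auto
    then show ?thesis by (simp add: s_def)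
  qed
  have s_mono: "s j \<le> s (Suc j)" for j by (simp add: s_def)
  have s_ge: "s j \<ge> j" for j by (simp add: s_def)
  define D where "D j x = F (s j) x - F (s (Suc j)) x" for j x
  have DL: "D j \<in> L2 M" for j unfolding D_def by (intro L2_diff F)
  note [measurable] = L2_measurable[OF DL]
  have Dn: "norm_L2 M (D j) \<le> (1/2)^j" for j
    using N[of j "s j" "s (Suc j)"] sN[of j] s_mono[of j] unfolding D_def by (simp add: less_imp_le)
  have "(\<integral>\<^sup>+x. (\<Sum>j. ennreal (2^j * (cmod (D j x))\<^sup>2)) \<partial>M) = (\<Sum>j. \<integral>\<^sup>+x. ennreal (2^j * (cmod (D j x))\<^sup>2) \<partial>M)"
    by (rule nn_integral_suminf) auto
  also have "\<dots> \<le> (\<Sum>j. ennreal ((1/2)^j))"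
  proof (rule suminf_le)
    fix j
    have "(\<integral>\<^sup>+x. ennreal (2^j * (cmod (D j x))\<^sup>2) \<partial>M) = ennreal (2^j) * ennreal ((norm_L2 M (D j))\<^sup>2)"
      by (simp add: ennreal_mult nn_integral_cmult nn_integral_eq_norm_L2[OF DL])
    also have "\<dots> = ennreal (2^j * (norm_L2 M (D j))\<^sup>2)" by (simp add: ennreal_mult)
    also have "\<dots> \<le> ennreal (2^j * ((1/2)^j)\<^sup>2)"
      by (intro ennreal_leI mult_left_mono power_mono Dn) auto
    also have "2^j * ((1/2)^j)\<^sup>2 = (1/2::real)^j"
      by (simp add: power2_eq_square power_mult_distrib[symmetric] flip: mult.assoc)
    finally show "(\<integral>\<^sup>+x. ennreal (2^j * (cmod (D j x))\<^sup>2) \<partial>M) \<le> ennreal ((1/2)^j)" .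
  qed auto
  also have "\<dots> < \<infinity>"
    by (subst suminf_ennreal2) (auto intro: summable_geometric)
  finally have "AE x in M. (\<Sum>j. ennreal (2^j * (cmod (D j x))\<^sup>2)) \<noteq> \<infinity>"
    by (intro nn_integral_noteq_infinite) auto
  then have conv: "AE x in M. convergent (\<lambda>j. F (s j) x)"
  proof eventually_elim
    case (elim x)
    have "summable (\<lambda>j. 2^j * (cmod (D j x))\<^sup>2)"
      using elim by (intro summable_suminf_not_top) auto
    then have "Bseq (\<lambda>j. 2^j * (cmod (D j x))\<^sup>2)"
      by (intro convergent_imp_Bseq) (auto dest: summable_LIMSEQ_zero simp: convergent_def)
    then obtain K where K: "K > 0" "\<And>j. norm (2^j * (cmod (D j x))\<^sup>2) \<le> K"
      by (rule BseqE) auto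
    have "summable (\<lambda>j. sqrt K * (sqrt (1/2))^j)"
      by (intro summable_mult summable_geometric) (simp add: real_sqrt_divide)
    then have "summable (\<lambda>j. norm (D j x))"
    proof (rule summable_comparison_test'[where N = 0])
      fix j
      have "(cmod (D j x))\<^sup>2 \<le> K * (1/2)^j"
        using K(2)[of j] by (simp add: field_simps)
      then have "sqrt ((cmod (D j x))\<^sup>2) \<le> sqrt (K * (1/2)^j)" by (rule real_sqrt_le_mono)
      then show "norm (norm (D j x)) \<le> sqrt K * (sqrt (1/2))^j"
        by (simp add: real_sqrt_mult real_sqrt_power)
    qed
    then have "summable (\<lambda>j. D j x)" by (rule summable_norm_cancel)
    then have "convergent (\<lambda>n. \<Sum>j<n. D j x)" by (simp add: summable_iff_convergent)
    moreover have "(\<Sum>j<n. D j x) = F (s 0) x - F (s n) x" for n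
      by (induction n) (auto simp: D_def)
    ultimately have "convergent (\<lambda>n. F (s 0) x - F (s n) x)" by simp
    from convergent_diff[OF convergent_const[of "F (s 0) x"] this] show ?case by simp
  qed
  define g where "g x = lim (\<lambda>j. F (s j) x)" for x
  have [measurable]: "g \<in> borel_measurable M" unfolding g_def by measurable
  have close: "(\<integral>\<^sup>+x. ennreal ((cmod (F m x - g x))\<^sup>2) \<partial>M) \<le> ennreal (e\<^sup>2)"
    if m: "m \<ge> n0" and n0: "\<And>m n. m \<ge> n0 \<Longrightarrow> n \<ge> n0 \<Longrightarrow> norm_L2 M (\<lambda>x. F m x - F n x) < e" for m n0 e
  proof -
    have "(\<integral>\<^sup>+x. ennreal ((cmod (F m x - g x))\<^sup>2) \<partial>M) =
        (\<integral>\<^sup>+x. liminf (\<lambda>j. ennreal ((cmod (F m x - F (s j) x))\<^sup>2)) \<partial>M)"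
    proof (rule nn_integral_cong_AE)
      show "AE x in M. ennreal ((cmod (F m x - g x))\<^sup>2) = liminf (\<lambda>j. ennreal ((cmod (F m x - F (s j) x))\<^sup>2))"
        using conv
      proof eventually_elim
        case (elim x)
        then have "(\<lambda>j. F (s j) x) \<longlonglongrightarrow> g x" by (simp add: g_def convergent_LIMSEQ_iff)
        then have "(\<lambda>j. ennreal ((cmod (F m x - F (s j) x))\<^sup>2)) \<longlonglongrightarrow> ennreal ((cmod (F m x - g x))\<^sup>2)"
          by (intro tendsto_intros)
        then show ?case by (rule lim_imp_Liminf[OF trivial_limit_sequentially, symmetric])
      qed
    qed
    also have "\<dots> \<le> liminf (\<lambda>j. \<integral>\<^sup>+x. ennreal ((cmod (F m x - F (s j) x))\<^sup>2) \<partial>M)"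
      by (rule nn_integral_liminf) auto
    also have "\<dots> \<le> ennreal (e\<^sup>2)"
    proof (rule Liminf_le)
      have "eventually (\<lambda>j. j \<ge> n0) sequentially" by (rule eventually_ge_at_top)
      then have "\<forall>\<^sub>F j in sequentially. (\<integral>\<^sup>+x. ennreal ((cmod (F m x - F (s j) x))\<^sup>2) \<partial>M) \<le> ennreal (e\<^sup>2)"
      proof eventually_elim
        case (elim j)
        then have "norm_L2 M (\<lambda>x. F m x - F (s j) x) < e"
          using n0[OF m, of "s j"] s_ge[of j] by simp
        then have "(norm_L2 M (\<lambda>x. F m x - F (s j) x))\<^sup>2 \<le> e\<^sup>2"
          by (intro power_mono) auto
        then show ?case
          by (subst nn_integral_eq_norm_L2) (auto intro!: L2_diff F ennreal_leI)
      qed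
      then show "\<forall>\<^sub>F j in sequentially. (\<integral>\<^sup>+x. ennreal ((cmod (F m x - F (s j) x))\<^sup>2) \<partial>M) \<le> ennreal (e\<^sup>2)" .
    qed simp
    finally show ?thesis .
  qed
  obtain n1 where n1: "\<And>m n. m \<ge> n1 \<Longrightarrow> n \<ge> n1 \<Longrightarrow> norm_L2 M (\<lambda>x. F m x - F n x) < 1"
    using Cauchy[of 1] by auto
  have "(\<lambda>x. F n1 x - g x) \<in> L2 M"
    using norm_L2_le_nn_integral(1)[OF _ close[OF _ n1]] by auto
  from L2_diff[OF F this, of n1] have g: "g \<in> L2 M" by simp
  moreover have "(\<lambda>n. norm_L2 M (\<lambda>x. F n x - g x)) \<longlonglongrightarrow> 0"
  proof (rule LIMSEQ_I)
    fix e :: real assume "e > 0"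
    then obtain n0 where n0: "\<And>m n. m \<ge> n0 \<Longrightarrow> n \<ge> n0 \<Longrightarrow> norm_L2 M (\<lambda>x. F m x - F n x) < e/2"
      using Cauchy[of "e/2"] by auto
    have "norm_L2 M (\<lambda>x. F m x - g x) \<le> e/2" if "m \<ge> n0" for m
      using norm_L2_le_nn_integral(2)[OF _ close[OF that n0]] \<open>e > 0\<close> by auto
    then show "\<exists>no. \<forall>n\<ge>no. norm (norm_L2 M (\<lambda>x. F n x - g x) - 0) < e"
      using \<open>e > 0\<close> by (intro exI[of _ n0]) (force intro: le_less_trans)
  qed
  ultimately show ?thesis by blast
qed

section \<open>Orthogonal series and projections\<close>

lemma L2_sums_inner:
  assumes "L2_sums M u g" "h \<in> L2 M"
  shows "(\<lambda>k. L2_inner M (u k) h) sums L2_inner M g h"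
  unfolding sums_def
proof (rule LIM_zero_cancel, rule Lim_null_comparison)
  have u: "\<And>k. u k \<in> L2 M" and g: "g \<in> L2 M"
    and lim: "(\<lambda>n. norm_L2 M (\<lambda>x. (\<Sum>k<n. u k x) - g x)) \<longlonglongrightarrow> 0"
    using assms by (auto simp: L2_sums_def)
  show "\<forall>\<^sub>F n in sequentially. norm ((\<Sum>k<n. L2_inner M (u k) h) - L2_inner M g h)
      \<le> norm_L2 M (\<lambda>x. (\<Sum>k<n. u k x) - g x) * norm_L2 M h"
  proof (rule always_eventually, rule allI)
    fix n
    have "(\<Sum>k<n. L2_inner M (u k) h) - L2_inner M g h = L2_inner M (\<lambda>x. (\<Sum>k<n. u k x) - g x) h"
      using u g assms(2) by (simp add: L2_inner_diff_left L2_sum L2_inner_sum_left)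
    then show "norm ((\<Sum>k<n. L2_inner M (u k) h) - L2_inner M g h)
      \<le> norm_L2 M (\<lambda>x. (\<Sum>k<n. u k x) - g x) * norm_L2 M h"
      using u g assms(2) by (simp add: L2_Cauchy_Schwarz L2_diff L2_sum)
  qed
  show "(\<lambda>n. norm_L2 M (\<lambda>x. (\<Sum>k<n. u k x) - g x) * norm_L2 M h) \<longlonglongrightarrow> 0"
    using tendsto_mult_left_zero[OF lim] by simp
qed

lemma L2_sums_L2: "L2_sums M u g \<Longrightarrow> g \<in> L2 M"
  by (simp add: L2_sums_def)

lemma norm_L2_orthogonal_sum:
  assumes "finite A" "\<And>i. i \<in> A \<Longrightarrow> u i \<in> L2 M"
    and "\<And>i j. i \<in> A \<Longrightarrow> j \<in> A \<Longrightarrow> i \<noteq> j \<Longrightarrow> L2_inner M (u i) (u j) = 0"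
  shows "(norm_L2 M (\<lambda>x. \<Sum>i\<in>A. u i x))\<^sup>2 = (\<Sum>i\<in>A. (norm_L2 M (u i))\<^sup>2)"
  using assms
proof (induction A rule: finite_induct)
  case empty
  then show ?case by (simp add: norm_L2_def)
next
  case (insert i A)
  have "L2_inner M (u i) (\<lambda>x. \<Sum>j\<in>A. u j x) = (\<Sum>j\<in>A. L2_inner M (u i) (u j))"
    using insert.prems by (intro L2_inner_sum_right) auto
  also have "\<dots> = 0" using insert.hyps insert.prems by (intro sum.neutral) auto
  finally show ?case using insert by (simp add: norm_L2_add_sq L2_sum)
qed

lemma norm_L2_le_of_limit:
  assumes "\<And>n. F n \<in> L2 M" "g \<in> L2 M" "(\<lambda>n. norm_L2 M (\<lambda>x. F n x - g x)) \<longlonglongrightarrow> 0"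
    and "\<And>n. norm_L2 M (F n) \<le> a n" "a \<longlonglongrightarrow> K"
  shows "norm_L2 M g \<le> K"
proof (rule LIMSEQ_le_const)
  show "(\<lambda>n. norm_L2 M (\<lambda>x. F n x - g x) + a n) \<longlonglongrightarrow> K"
    using tendsto_add[OF assms(3,5)] by simp
  have "norm_L2 M g \<le> norm_L2 M (\<lambda>x. F n x - g x) + a n" for n
    using norm_L2_triangle[OF L2_diff[OF assms(2,1)] assms(1), of n n] assms(4)[of n]
      norm_L2_minus_commute[of M g "F n"] by simp
  then show "\<exists>N. \<forall>n\<ge>N. norm_L2 M g \<le> norm_L2 M (\<lambda>x. F n x - g x) + a n" by blast
qed

lemma L2_orthogonal_series:
  assumes u: "\<And>k. u k \<in> L2 M"
    and orth: "\<And>i j. i \<noteq> j \<Longrightarrow> L2_inner M (u i) (u j) = 0"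
    and bound: "\<And>n. (\<Sum>k<n. (norm_L2 M (u k))\<^sup>2) \<le> K\<^sup>2" and "K \<ge> 0"
  shows "\<exists>g. L2_sums M u g" "L2_sums M u g \<Longrightarrow> norm_L2 M g \<le> K"
proof -
  define F where "F n x = (\<Sum>k<n. u k x)" for n x
  define S where "S n = (\<Sum>k<n. (norm_L2 M (u k))\<^sup>2)" for n
  have F: "F n \<in> L2 M" for n unfolding F_def by (intro L2_sum u)
  have le: "(norm_L2 M (\<lambda>x. F n x - F m x))\<^sup>2 = S n - S m" if "m \<le> n" for m n
  proof -
    have "F n x - F m x = (\<Sum>k=m..<n. u k x)" for x
      unfolding F_def using that by (simp add: sum_diff_nat_ivl lessThan_atLeast0)
    moreover have "S n - S m = (\<Sum>k=m..<n. (norm_L2 M (u k))\<^sup>2)"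
      unfolding S_def using that by (simp add: sum_diff_nat_ivl lessThan_atLeast0)
    ultimately show ?thesis by (simp add: norm_L2_orthogonal_sum u orth)
  qed
  have sq: "(norm_L2 M (\<lambda>x. F m x - F n x))\<^sup>2 \<le> \<bar>S m - S n\<bar>" for m n
    using le[of m n] le[of n m] norm_L2_minus_commute[of M "F m" "F n"] by (cases "m \<le> n") auto
  have "summable (\<lambda>k. (norm_L2 M (u k))\<^sup>2)"
    using bound by (intro bounded_imp_summable[where B = "K\<^sup>2"])
      (auto simp flip: lessThan_Suc_atMost simp del: sum.lessThan_Suc)
  then have "Cauchy S"
    unfolding S_def summable_iff_convergent by (rule convergent_Cauchy)
  have "\<exists>g\<in>L2 M. (\<lambda>n. norm_L2 M (\<lambda>x. F n x - g x)) \<longlonglongrightarrow> 0"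
  proof (rule L2_complete[OF F])
    fix e :: real assume "e > 0"
    then obtain N where N: "\<And>m n. m \<ge> N \<Longrightarrow> n \<ge> N \<Longrightarrow> norm (S m - S n) < e\<^sup>2"
      using CauchyD[OF \<open>Cauchy S\<close>, of "e\<^sup>2"] by auto
    have "norm_L2 M (\<lambda>x. F m x - F n x) < e" if "m \<ge> N" "n \<ge> N" for m n
      using sq[of m n] N[OF that] \<open>e > 0\<close> by (intro power_less_imp_less_base[of _ 2 e]) auto
    then show "\<exists>N. \<forall>m\<ge>N. \<forall>n\<ge>N. norm_L2 M (\<lambda>x. F m x - F n x) < e" by blast
  qed
  then show "\<exists>g. L2_sums M u g" using u by (auto simp: L2_sums_def F_def)
  assume g: "L2_sums M u g"
  have "norm_L2 M (F n) \<le> K" for n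
  proof (rule power2_le_imp_le)
    show "(norm_L2 M (F n))\<^sup>2 \<le> K\<^sup>2"
      using bound[of n] unfolding F_def by (simp add: norm_L2_orthogonal_sum u orth)
  qed fact
  then have *: "\<And>n. norm_L2 M (F n) \<le> K" .
  show "norm_L2 M g \<le> K"
  proof (rule norm_L2_le_of_limit)
    show "F n \<in> L2 M" for n by (rule F)
    show "g \<in> L2 M" using g by (rule L2_sums_L2)
    show "(\<lambda>n. norm_L2 M (\<lambda>x. F n x - g x)) \<longlonglongrightarrow> 0"
      using g by (simp add: L2_sums_def F_def)
    show "norm_L2 M (F n) \<le> K" for n by (rule *)
    show "(\<lambda>_. K) \<longlonglongrightarrow> K" by simp
  qed
qed

text \<open>
  Best approximation from a linear subspace: a minimizing sequence is Cauchy by the parallelogram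
  law, and the error of the limit is orthogonal to the subspace.
\<close>

lemma L2_orthogonal_projection:
  assumes V: "V \<subseteq> L2 M" "V \<noteq> {}"
    and lin: "\<And>v w a b. v \<in> V \<Longrightarrow> w \<in> V \<Longrightarrow> (\<lambda>x. a * v x + b * w x) \<in> V"
    and f: "f \<in> L2 M"
  shows "\<exists>p\<in>L2 M. (\<forall>e>0. \<exists>v\<in>V. norm_L2 M (\<lambda>x. p x - v x) < e) \<and>
    (\<forall>v\<in>V. L2_inner M (\<lambda>x. f x - p x) v = 0)"
proof -
  define d where "d = (INF v\<in>V. norm_L2 M (\<lambda>x. f x - v x))"
  have bdd: "bdd_below ((\<lambda>v. norm_L2 M (\<lambda>x. f x - v x)) ` V)"
    by (rule bdd_belowI[of _ 0]) auto
  have d: "d \<le> norm_L2 M (\<lambda>x. f x - v x)" if "v \<in> V" for v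
    unfolding d_def by (rule cINF_lower[OF bdd that])
  have d0: "d \<ge> 0" unfolding d_def using V by (intro cINF_greatest) auto
  have "\<exists>v\<in>V. norm_L2 M (\<lambda>x. f x - v x) < d + 1 / real (Suc n)" for n
    using cInf_lessD[of "(\<lambda>v. norm_L2 M (\<lambda>x. f x - v x)) ` V" "d + 1 / real (Suc n)"] V
    unfolding d_def by auto
  then obtain v where vV: "\<And>n. v n \<in> V" and v: "\<And>n. norm_L2 M (\<lambda>x. f x - v n x) < d + 1 / real (Suc n)"
    by metis
  have vL: "v n \<in> L2 M" for n using vV V by auto
  have para: "(norm_L2 M (\<lambda>x. v m x - v n x))\<^sup>2 \<le> 2 * (d + 1 / real (Suc m))\<^sup>2 + 2 * (d + 1 / real (Suc n))\<^sup>2 - 4 * d\<^sup>2"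
    for m n
  proof -
    let ?a = "\<lambda>x. f x - v m x" and ?b = "\<lambda>x. f x - v n x"
    have ab: "?a \<in> L2 M" "?b \<in> L2 M" using f vL by (auto intro: L2_diff)
    have "(norm_L2 M (\<lambda>x. ?b x - ?a x))\<^sup>2 + (norm_L2 M (\<lambda>x. ?b x + ?a x))\<^sup>2 =
        2 * (norm_L2 M ?a)\<^sup>2 + 2 * (norm_L2 M ?b)\<^sup>2"
      using norm_L2_add_sq[OF ab(2,1)] norm_L2_diff_sq[OF ab(2,1)] by simp
    moreover have "(norm_L2 M ?a)\<^sup>2 \<le> (d + 1 / real (Suc m))\<^sup>2" "(norm_L2 M ?b)\<^sup>2 \<le> (d + 1 / real (Suc n))\<^sup>2"
      using less_imp_le[OF v[of m]] less_imp_le[OF v[of n]] by (auto intro: power_mono simp del: of_nat_Suc)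
    moreover have "2 * d \<le> norm_L2 M (\<lambda>x. ?b x + ?a x)"
    proof -
      have "(\<lambda>x. ?b x + ?a x) = (\<lambda>x. 2 * (f x - (1/2 * v m x + 1/2 * v n x)))"
        by (auto simp: fun_eq_iff algebra_simps)
      then have "norm_L2 M (\<lambda>x. ?b x + ?a x) = 2 * norm_L2 M (\<lambda>x. f x - (1/2 * v m x + 1/2 * v n x))"
        using norm_L2_scale[of M 2 "\<lambda>x. f x - (1/2 * v m x + 1/2 * v n x)"] by (simp only: norm_numeral)
      then show ?thesis using d[OF lin[OF vV vV, of "1/2" m "1/2" n]] by simp
    qed
    then have "(2 * d)\<^sup>2 \<le> (norm_L2 M (\<lambda>x. ?b x + ?a x))\<^sup>2" using d0 by (intro power_mono) auto
    ultimately show ?thesis by (simp add: power_mult_distrib)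
  qed
  have "\<exists>p\<in>L2 M. (\<lambda>n. norm_L2 M (\<lambda>x. v n x - p x)) \<longlonglongrightarrow> 0"
  proof (rule L2_complete[OF vL])
    fix e :: real assume e: "e > 0"
    have "(\<lambda>n. 2 * (d + 1 / real (Suc n))\<^sup>2 - 2 * d\<^sup>2) \<longlonglongrightarrow> 2 * (d + 0)\<^sup>2 - 2 * d\<^sup>2"
      by (intro tendsto_intros LIMSEQ_Suc lim_1_over_n)
    then have "\<forall>\<^sub>F n in sequentially. 2 * (d + 1 / real (Suc n))\<^sup>2 - 2 * d\<^sup>2 < e\<^sup>2 / 2"
      using e by (intro order_tendstoD(2)[of _ 0]) auto
    then obtain N where N: "\<And>n. n \<ge> N \<Longrightarrow> 2 * (d + 1 / real (Suc n))\<^sup>2 - 2 * d\<^sup>2 < e\<^sup>2 / 2"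
      by (auto simp: eventually_sequentially)
    have "norm_L2 M (\<lambda>x. v m x - v n x) < e" if "m \<ge> N" "n \<ge> N" for m n
    proof (rule power_less_imp_less_base)
      show "(norm_L2 M (\<lambda>x. v m x - v n x))\<^sup>2 < e\<^sup>2"
        using para[of m n] N[OF that(1)] N[OF that(2)] by linarith
    qed (use e in auto)
    then show "\<exists>N. \<forall>m\<ge>N. \<forall>n\<ge>N. norm_L2 M (\<lambda>x. v m x - v n x) < e" by blast
  qed
  then obtain p where p: "p \<in> L2 M" and lim: "(\<lambda>n. norm_L2 M (\<lambda>x. v n x - p x)) \<longlonglongrightarrow> 0" by blast
  define q where "q x = f x - p x" for x
  have q: "q \<in> L2 M" using f p unfolding q_def by (rule L2_diff)
  have "norm_L2 M q \<le> d"
  proof (rule norm_L2_le_of_limit[where F = "\<lambda>n x. f x - v n x" and a = "\<lambda>n. d + 1 / real (Suc n)"])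
    show "(\<lambda>n. norm_L2 M (\<lambda>x. f x - v n x - q x)) \<longlonglongrightarrow> 0"
      using lim norm_L2_minus_commute[of M p "v _"] by (simp add: q_def)
    show "(\<lambda>n. d + 1 / real (Suc n)) \<longlonglongrightarrow> d"
      using tendsto_add[OF tendsto_const LIMSEQ_Suc[OF lim_1_over_n], of d] by simp
  qed (use f vL q v in \<open>auto intro: L2_diff less_imp_le\<close>)
  have "L2_inner M q w = 0" if w: "w \<in> V" for w
  proof -
    have wL: "w \<in> L2 M" using w V by auto
    have ge: "norm_L2 M q \<le> norm_L2 M (\<lambda>x. q x - t * w x)" for t
    proof -
      have "d \<le> norm_L2 M (\<lambda>x. q x - t * w x) + norm_L2 M (\<lambda>x. v n x - p x)" for n
      proof -
        have "d \<le> norm_L2 M (\<lambda>x. f x - (1 * v n x + t * w x))" by (rule d[OF lin[OF vV w]])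
        also have "\<dots> = norm_L2 M (\<lambda>x. (q x - t * w x) - (v n x - p x))"
          by (simp add: q_def algebra_simps)
        also have "\<dots> \<le> norm_L2 M (\<lambda>x. q x - t * w x) + norm_L2 M (\<lambda>x. v n x - p x)"
          using norm_L2_triangle[of "\<lambda>x. q x - t * w x" M "\<lambda>x. -1 * (v n x - p x)"]
            norm_L2_scale[of M "-1" "\<lambda>x. v n x - p x"] L2_scale[of "\<lambda>x. v n x - p x" M "-1"] q wL vL p
          by (simp add: L2_diff L2_scale algebra_simps)
        finally show ?thesis .
      qed
      then have "d \<le> norm_L2 M (\<lambda>x. q x - t * w x) + 0"
        by (intro LIMSEQ_le_const[OF tendsto_add[OF tendsto_const lim]]) auto
      with \<open>norm_L2 M q \<le> d\<close> show ?thesis by simp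
    qed
    show ?thesis
    proof (cases "norm_L2 M w = 0")
      case True
      then show ?thesis using L2_Cauchy_Schwarz[OF q wL] by simp
    next
      case False
      then have n: "norm_L2 M w > 0" by (simp add: less_le)
      define z where "z = L2_inner M q w"
      define t where "t = z / of_real ((norm_L2 M w)\<^sup>2)"
      have ct: "cnj t * z = of_real ((cmod z)\<^sup>2 / (norm_L2 M w)\<^sup>2)"
        using n by (simp add: t_def complex_norm_square mult.commute del: of_real_power)
      have "(norm_L2 M q)\<^sup>2 \<le> (norm_L2 M (\<lambda>x. q x - t * w x))\<^sup>2"
        by (intro power_mono ge) auto
      also have "\<dots> = (norm_L2 M q)\<^sup>2 + (cmod t * norm_L2 M w)\<^sup>2 - 2 * Re (cnj t * z)"
        using q wL by (simp add: norm_L2_diff_sq L2_scale norm_L2_scale L2_inner_scale_right z_def)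
      also have "Re (cnj t * z) = (cmod z)\<^sup>2 / (norm_L2 M w)\<^sup>2" unfolding ct by simp
      also have "(cmod t * norm_L2 M w)\<^sup>2 = (cmod z)\<^sup>2 / (norm_L2 M w)\<^sup>2"
        using n by (simp add: t_def norm_divide norm_mult power2_eq_square)
      finally have "(cmod z)\<^sup>2 / (norm_L2 M w)\<^sup>2 \<le> 0" by simp
      then have "z = 0" using n by (simp add: divide_le_0_iff)
      then show ?thesis by (simp add: z_def)
    qed
  qed
  moreover have "\<exists>w\<in>V. norm_L2 M (\<lambda>x. p x - w x) < e" if e: "e > 0" for e
  proof -
    obtain n where "norm_L2 M (\<lambda>x. v n x - p x) < e"
      using order_tendstoD(2)[OF lim e] by (auto simp: eventually_sequentially)
    then show ?thesis using vV[of n] norm_L2_minus_commute[of M p "v n"]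
      by (intro bexI[of _ "v n"]) simp_all
  qed
  ultimately show ?thesis using p unfolding q_def by (intro bexI[of _ p]) auto
qed

lemma L2_dense_span:
  assumes B: "B \<subseteq> L2 M"
    and total: "\<And>f. f \<in> L2 M \<Longrightarrow> (\<And>b. b \<in> B \<Longrightarrow> L2_inner M f b = 0) \<Longrightarrow> norm_L2 M f = 0"
    and f: "f \<in> L2 M" and e: "e > 0"
  shows "\<exists>F c. finite F \<and> F \<subseteq> B \<and> norm_L2 M (\<lambda>x. f x - (\<Sum>b\<in>F. c b * b x)) < e"
proof -
  define V where "V = {\<lambda>x. \<Sum>b\<in>F. c b * b x | F c. finite F \<and> F \<subseteq> B}"
  have VL: "V \<subseteq> L2 M" using B by (auto simp: V_def intro!: L2_sum L2_scale)
  have lin: "(\<lambda>x. a * v x + b * w x) \<in> V" if v: "v \<in> V" and w: "w \<in> V" for v w a b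
  proof -
    obtain F c where F: "finite F" "F \<subseteq> B" "v = (\<lambda>x. \<Sum>b\<in>F. c b * b x)" using v by (auto simp: V_def)
    obtain G c' where G: "finite G" "G \<subseteq> B" "w = (\<lambda>x. \<Sum>b\<in>G. c' b * b x)" using w by (auto simp: V_def)
    define k where "k y = a * (if y \<in> F then c y else 0) + b * (if y \<in> G then c' y else 0)" for y
    have vF: "v x = (\<Sum>y\<in>F \<union> G. (if y \<in> F then c y else 0) * y x)" for x
      unfolding F(3) by (rule sum.mono_neutral_cong_left) (use F(1) G(1) in auto)
    have wG: "w x = (\<Sum>y\<in>F \<union> G. (if y \<in> G then c' y else 0) * y x)" for x
      unfolding G(3) by (rule sum.mono_neutral_cong_left) (use F(1) G(1) in auto)
    have "a * v x + b * w x = (\<Sum>y\<in>F \<union> G. k y * y x)" for x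
      by (simp add: vF wG k_def sum_distrib_left sum.distrib[symmetric] ring_distribs mult.assoc)
    then have "(\<lambda>x. a * v x + b * w x) = (\<lambda>x. \<Sum>y\<in>F \<union> G. k y * y x)" by (rule ext)
    then show ?thesis unfolding V_def
      by (intro CollectI exI[of _ "F \<union> G"] exI[of _ k]) (simp add: F(1,2) G(1,2))
  qed
  have "V \<noteq> {}" by (auto simp: V_def)
  from L2_orthogonal_projection[OF VL this lin f] obtain p where p: "p \<in> L2 M"
    and p': "(\<forall>e>0. \<exists>v\<in>V. norm_L2 M (\<lambda>x. p x - v x) < e) \<and> (\<forall>v\<in>V. L2_inner M (\<lambda>x. f x - p x) v = 0)"
    by (rule bexE)
  note close = conjunct1[OF p', rule_format] and orth = conjunct2[OF p', rule_format]
  have "b \<in> V" if "b \<in> B" for b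
    unfolding V_def using that by (intro CollectI exI[of _ "{b}"] exI[of _ "\<lambda>_. 1"]) auto
  then have 0: "norm_L2 M (\<lambda>x. f x - p x) = 0"
    by (intro total L2_diff f p orth)
  obtain v where v: "v \<in> V" "norm_L2 M (\<lambda>x. p x - v x) < e" using close[OF e] by blast
  have "norm_L2 M (\<lambda>x. f x - v x) < e"
    using norm_L2_triangle_diff[OF f p, of v] v VL 0 by auto
  moreover obtain F c where "finite F" "F \<subseteq> B" "v = (\<lambda>x. \<Sum>b\<in>F. c b * b x)"
    using v(1) by (auto simp: V_def)
  ultimately show ?thesis by (intro exI[of _ F] exI[of _ c]) simp
qed

section \<open>Operators that are diagonal with respect to orthogonal projections\<close>

text \<open>
  Linearity of the \<open>P k\<close> and their compatibility with almost everywhere equality are consequences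
  of self-adjointness; a relation between inner products is all that has to be known of a
  projection.
\<close>

locale L2_projections =
  fixes M :: "'a measure" and P :: "nat \<Rightarrow> ('a \<Rightarrow> complex) \<Rightarrow> 'a \<Rightarrow> complex"
  assumes P_L2: "f \<in> L2 M \<Longrightarrow> P k f \<in> L2 M"
    and P_adjoint: "f \<in> L2 M \<Longrightarrow> g \<in> L2 M \<Longrightarrow> L2_inner M (P k f) g = L2_inner M f (P k g)"
    and P_inner_P: "f \<in> L2 M \<Longrightarrow> g \<in> L2 M \<Longrightarrow>
      L2_inner M (P j f) (P k g) = (if j = k then L2_inner M (P k f) g else 0)"
begin

lemma P_linear:
  assumes "f \<in> L2 M" "g \<in> L2 M" "h \<in> L2 M"
  shows "L2_inner M (P k (\<lambda>x. a * f x + b * g x)) h = a * L2_inner M (P k f) h + b * L2_inner M (P k g) h"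
  using assms
  by (simp add: P_adjoint L2_inner_add_left L2_inner_scale_left L2_add L2_scale P_L2)

lemma P_norm_sq: "f \<in> L2 M \<Longrightarrow> of_real ((norm_L2 M (P k f))\<^sup>2) = L2_inner M (P k f) f"
  using P_inner_P[of f f k k] L2_inner_self[of M "P k f"] by simp

lemma P_Bessel:
  assumes f: "f \<in> L2 M"
  shows "(\<Sum>k<n. (norm_L2 M (P k f))\<^sup>2) \<le> (norm_L2 M f)\<^sup>2"
proof -
  define g where "g x = (\<Sum>k<n. P k f x)" for x
  have g: "g \<in> L2 M" unfolding g_def by (intro L2_sum P_L2 f)
  have sq: "(norm_L2 M g)\<^sup>2 = (\<Sum>k<n. (norm_L2 M (P k f))\<^sup>2)"
    unfolding g_def by (rule norm_L2_orthogonal_sum) (simp_all add: P_L2 P_inner_P f)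
  have "complex_of_real ((norm_L2 M g)\<^sup>2) = (\<Sum>k<n. L2_inner M (P k f) f)"
    unfolding sq of_real_sum by (intro sum.cong refl P_norm_sq f)
  also have "\<dots> = L2_inner M g f" unfolding g_def using P_L2 f by (simp add: L2_inner_sum_left)
  finally have "(norm_L2 M g)\<^sup>2 = cmod (L2_inner M g f)"
    by (metis norm_of_real abs_of_nonneg zero_le_power2)
  also have "\<dots> \<le> norm_L2 M g * norm_L2 M f" by (rule L2_Cauchy_Schwarz[OF g f])
  finally have "norm_L2 M g \<le> norm_L2 M f"
    by (cases "norm_L2 M g = 0") (auto simp: power2_eq_square less_le)
  then show ?thesis unfolding sq[symmetric] by (intro power_mono) auto
qed

lemma diagonal_sums_exist:
  assumes f: "f \<in> L2 M" and d: "\<And>k. cmod (d k) \<le> K"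
  shows "\<exists>g. L2_sums M (\<lambda>k x. d k * P k f x) g"
    and "L2_sums M (\<lambda>k x. d k * P k f x) g \<Longrightarrow> norm_L2 M g \<le> K * norm_L2 M f"
proof -
  have K: "K \<ge> 0" using d[of 0] norm_ge_zero order_trans by blast
  have u: "(\<lambda>x. d k * P k f x) \<in> L2 M" for k by (intro L2_scale P_L2 f)
  have orth: "L2_inner M (\<lambda>x. d i * P i f x) (\<lambda>x. d j * P j f x) = 0" if "i \<noteq> j" for i j
    using that by (simp add: L2_inner_scale_left L2_inner_scale_right P_inner_P f)
  have bound: "(\<Sum>k<n. (norm_L2 M (\<lambda>x. d k * P k f x))\<^sup>2) \<le> (K * norm_L2 M f)\<^sup>2" for n
  proof -
    have "(\<Sum>k<n. (norm_L2 M (\<lambda>x. d k * P k f x))\<^sup>2) \<le> (\<Sum>k<n. K\<^sup>2 * (norm_L2 M (P k f))\<^sup>2)"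
      unfolding norm_L2_scale power_mult_distrib
      by (intro sum_mono mult_right_mono power_mono d) auto
    also have "\<dots> \<le> K\<^sup>2 * (norm_L2 M f)\<^sup>2"
      unfolding sum_distrib_left[symmetric] by (intro mult_left_mono P_Bessel f) auto
    finally show ?thesis by (simp add: power_mult_distrib)
  qed
  have nn: "K * norm_L2 M f \<ge> 0" using K by simp
  show "\<exists>g. L2_sums M (\<lambda>k x. d k * P k f x) g"
    by (rule L2_orthogonal_series(1)[OF u orth bound nn])
  show "norm_L2 M g \<le> K * norm_L2 M f" if "L2_sums M (\<lambda>k x. d k * P k f x) g"
    by (rule L2_orthogonal_series(2)[OF u orth bound nn that])
qed

lemma diagonal_inner:
  assumes "L2_sums M (\<lambda>k x. d k * P k f x) g" "h \<in> L2 M"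
  shows "(\<lambda>k. d k * L2_inner M (P k f) h) sums L2_inner M g h"
  using L2_sums_inner[OF assms] by (simp add: L2_inner_scale_left)

lemma diagonal_inner_P:
  assumes "L2_sums M (\<lambda>k x. d k * P k f x) g" "f \<in> L2 M" "h \<in> L2 M"
  shows "L2_inner M g (P j h) = d j * L2_inner M (P j f) h"
proof -
  have "(\<lambda>k. d k * L2_inner M (P k f) (P j h)) sums L2_inner M g (P j h)"
    by (rule diagonal_inner[OF assms(1) P_L2[OF assms(3)]])
  moreover have "d k * L2_inner M (P k f) (P j h) = (if k = j then d j * L2_inner M (P j f) h else 0)" for k
    using assms by (simp add: P_inner_P)
  ultimately have "(\<lambda>k. if k = j then d j * L2_inner M (P j f) h else 0) sums L2_inner M g (P j h)"
    by simp
  then show ?thesis using sums_single[of j "\<lambda>_. d j * L2_inner M (P j f) h"] sums_unique2 by blast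
qed

end

locale L2_diagonal_operator = L2_projections M P
  for M :: "'a measure" and P :: "nat \<Rightarrow> ('a \<Rightarrow> complex) \<Rightarrow> 'a \<Rightarrow> complex" +
  fixes c :: "nat \<Rightarrow> real" and T :: "('a \<Rightarrow> complex) \<Rightarrow> 'a \<Rightarrow> complex"
  assumes T_sums: "f \<in> L2 M \<Longrightarrow> L2_sums M (\<lambda>k x. of_real (c k) * P k f x) (T f)"
    and P_nonzero: "\<exists>f\<in>L2 M. norm_L2 M (P k f) \<noteq> 0"
    and common_kernel: "\<exists>f\<in>L2 M. norm_L2 M f \<noteq> 0 \<and> (\<forall>k. norm_L2 M (P k f) = 0)"
    and c_bounded: "\<exists>K. \<forall>k. \<bar>c k\<bar> \<le> K"
begin

lemma T_L2: "f \<in> L2 M \<Longrightarrow> T f \<in> L2 M"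
  using T_sums L2_sums_L2 by blast

lemma T_inner_P:
  "f \<in> L2 M \<Longrightarrow> h \<in> L2 M \<Longrightarrow> L2_inner M (T f) (P k h) = of_real (c k) * L2_inner M (P k f) h"
  by (rule diagonal_inner_P[OF T_sums])

lemma T_inner:
  "f \<in> L2 M \<Longrightarrow> h \<in> L2 M \<Longrightarrow> (\<lambda>k. of_real (c k) * L2_inner M (P k f) h) sums L2_inner M (T f) h"
  by (rule diagonal_inner[OF T_sums])

lemma inner_eq_0: "f \<in> L2 M \<Longrightarrow> h \<in> L2 M \<Longrightarrow> norm_L2 M f = 0 \<Longrightarrow> L2_inner M f h = 0"
  using L2_Cauchy_Schwarz[of f M h] by simp

lemma T_eigen_range:
  assumes b: "b \<in> L2 M" and bP: "AE x in M. P k b x = b x"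
  shows "AE x in M. T b x = of_real (c k) * b x"
proof (rule L2_eqI_inner)
  fix h assume h: "h \<in> L2 M"
  have "of_real (c j) * L2_inner M (P j b) h = (if j = k then of_real (c k) * L2_inner M b h else 0)" for j
  proof -
    note meas = L2_measurable[OF b] L2_measurable[OF P_L2[OF b]] L2_measurable[OF P_L2[OF h]]
    have "L2_inner M (P j b) h = L2_inner M b (P j h)" using b h by (rule P_adjoint)
    also have "\<dots> = L2_inner M (P k b) (P j h)"
      using bP by (intro L2_inner_cong meas) (auto elim: eventually_mono)
    also have "\<dots> = (if j = k then L2_inner M (P k b) h else 0)"
      using b h by (simp add: P_inner_P)
    also have "L2_inner M (P k b) h = L2_inner M b h"
      using bP by (intro L2_inner_cong meas L2_measurable[OF h]) auto
    finally show ?thesis by simp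
  qed
  then have "(\<lambda>j. if j = k then of_real (c k) * L2_inner M b h else 0) sums L2_inner M (T b) h"
    using T_inner[OF b h] by simp
  then have "L2_inner M (T b) h = of_real (c k) * L2_inner M b h"
    using sums_single[of k "\<lambda>_. of_real (c k) * L2_inner M b h"] sums_unique2 by blast
  then show "L2_inner M (T b) h = L2_inner M (\<lambda>x. of_real (c k) * b x) h"
    by (simp add: L2_inner_scale_left)
qed (use b in \<open>auto intro: T_L2 L2_scale\<close>)

lemma T_eigen_kernel:
  assumes b: "b \<in> L2 M" and bP: "\<And>k. norm_L2 M (P k b) = 0"
  shows "AE x in M. T b x = 0"
proof (rule L2_eqI_inner)
  fix h assume h: "h \<in> L2 M"
  have "L2_inner M (P k b) h = 0" for k using inner_eq_0[OF P_L2[OF b] h bP] .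
  then have "(\<lambda>k. 0) sums L2_inner M (T b) h" using T_inner[OF b h] by simp
  from sums_unique2[OF sums_zero this] show "L2_inner M (T b) h = L2_inner M (\<lambda>x. 0) h"
    by simp
qed (use b in \<open>auto intro: T_L2\<close>)

lemma P_idem: "f \<in> L2 M \<Longrightarrow> AE x in M. P k (P k f) x = P k f x"
proof (rule L2_eqI_inner)
  fix h assume "f \<in> L2 M" "h \<in> L2 M"
  then show "L2_inner M (P k (P k f)) h = L2_inner M (P k f) h"
    using P_adjoint[of "P k f" h k] P_inner_P[of f h k k] by (simp add: P_L2)
qed (auto intro: P_L2)

lemma eigenfunction_range:
  assumes "f \<in> L2 M" "norm_L2 M (P k f) \<noteq> 0"
  shows "L2_eigenfunction M T (of_real (c k)) (P k f)"
  using assms norm_L2_eq_0_iff[OF P_L2, of f k] T_eigen_range[OF P_L2 P_idem, of f k]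
  by (simp add: L2_eigenfunction_def P_L2)

lemma point_spectrum: "L2_point_spectrum M T = {0} \<union> {complex_of_real (c k) | k. True}"
proof (rule set_eqI, rule iffI)
  fix z assume "z \<in> L2_point_spectrum M T"
  then obtain f where f: "f \<in> L2 M" and nz: "\<not> (AE x in M. f x = 0)" and Tf: "AE x in M. T f x = z * f x"
    by (auto simp: L2_point_spectrum_def L2_eigenfunction_def)
  show "z \<in> {0} \<union> {complex_of_real (c k) | k. True}"
  proof (rule ccontr)
    assume not: "z \<notin> {0} \<union> {complex_of_real (c k) | k. True}"
    have eq: "L2_inner M (T f) h = z * L2_inner M f h" if "h \<in> L2 M" for h
    proof -
      have "L2_inner M (T f) h = L2_inner M (\<lambda>x. z * f x) h"
        using Tf that f by (intro L2_inner_cong L2_measurable T_L2 L2_scale) auto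
      then show ?thesis by (simp add: L2_inner_scale_left)
    qed
    have "L2_inner M (P k f) f = 0" for k
      using eq[OF P_L2[OF f], of k] T_inner_P[OF f f, of k] P_adjoint[OF f f, of k] not by auto
    then have "norm_L2 M (P k f) = 0" for k
      using P_norm_sq[OF f, of k] by simp
    from T_eigen_kernel[OF f this] have "AE x in M. T f x = 0" .
    moreover have "z \<noteq> 0" using not by blast
    then have "AE x in M. z \<noteq> 0" by simp
    ultimately have "AE x in M. f x = 0" using Tf by eventually_elim simp
    then show False using nz by contradiction
  qed
next
  fix z assume "z \<in> {0} \<union> {complex_of_real (c k) | k. True}"
  then consider "z = 0" | k where "z = of_real (c k)" by auto
  then show "z \<in> L2_point_spectrum M T"
  proof cases
    case 1
    obtain f where f: "f \<in> L2 M" "norm_L2 M f \<noteq> 0" "\<And>k. norm_L2 M (P k f) = 0"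
      using common_kernel by blast
    then have "L2_eigenfunction M T 0 f"
      using norm_L2_eq_0_iff[of f M] T_eigen_kernel[of f] by (simp add: L2_eigenfunction_def)
    then show ?thesis unfolding 1 L2_point_spectrum_def by blast
  next
    case 2
    obtain f where f: "f \<in> L2 M" "norm_L2 M (P k f) \<noteq> 0" using P_nonzero[of k] by blast
    show ?thesis unfolding 2 L2_point_spectrum_def using eigenfunction_range[OF f] by blast
  qed
qed

text \<open>
  If \<open>T - z\<close> has an inverse with bound \<open>K\<close>, testing it on eigenfunctions gives \<open>1 \<le> K * dist w z\<close> for
  every eigenvalue \<open>w\<close>, so \<open>z\<close> is not in the closure. Conversely, outside the closure the diagonal
  operator with the inverse entries is bounded.
\<close>

lemma spectrum: "L2_spectrum M T = closure ({0} \<union> {complex_of_real (c k) | k. True})"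
    (is "_ = closure ?S")
proof (rule set_eqI, rule iffI)
  fix z assume z: "z \<in> closure ?S"
  show "z \<in> L2_spectrum M T" unfolding L2_spectrum_def
  proof (safe)
    fix R assume R: "L2_bounded_operator M R"
      and inv: "\<forall>f\<in>L2 M. (AE x in M. R (\<lambda>y. T f y - z * f y) x = f x) \<and> (AE x in M. T (R f) x - z * R f x = f x)"
    obtain K where K: "\<And>f. f \<in> L2 M \<Longrightarrow> norm_L2 M (R f) \<le> K * norm_L2 M f"
      and RL: "\<And>f. f \<in> L2 M \<Longrightarrow> R f \<in> L2 M"
      using R unfolding L2_bounded_operator_def by blast
    have est: "1 \<le> \<bar>K\<bar> * dist w z" if "w \<in> ?S" for w
    proof -
      obtain f where f: "f \<in> L2 M" "\<not> (AE x in M. f x = 0)" "AE x in M. T f x = w * f x"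
        using \<open>w \<in> ?S\<close> unfolding point_spectrum[symmetric]
        by (auto simp: L2_point_spectrum_def L2_eigenfunction_def)
      define q where "q y = T f y - z * f y" for y
      have q: "q \<in> L2 M" unfolding q_def using f by (intro L2_diff L2_scale T_L2)
      have "norm_L2 M f = norm_L2 M (R q)"
        using inv f RL[OF q] by (intro norm_L2_cong L2_measurable) (auto simp: q_def[abs_def] elim: eventually_mono)
      also have "\<dots> \<le> K * norm_L2 M q" by (rule K[OF q])
      also have "norm_L2 M q = norm_L2 M (\<lambda>x. (w - z) * f x)"
        using f(3) by (intro norm_L2_cong L2_measurable q L2_scale f(1))
          (auto simp: q_def ring_distribs elim: eventually_mono)
      also have "\<dots> = dist w z * norm_L2 M f" by (simp add: norm_L2_scale dist_norm)
      also have "K * (dist w z * norm_L2 M f) \<le> (\<bar>K\<bar> * dist w z) * norm_L2 M f"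
        unfolding mult.assoc by (intro mult_right_mono) auto
      finally show ?thesis using f(1,2) norm_L2_eq_0_iff[of f M]
        by (auto simp: less_le)
    qed
    have "\<bar>K\<bar> + 1 > 0" by simp
    then obtain w where "w \<in> ?S" "dist w z < 1 / (\<bar>K\<bar> + 1)"
      using z unfolding closure_approachable by (meson zero_less_divide_1_iff)
    then have "\<bar>K\<bar> * dist w z < 1"
      by (simp add: field_simps) (smt (verit) zero_le_dist mult_nonneg_nonneg)
    with est[OF \<open>w \<in> ?S\<close>] show False by simp
  qed
next
  fix z assume "z \<in> L2_spectrum M T"
  show "z \<in> closure ?S"
  proof (rule ccontr)
    assume "z \<notin> closure ?S"
    then obtain \<delta> where "\<delta> > 0" and \<delta>: "\<And>w. w \<in> ?S \<Longrightarrow> \<delta> \<le> dist w z"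
      unfolding closure_approachable by (meson not_less)
    have z0: "z \<noteq> 0" using \<delta>[of 0] \<open>\<delta> > 0\<close> by auto
    have gap: "\<delta> \<le> cmod (of_real (c k) - z)" for k using \<delta>[of "of_real (c k)"] by (auto simp: dist_norm)
    have zc: "of_real (c k) - z \<noteq> 0" for k using gap[of k] \<open>\<delta> > 0\<close> by auto
    obtain K where K: "\<And>k. \<bar>c k\<bar> \<le> K" using c_bounded by blast
    have "K \<ge> 0" using K[of 0] by linarith
    (* (T - z)^{-1} is -1/z on the common kernel and 1/(c k - z) on the range of P k. *)
    define d where "d k = of_real (c k) / (z * (of_real (c k) - z))" for k
    have d: "cmod (d k) \<le> K / (cmod z * \<delta>)" for k
      unfolding d_def norm_divide norm_mult norm_of_real
      using K[of k] gap[of k] z0 \<open>\<delta> > 0\<close> \<open>K \<ge> 0\<close> by (intro frac_le mult_left_mono mult_pos_pos) auto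
    define D where "D f = (SOME g. L2_sums M (\<lambda>k x. d k * P k f x) g)" for f
    have D: "L2_sums M (\<lambda>k x. d k * P k f x) (D f)" if "f \<in> L2 M" for f
      unfolding D_def by (rule someI_ex[OF diagonal_sums_exist(1)[OF that d]])
    note DL = L2_sums_L2[OF D]
    have D_inner: "(\<lambda>k. d k * L2_inner M (P k f) h) sums L2_inner M (D f) h"
      if "f \<in> L2 M" "h \<in> L2 M" for f h by (rule diagonal_inner[OF D that(2)]) fact
    define R where "R f x = - (1 / z) * f x + 1 * D f x" for f x
    have RL: "R f \<in> L2 M" if "f \<in> L2 M" for f
      unfolding R_def[abs_def] using that by (intro L2_add L2_scale DL)
    have R_inner: "L2_inner M (R f) h = - (1 / z) * L2_inner M f h + L2_inner M (D f) h"
      if "f \<in> L2 M" "h \<in> L2 M" for f h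
      unfolding R_def[abs_def] using that DL[OF that(1)]
      by (simp only: L2_inner_add_left L2_inner_scale_left L2_scale mult_1)
    have R_inner_P: "L2_inner M (R f) (P k h) = L2_inner M (P k f) h / (of_real (c k) - z)"
      if "f \<in> L2 M" "h \<in> L2 M" for f h k
    proof -
      have "L2_inner M (R f) (P k h) = - (1 / z) * L2_inner M (P k f) h + d k * L2_inner M (P k f) h"
        using that by (simp add: R_inner P_L2 P_adjoint diagonal_inner_P[OF D])
      also have "\<dots> = L2_inner M (P k f) h / (of_real (c k) - z)"
        using z0 zc[of k] by (simp add: d_def field_simps)
      finally show ?thesis .
    qed
    have bounded: "L2_bounded_operator M R" unfolding L2_bounded_operator_def
    proof (intro conjI ballI allI)
      fix f g a b assume f: "f \<in> L2 M" and g: "g \<in> L2 M"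
      let ?c = "\<lambda>y. a * f y + b * g y"
      have c: "?c \<in> L2 M" using f g by (intro L2_add L2_scale)
      show "AE x in M. R ?c x = a * R f x + b * R g x"
      proof (rule L2_eqI_inner)
        fix h assume h: "h \<in> L2 M"
        have "(\<lambda>k. a * (d k * L2_inner M (P k f) h) + b * (d k * L2_inner M (P k g) h))
            sums (a * L2_inner M (D f) h + b * L2_inner M (D g) h)"
          by (intro sums_add sums_mult D_inner f g h)
        moreover have "a * (d k * L2_inner M (P k f) h) + b * (d k * L2_inner M (P k g) h) =
            d k * L2_inner M (P k ?c) h" for k
          unfolding P_linear[OF f g h] by (simp add: algebra_simps)
        ultimately have "(\<lambda>k. d k * L2_inner M (P k ?c) h)
            sums (a * L2_inner M (D f) h + b * L2_inner M (D g) h)" by simp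
        from sums_unique2[OF D_inner[OF c h] this]
        have "L2_inner M (D ?c) h = a * L2_inner M (D f) h + b * L2_inner M (D g) h" .
        then show "L2_inner M (R ?c) h = L2_inner M (\<lambda>x. a * R f x + b * R g x) h"
          using f g h c RL[OF f] RL[OF g]
          by (simp add: R_inner L2_inner_add_left L2_inner_scale_left L2_scale algebra_simps)
      qed (intro RL c L2_add L2_scale f g)+
    next
      let ?K = "1 / cmod z + K / (cmod z * \<delta>)"
      have "norm_L2 M (R f) \<le> ?K * norm_L2 M f" if f: "f \<in> L2 M" for f
        using norm_L2_triangle[OF L2_scale[OF f] L2_scale[OF DL[OF f]], of "- (1 / z)" 1]
          diagonal_sums_exist(2)[OF f d D[OF f]]
        unfolding R_def[abs_def] norm_L2_scale by (simp add: norm_divide ring_distribs)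
      then show "\<exists>K. \<forall>f\<in>L2 M. norm_L2 M (R f) \<le> K * norm_L2 M f" by blast
    qed (rule RL)
    have "z \<notin> L2_spectrum M T" unfolding L2_spectrum_def mem_Collect_eq not_not
    proof (intro exI[of _ R] conjI bounded ballI)
      fix f assume f: "f \<in> L2 M"
      let ?q = "\<lambda>y. T f y - z * f y"
      have q: "?q \<in> L2 M" using f by (intro L2_diff L2_scale T_L2)
      show "AE x in M. R ?q x = f x"
      proof (rule L2_eqI_inner)
        fix h assume h: "h \<in> L2 M"
        have Pq: "L2_inner M (P k ?q) h = (of_real (c k) - z) * L2_inner M (P k f) h" for k
          using q f h T_inner_P[OF f h]
          by (simp add: P_adjoint L2_inner_diff_left T_L2 L2_scale L2_inner_scale_left P_L2 ring_distribs)
        have "(\<lambda>k. of_real (c k) * L2_inner M (P k f) h / z) sums (L2_inner M (T f) h / z)"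
          by (intro sums_divide T_inner f h)
        moreover have "of_real (c k) * L2_inner M (P k f) h / z = d k * L2_inner M (P k ?q) h" for k
          unfolding Pq d_def using z0 zc[of k] by (simp add: field_simps)
        ultimately have "(\<lambda>k. d k * L2_inner M (P k ?q) h) sums (L2_inner M (T f) h / z)" by simp
        from sums_unique2[OF D_inner[OF q h] this] have "L2_inner M (D ?q) h = L2_inner M (T f) h / z" .
        then show "L2_inner M (R ?q) h = L2_inner M f h"
          using z0 f h by (simp add: R_inner[OF q h] L2_inner_diff_left L2_inner_scale_left T_L2 L2_scale field_simps)
      qed (intro RL q f)+
      show "AE x in M. T (R f) x - z * R f x = f x"
      proof (rule L2_eqI_inner)
        fix h assume h: "h \<in> L2 M"
        have PR: "L2_inner M (P k (R f)) h = L2_inner M (P k f) h / (of_real (c k) - z)" for k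
          using R_inner_P[OF f h] by (simp add: P_adjoint[OF RL[OF f] h])
        have "(\<lambda>k. z * (d k * L2_inner M (P k f) h)) sums (z * L2_inner M (D f) h)"
          by (intro sums_mult D_inner f h)
        moreover have "z * (d k * L2_inner M (P k f) h) = of_real (c k) * L2_inner M (P k (R f)) h" for k
          unfolding PR d_def using z0 zc[of k] by (simp add: field_simps)
        ultimately have "(\<lambda>k. of_real (c k) * L2_inner M (P k (R f)) h) sums (z * L2_inner M (D f) h)" by simp
        from sums_unique2[OF T_inner[OF RL[OF f] h] this] have "L2_inner M (T (R f)) h = z * L2_inner M (D f) h" .
        then show "L2_inner M (\<lambda>x. T (R f) x - z * R f x) h = L2_inner M f h"
          using z0 f h RL[OF f]
          by (simp add: R_inner L2_inner_diff_left L2_inner_scale_left T_L2 L2_scale field_simps)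
      qed (intro RL f L2_diff L2_scale T_L2)+
    qed
    then show False using \<open>z \<in> L2_spectrum M T\<close> by contradiction
  qed
qed

text \<open>
  Maximality is taken among orthogonal sets of eigenfunctions that lie in the range of one projection
  or in the common kernel of all of them. These conditions are respected by every \<open>P k\<close>, so a function
  \<open>f\<close> that is orthogonal to the set has all its \<open>P k f\<close> orthogonal to it as well. Arbitrary
  eigenfunctions would not do: if two of the \<open>c k\<close> coincide, they mix different ranges.
\<close>

lemma orthogonal_basis:
  "\<exists>B. L2_orthogonal_basis M B \<and> (\<forall>b\<in>B. \<exists>z. L2_eigenfunction M T z b)"
proof -
  define E where "E = {b \<in> L2 M. \<not> (AE x in M. b x = 0) \<and>
    ((\<exists>k. AE x in M. P k b x = b x) \<or> (\<forall>k. norm_L2 M (P k b) = 0))}"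
  define \<O> where "\<O> = {B. B \<subseteq> E \<and> (\<forall>b\<in>B. \<forall>b'\<in>B. b \<noteq> b' \<longrightarrow> L2_inner M b b' = 0)}"
  have "\<exists>B\<in>\<O>. \<forall>X\<in>\<O>. B \<subseteq> X \<longrightarrow> X = B"
  proof (rule subset_Zorn_nonempty)
    show "\<O> \<noteq> {}" by (auto simp: \<O>_def)
    fix C assume C: "C \<noteq> {}" "subset.chain \<O> C"
    have "L2_inner M b b' = 0" if bX: "b \<in> X" "X \<in> C" "b' \<in> Y" "Y \<in> C" and ne: "b \<noteq> b'" for b b' X Y
    proof -
      have "X \<subseteq> Y \<or> Y \<subseteq> X" using C(2) bX by (auto simp: subset_chain_def)
      then obtain Z where "Z \<in> C" "b \<in> Z" "b' \<in> Z" using bX by blast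
      then show ?thesis using C(2) ne by (auto simp: subset_chain_def \<O>_def)
    qed
    moreover have "\<Union>C \<subseteq> E" using C(2) by (auto simp: subset_chain_def \<O>_def)
    ultimately show "\<Union>C \<in> \<O>" unfolding \<O>_def by blast
  qed
  then obtain B where B: "B \<in> \<O>" and max: "\<And>X. X \<in> \<O> \<Longrightarrow> B \<subseteq> X \<Longrightarrow> X = B" by blast
  have BE: "B \<subseteq> E" and BL: "B \<subseteq> L2 M" using B by (auto simp: \<O>_def E_def)
  have no_more: False if f: "f \<in> E" and orth: "\<And>b. b \<in> B \<Longrightarrow> L2_inner M f b = 0" for f
  proof -
    have "insert f B \<in> \<O>"
      using B f orth L2_inner_cnj[of M f] unfolding \<O>_def
      by (auto simp: E_def) (metis complex_cnj_zero)+
    then have "f \<in> B" using max by blast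
    then have "L2_inner M f f = 0" using orth by blast
    then have "norm_L2 M f = 0" by (simp add: L2_inner_self)
    then show False using f norm_L2_eq_0_iff[of f M] by (simp add: E_def)
  qed
  have total: "norm_L2 M f = 0" if f: "f \<in> L2 M" and orth: "\<And>b. b \<in> B \<Longrightarrow> L2_inner M f b = 0" for f
  proof (rule ccontr)
    assume nz: "norm_L2 M f \<noteq> 0"
    have Pb: "L2_inner M (P k f) b = 0" if b: "b \<in> B" for k b
    proof -
      have bL: "b \<in> L2 M" using b BL by auto
      consider j where "AE x in M. P j b x = b x" | "\<And>k. norm_L2 M (P k b) = 0"
        using b BE unfolding E_def by blast
      then show ?thesis
      proof cases
        case 1
        have "L2_inner M (P k f) b = L2_inner M (P k f) (P j b)"
          using 1 f bL by (intro L2_inner_cong L2_measurable P_L2) (auto elim: eventually_mono)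
        also have "\<dots> = (if k = j then L2_inner M (P j f) b else 0)" using f bL by (simp add: P_inner_P)
        also have "L2_inner M (P j f) b = L2_inner M f (P j b)" using f bL by (rule P_adjoint)
        also have "\<dots> = L2_inner M f b"
          using 1 f bL by (intro L2_inner_cong L2_measurable P_L2) auto
        finally show ?thesis using orth[OF b] by (simp split: if_splits)
      next
        case 2
        have "L2_inner M (P k f) b = L2_inner M f (P k b)" using f bL by (rule P_adjoint)
        then show ?thesis using L2_Cauchy_Schwarz[OF f P_L2[OF bL], of k] 2[of k] by simp
      qed
    qed
    show False
    proof (cases "\<forall>k. norm_L2 M (P k f) = 0")
      case True
      then have "f \<in> E" using f nz norm_L2_eq_0_iff[OF f] by (simp add: E_def)
      then show False using no_more orth by blast
    next
      case False
      then obtain k where k: "norm_L2 M (P k f) \<noteq> 0" by blast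
      have "P k f \<in> E"
        using k P_L2[OF f] P_idem[OF f] norm_L2_eq_0_iff[OF P_L2[OF f]] unfolding E_def by blast
      then show False using no_more Pb by blast
    qed
  qed
  have "L2_orthogonal_basis M B" unfolding L2_orthogonal_basis_def
  proof (intro conjI ballI allI impI)
    show "\<not> (AE x in M. b x = 0)" if "b \<in> B" for b using that BE by (auto simp: E_def)
    show "L2_inner M b b' = 0" if "b \<in> B" "b' \<in> B" "b \<noteq> b'" for b b' using that B by (auto simp: \<O>_def)
    show "\<exists>F c. finite F \<and> F \<subseteq> B \<and> norm_L2 M (\<lambda>x. f x - (\<Sum>b\<in>F. c b * b x)) < e"
      if "f \<in> L2 M" "0 < e" for f e using L2_dense_span[OF BL total that] .
  qed (rule BL)
  moreover have "\<exists>z. L2_eigenfunction M T z b" if "b \<in> B" for b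
  proof -
    have b: "b \<in> E" using that BE by auto
    then have bL: "b \<in> L2 M" and nz: "\<not> (AE x in M. b x = 0)" by (auto simp: E_def)
    have "\<exists>z. AE x in M. T b x = z * b x"
    proof (cases "\<forall>k. norm_L2 M (P k b) = 0")
      case True
      then have "AE x in M. T b x = 0 * b x" using T_eigen_kernel[OF bL] by simp
      then show ?thesis by blast
    next
      case False
      then obtain k where "AE x in M. P k b x = b x" using b by (auto simp: E_def)
      then show ?thesis using T_eigen_range[OF bL] by blast
    qed
    then show ?thesis using bL nz by (auto simp: L2_eigenfunction_def)
  qed
  ultimately show ?thesis by blast
qed

end

section \<open>Sums of multiples of partial isometries\<close>

lemma L2_sums_cong_AE:
  assumes "L2_sums M u g" "\<And>k. v k \<in> L2 M" "\<And>k. AE x in M. u k x = v k x"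
    and "g' \<in> L2 M" "AE x in M. g x = g' x"
  shows "L2_sums M v g'"
proof -
  have u: "\<And>k. u k \<in> L2 M" and g: "g \<in> L2 M"
    and lim: "(\<lambda>n. norm_L2 M (\<lambda>x. (\<Sum>k<n. u k x) - g x)) \<longlonglongrightarrow> 0"
    using assms(1) by (simp_all add: L2_sums_def)
  have "AE x in M. \<forall>k. u k x = v k x" using assms(3) by (simp add: AE_all_countable)
  then have "AE x in M. (\<Sum>k<n. u k x) - g x = (\<Sum>k<n. v k x) - g' x" for n
    using assms(5) by eventually_elim simp
  then have "norm_L2 M (\<lambda>x. (\<Sum>k<n. u k x) - g x) = norm_L2 M (\<lambda>x. (\<Sum>k<n. v k x) - g' x)" for n
    by (intro norm_L2_cong L2_measurable L2_diff L2_sum u g assms(2,4))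
  then show ?thesis using lim assms(2,4) by (simp add: L2_sums_def)
qed

text \<open>
  The relation \<open>S S' S = C S\<close> for an operator with adjoint \<open>S'\<close> says that \<open>S / sqrt C\<close> is a partial
  isometry, with initial projection \<open>S' S / C\<close> and final projection \<open>S S' / C\<close>. The orthogonality
  assumptions make these projections orthogonal for different modes.
\<close>

locale L2_modes =
  fixes M :: "'a measure" and S S' :: "nat \<Rightarrow> ('a \<Rightarrow> complex) \<Rightarrow> 'a \<Rightarrow> complex" and C :: "nat \<Rightarrow> real"
  assumes S_L2: "f \<in> L2 M \<Longrightarrow> S k f \<in> L2 M"
    and S'_L2: "f \<in> L2 M \<Longrightarrow> S' k f \<in> L2 M"
    and S_adjoint: "f \<in> L2 M \<Longrightarrow> g \<in> L2 M \<Longrightarrow> L2_inner M (S k f) g = L2_inner M f (S' k g)"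
    and S_orthogonal: "f \<in> L2 M \<Longrightarrow> g \<in> L2 M \<Longrightarrow> j \<noteq> k \<Longrightarrow> L2_inner M (S j f) (S k g) = 0"
    and S'_orthogonal: "f \<in> L2 M \<Longrightarrow> g \<in> L2 M \<Longrightarrow> j \<noteq> k \<Longrightarrow> L2_inner M (S' j f) (S' k g) = 0"
    and S_S'_S: "f \<in> L2 M \<Longrightarrow> g \<in> L2 M \<Longrightarrow>
      L2_inner M (S k (S' k (S k f))) g = of_real (C k) * L2_inner M (S k f) g"
    and C_pos: "C k > 0" and C_bounded: "\<exists>K. \<forall>k. C k \<le> K"
    and S_nonzero: "\<exists>f\<in>L2 M. norm_L2 M (S k f) \<noteq> 0"
    and common_kernel: "\<exists>f\<in>L2 M. norm_L2 M f \<noteq> 0 \<and> (\<forall>k. norm_L2 M (S k f) = 0 \<and> norm_L2 M (S' k f) = 0)"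
begin

lemma S'_adjoint: "f \<in> L2 M \<Longrightarrow> g \<in> L2 M \<Longrightarrow> L2_inner M (S' k f) g = L2_inner M f (S k g)"
  using S_adjoint[of g f k] by (metis L2_inner_cnj)

lemma dual: "L2_modes M S' S C"
proof
  fix f g k assume f: "f \<in> L2 M" and g: "g \<in> L2 M"
  have "L2_inner M (S' k (S k (S' k f))) g = L2_inner M f (S k (S' k (S k g)))"
    using f g by (simp add: S_adjoint S'_adjoint S_L2 S'_L2)
  also have "\<dots> = cnj (of_real (C k) * L2_inner M (S k g) f)"
    unfolding S_S'_S[OF g f, symmetric] L2_inner_cnj ..
  also have "\<dots> = of_real (C k) * L2_inner M (S' k f) g"
    by (simp add: L2_inner_cnj S'_adjoint[OF f g])
  finally show "L2_inner M (S' k (S k (S' k f))) g = of_real (C k) * L2_inner M (S' k f) g" .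
next
  fix k
  obtain f where f: "f \<in> L2 M" "norm_L2 M (S k f) \<noteq> 0" using S_nonzero by blast
  have "norm_L2 M (S' k (S k f)) \<noteq> 0"
  proof
    assume "norm_L2 M (S' k (S k f)) = 0"
    then have "L2_inner M (S' k (S k f)) f = 0"
      using L2_Cauchy_Schwarz[OF S'_L2[OF S_L2[OF f(1)]] f(1), of k k] by simp
    then show False using f by (simp add: S'_adjoint S_L2 L2_inner_self)
  qed
  then show "\<exists>f\<in>L2 M. norm_L2 M (S' k f) \<noteq> 0" using S_L2[OF f(1)] by blast
  show "C k > 0" by (rule C_pos)
next
  show "\<exists>f\<in>L2 M. norm_L2 M f \<noteq> 0 \<and> (\<forall>k. norm_L2 M (S' k f) = 0 \<and> norm_L2 M (S k f) = 0)"
    using common_kernel by blast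
qed (fact S_L2 S'_L2 S'_adjoint S_orthogonal S'_orthogonal C_bounded)+

definition P where "P k f = (\<lambda>x. of_real (1 / C k) * S' k (S k f) x)"

lemma P_inner:
  "f \<in> L2 M \<Longrightarrow> g \<in> L2 M \<Longrightarrow> L2_inner M (P k f) g = of_real (1 / C k) * L2_inner M (S k f) (S k g)"
  unfolding P_def L2_inner_scale_left by (simp add: S'_adjoint S_L2)

lemma P_projections: "L2_projections M P"
proof
  show "P k f \<in> L2 M" if "f \<in> L2 M" for k f
    unfolding P_def using that by (intro L2_scale S_L2 S'_L2)
  note PL = this
  show "L2_inner M (P k f) g = L2_inner M f (P k g)" if "f \<in> L2 M" "g \<in> L2 M" for k f g
    using P_inner[OF that] that S_adjoint[of f "S k g" k] unfolding P_def L2_inner_scale_right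
    by (simp add: S_adjoint S_L2 S'_L2)
  show "L2_inner M (P j f) (P k g) = (if j = k then L2_inner M (P k f) g else 0)"
    if f: "f \<in> L2 M" and g: "g \<in> L2 M" for j k f g
  proof (cases "j = k")
    case False
    have "L2_inner M (P j f) (P k g) =
        of_real (1 / C j) * (of_real (1 / C k) * L2_inner M (S' j (S j f)) (S' k (S k g)))"
      unfolding P_def L2_inner_scale_left L2_inner_scale_right by simp
    then show ?thesis using False f g by (simp add: S'_orthogonal S_L2)
  next
    case True
    have "L2_inner M (P k f) (P k g) =
        of_real (1 / C k) * (of_real (1 / C k) * L2_inner M (S k (S' k (S k f))) (S k g))"
      unfolding P_def L2_inner_scale_left L2_inner_scale_right using f g
      by (simp add: S_adjoint S_L2 S'_L2)
    also have "\<dots> = of_real (1 / C k) * L2_inner M (S k f) (S k g)"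
      unfolding S_S'_S[OF f S_L2[OF g]] using C_pos[of k] by simp
    finally show ?thesis using True P_inner[OF f g] by simp
  qed
qed

lemma S_norm_sq:
  assumes f: "f \<in> L2 M"
  shows "(norm_L2 M (S k f))\<^sup>2 = C k * (norm_L2 M (P k f))\<^sup>2"
proof -
  interpret L2_projections M P by (rule P_projections)
  have "complex_of_real ((norm_L2 M (P k f))\<^sup>2) = of_real (1 / C k * (norm_L2 M (S k f))\<^sup>2)"
    using P_norm_sq[OF f, of k] P_inner[OF f f] unfolding L2_inner_self of_real_mult by simp
  then have "(norm_L2 M (P k f))\<^sup>2 = 1 / C k * (norm_L2 M (S k f))\<^sup>2" by (simp only: of_real_eq_iff)
  then show ?thesis using C_pos[of k] by (simp add: field_simps)
qed

lemma S_sums_exist: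
  assumes f: "f \<in> L2 M"
  shows "\<exists>g. L2_sums M (\<lambda>k. S k f) g"
proof -
  interpret L2_projections M P by (rule P_projections)
  obtain K where K: "\<And>k. C k \<le> K" using C_bounded by blast
  have K0: "K \<ge> 0" using K[of 0] C_pos[of 0] by linarith
  show ?thesis
  proof (rule L2_orthogonal_series(1))
    fix n
    have "(\<Sum>k<n. (norm_L2 M (S k f))\<^sup>2) \<le> (\<Sum>k<n. K * (norm_L2 M (P k f))\<^sup>2)"
      unfolding S_norm_sq[OF f] by (intro sum_mono mult_right_mono K) simp
    also have "\<dots> \<le> K * (norm_L2 M f)\<^sup>2"
      unfolding sum_distrib_left[symmetric] by (intro mult_left_mono P_Bessel f K0)
    also have "\<dots> = (sqrt K * norm_L2 M f)\<^sup>2" using K0 by (simp add: power_mult_distrib)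
    finally show "(\<Sum>k<n. (norm_L2 M (S k f))\<^sup>2) \<le> (sqrt K * norm_L2 M f)\<^sup>2" .
  qed (use f K0 in \<open>auto simp: S_L2 S_orthogonal\<close>)
qed

text \<open>
  Of the sum \<open>g\<close> of the functions \<open>S k f\<close>, the operator \<open>S' k\<close> retains only the contribution of \<open>S k f\<close>
  by orthogonality. This computes the composition of the two sums term by term.
\<close>

lemma S'_S_sums:
  assumes f: "f \<in> L2 M" and g: "L2_sums M (\<lambda>k. S k f) g" and t: "L2_sums M (\<lambda>k. S' k g) t"
  shows "L2_sums M (\<lambda>k x. of_real (C k) * P k f x) t"
proof (rule L2_sums_cong_AE[OF t])
  interpret L2_projections M P by (rule P_projections)
  have gL: "g \<in> L2 M" using g by (rule L2_sums_L2)
  show "(\<lambda>x. of_real (C k) * P k f x) \<in> L2 M" for k by (intro L2_scale P_L2 f)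
  show "AE x in M. S' k g x = of_real (C k) * P k f x" for k
  proof (rule L2_eqI_inner)
    fix h assume h: "h \<in> L2 M"
    have "(\<lambda>j. L2_inner M (S j f) (S k h)) sums L2_inner M g (S k h)"
      by (rule L2_sums_inner[OF g S_L2[OF h]])
    moreover have "L2_inner M (S j f) (S k h) = (if j = k then L2_inner M (S k f) (S k h) else 0)" for j
      using f h S_orthogonal by auto
    ultimately have "(\<lambda>j. if j = k then L2_inner M (S k f) (S k h) else 0) sums L2_inner M g (S k h)"
      by simp
    from sums_unique2[OF this sums_single]
    have "L2_inner M g (S k h) = L2_inner M (S k f) (S k h)" .
    then show "L2_inner M (S' k g) h = L2_inner M (\<lambda>x. of_real (C k) * P k f x) h"
      using C_pos[of k] f h gL by (simp add: L2_inner_scale_left P_inner S'_adjoint)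
  qed (use f gL in \<open>auto intro: S'_L2 L2_scale P_L2\<close>)
qed (use L2_sums_L2[OF t] in auto)

lemma diagonal_operator:
  assumes "\<And>f. f \<in> L2 M \<Longrightarrow> L2_sums M (\<lambda>k. S k f) (L f)"
    and "\<And>f. f \<in> L2 M \<Longrightarrow> L2_sums M (\<lambda>k. S' k f) (L' f)"
  shows "L2_diagonal_operator M P C (L' \<circ> L)"
proof -
  interpret L2_projections M P by (rule P_projections)
  show ?thesis
  proof
    show "L2_sums M (\<lambda>k x. of_real (C k) * P k f x) ((L' \<circ> L) f)" if f: "f \<in> L2 M" for f
      using S'_S_sums[OF f assms(1)[OF f] assms(2)] L2_sums_L2[OF assms(1)[OF f]] by simp
    show "\<exists>f\<in>L2 M. norm_L2 M (P k f) \<noteq> 0" for k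
    proof -
      obtain f where f: "f \<in> L2 M" "norm_L2 M (S k f) \<noteq> 0" using S_nonzero by blast
      then have "norm_L2 M (P k f) \<noteq> 0" using S_norm_sq[OF f(1), of k] by auto
      then show ?thesis using f(1) by blast
    qed
    show "\<exists>f\<in>L2 M. norm_L2 M f \<noteq> 0 \<and> (\<forall>k. norm_L2 M (P k f) = 0)"
    proof -
      obtain f where f: "f \<in> L2 M" "norm_L2 M f \<noteq> 0" "\<And>k. norm_L2 M (S k f) = 0"
        using common_kernel by blast
      have "norm_L2 M (P k f) = 0" for k
        using S_norm_sq[OF f(1), of k] f(3)[of k] C_pos[of k] by simp
      then show ?thesis using f(1,2) by blast
    qed
    show "\<exists>K. \<forall>k. \<bar>C k\<bar> \<le> K"
      using C_bounded C_pos by (simp add: abs_of_pos)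
  qed
qed

text \<open>
  The sum of the adjoints has the property by which the adjoint is chosen, and that property determines
  a function up to a null set.
\<close>

lemma adjoint_sums:
  assumes L: "\<And>f. f \<in> L2 M \<Longrightarrow> L2_sums M (\<lambda>k. S k f) (L f)" and g: "g \<in> L2 M"
  shows "L2_sums M (\<lambda>k. S' k g) (L2_adjoint M L g)"
proof -
  obtain h where h: "L2_sums M (\<lambda>k. S' k g) h"
    using L2_modes.S_sums_exist[OF dual g] by blast
  have hL: "h \<in> L2 M" using h by (rule L2_sums_L2)
  have adj: "L2_inner M (L f) g = L2_inner M f h" if f: "f \<in> L2 M" for f
  proof -
    have "(\<lambda>k. cnj (L2_inner M (S' k g) f)) sums cnj (L2_inner M h f)"
      unfolding sums_cnj by (rule L2_sums_inner[OF h f])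
    then have "(\<lambda>k. L2_inner M (S k f) g) sums L2_inner M f h"
      using f g by (simp add: L2_inner_cnj S_adjoint)
    from sums_unique2[OF L2_sums_inner[OF L[OF f] g] this] show ?thesis .
  qed
  let ?h = "L2_adjoint M L g"
  have "\<exists>h. h \<in> L2 M \<and> (\<forall>f\<in>L2 M. L2_inner M (L f) g = L2_inner M f h)"
    using hL adj by blast
  then have *: "?h \<in> L2 M \<and> (\<forall>f\<in>L2 M. L2_inner M (L f) g = L2_inner M f ?h)"
    unfolding L2_adjoint_def by (rule someI_ex)
  have "AE x in M. h x = ?h x"
  proof (rule L2_eqI_inner[OF hL conjunct1[OF *]])
    fix f assume f: "f \<in> L2 M"
    have "L2_inner M f h = L2_inner M f ?h" using * adj f by simp
    then show "L2_inner M h f = L2_inner M ?h f" by (metis L2_inner_cnj)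
  qed
  then show ?thesis
    using h * by (intro L2_sums_cong_AE[OF h]) (auto simp: L2_sums_def)
qed

lemma spectral_theorem:
  assumes L: "\<And>f. f \<in> L2 M \<Longrightarrow> L2_sums M (\<lambda>k. S k f) (L f)"
    and T: "T = L2_adjoint M L \<circ> L \<or> T = L \<circ> L2_adjoint M L"
  shows "(\<exists>B. L2_orthogonal_basis M B \<and> (\<forall>b\<in>B. \<exists>c. L2_eigenfunction M T c b)) \<and>
         L2_point_spectrum M T = {0} \<union> {complex_of_real (C k) | k. True} \<and>
         L2_spectrum M T = closure ({0} \<union> {complex_of_real (C k) | k. True})"
proof -
  have "\<exists>Q. L2_diagonal_operator M Q C T"
    using T diagonal_operator[OF L adjoint_sums[OF L]]
      L2_modes.diagonal_operator[OF dual adjoint_sums[OF L] L] by blast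
  then obtain Q where "L2_diagonal_operator M Q C T" by blast
  then interpret L2_diagonal_operator M Q C T .
  show ?thesis using orthogonal_basis point_spectrum spectrum by blast
qed

end

section \<open>Integral operators and the Schur test\<close>

definition integral_op :: "'a measure \<Rightarrow> ('a \<Rightarrow> 'a \<Rightarrow> complex) \<Rightarrow> ('a \<Rightarrow> complex) \<Rightarrow> 'a \<Rightarrow> complex" where
  "integral_op M K f x = (LINT y|M. K x y * f y)"

definition adjoint_kernel :: "('a \<Rightarrow> 'a \<Rightarrow> complex) \<Rightarrow> 'a \<Rightarrow> 'a \<Rightarrow> complex" where
  "adjoint_kernel K x y = cnj (K y x)"

definition compose_kernel :: "'a measure \<Rightarrow> ('a \<Rightarrow> 'a \<Rightarrow> complex) \<Rightarrow> ('a \<Rightarrow> 'a \<Rightarrow> complex) \<Rightarrow> 'a \<Rightarrow> 'a \<Rightarrow> complex" where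
  "compose_kernel M K L x z = (LINT y|M. K x y * L y z)"

lemma norm_integral_le_nn_integral:
  fixes f :: "'a \<Rightarrow> complex"
  shows "ennreal (norm (integral\<^sup>L M f)) \<le> (\<integral>\<^sup>+x. ennreal (norm (f x)) \<partial>M)"
  by (cases "integrable M f") (simp_all add: integral_norm_bound_ennreal not_integrable_integral_eq)

locale schur_weight = sigma_finite_measure M for M :: "'a measure" +
  fixes h :: "'a \<Rightarrow> real"
  assumes h_measurable [measurable]: "h \<in> borel_measurable M"
    and h_pos: "AE x in M. h x > 0"
begin

sublocale prod: pair_sigma_finite M M ..

definition schur_bound :: "('a \<Rightarrow> 'a \<Rightarrow> ennreal) \<Rightarrow> ennreal \<Rightarrow> bool" where
  "schur_bound k C \<longleftrightarrow> C < \<infinity> \<and>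
     (AE x in M. (\<integral>\<^sup>+y. k x y * ennreal (h y) \<partial>M) \<le> C * ennreal (h x)) \<and>
     (AE y in M. (\<integral>\<^sup>+x. k x y * ennreal (h x) \<partial>M) \<le> C * ennreal (h y))"

text \<open>
  Cauchy--Schwarz for the measure with density \<open>k x\<close>, applied to the factorization
  \<open>u = sqrt h * (u / sqrt h)\<close>.
\<close>

lemma schur_test:
  assumes [measurable]: "(\<lambda>(x, y). k x y) \<in> borel_measurable (M \<Otimes>\<^sub>M M)" "u \<in> borel_measurable M"
    and "schur_bound k C"
  shows "(\<integral>\<^sup>+x. (\<integral>\<^sup>+y. k x y * u y \<partial>M)\<^sup>2 \<partial>M) \<le> C\<^sup>2 * (\<integral>\<^sup>+y. (u y)\<^sup>2 \<partial>M)"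
proof -
  have C1: "AE x in M. (\<integral>\<^sup>+y. k x y * ennreal (h y) \<partial>M) \<le> C * ennreal (h x)"
    and C2: "AE y in M. (\<integral>\<^sup>+x. k x y * ennreal (h x) \<partial>M) \<le> C * ennreal (h y)"
    using assms(3) by (auto simp: schur_bound_def)
  have cs: "(\<integral>\<^sup>+y. k x y * u y \<partial>M)\<^sup>2 \<le>
      (\<integral>\<^sup>+y. k x y * ennreal (h y) \<partial>M) * (\<integral>\<^sup>+y. k x y * ((u y)\<^sup>2 / ennreal (h y)) \<partial>M)"
    if x: "x \<in> space M" for x
  proof -
    have [measurable]: "(\<lambda>y. k x y) \<in> borel_measurable M" using x by measurable
    let ?N = "density M (k x)" and ?v = "\<lambda>y. ennreal (sqrt (h y))"
      and ?w = "\<lambda>y. u y / ennreal (sqrt (h y))"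
    have "(\<integral>\<^sup>+y. k x y * u y \<partial>M) = (\<integral>\<^sup>+y. k x y * (?v y * ?w y) \<partial>M)"
    proof (rule nn_integral_cong_AE)
      show "AE y in M. k x y * u y = k x y * (?v y * ?w y)"
        using h_pos
      proof eventually_elim
        case (elim y)
        have "?v y * ?w y = u y * ?v y / ?v y" by (simp add: ennreal_times_divide mult.commute)
        also have "\<dots> = u y" using elim by (intro ennreal_mult_divide_eq) auto
        finally show ?case by simp
      qed
    qed
    also have "\<dots> = (\<integral>\<^sup>+y. ?v y * ?w y \<partial>?N)" by (simp add: nn_integral_density)
    finally have "(\<integral>\<^sup>+y. k x y * u y \<partial>M)\<^sup>2 \<le> (\<integral>\<^sup>+y. (?v y)\<^sup>2 \<partial>?N) * (\<integral>\<^sup>+y. (?w y)\<^sup>2 \<partial>?N)"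
      using nn_integral_Cauchy_Schwarz[of ?v ?N ?w] by simp
    also have "(\<integral>\<^sup>+y. (?v y)\<^sup>2 \<partial>?N) = (\<integral>\<^sup>+y. k x y * (?v y)\<^sup>2 \<partial>M)" by (simp add: nn_integral_density)
    also have "\<dots> = (\<integral>\<^sup>+y. k x y * ennreal (h y) \<partial>M)"
      using h_pos by (intro nn_integral_cong_AE) (auto elim!: eventually_mono simp: ennreal_power)
    also have "(\<integral>\<^sup>+y. (?w y)\<^sup>2 \<partial>?N) = (\<integral>\<^sup>+y. k x y * (?w y)\<^sup>2 \<partial>M)" by (simp add: nn_integral_density)
    also have "\<dots> = (\<integral>\<^sup>+y. k x y * ((u y)\<^sup>2 / ennreal (h y)) \<partial>M)"
    proof (rule nn_integral_cong_AE)
      show "AE y in M. k x y * (?w y)\<^sup>2 = k x y * ((u y)\<^sup>2 / ennreal (h y))"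
        using h_pos
      proof eventually_elim
        case (elim y)
        then have "(inverse (ennreal (sqrt (h y))))\<^sup>2 = inverse (ennreal (h y))"
          by (simp add: inverse_ennreal ennreal_power power_inverse)
        then show ?case by (simp add: divide_ennreal_def power_mult_distrib)
      qed
    qed
    finally show ?thesis .
  qed
  have "(\<integral>\<^sup>+x. (\<integral>\<^sup>+y. k x y * u y \<partial>M)\<^sup>2 \<partial>M) \<le>
      (\<integral>\<^sup>+x. C * ennreal (h x) * (\<integral>\<^sup>+y. k x y * ((u y)\<^sup>2 / ennreal (h y)) \<partial>M) \<partial>M)"
  proof (rule nn_integral_mono_AE)
    show "AE x in M. (\<integral>\<^sup>+y. k x y * u y \<partial>M)\<^sup>2 \<le>
        C * ennreal (h x) * (\<integral>\<^sup>+y. k x y * ((u y)\<^sup>2 / ennreal (h y)) \<partial>M)"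
      using C1 AE_space by eventually_elim (rule order_trans[OF cs mult_right_mono], auto)
  qed
  also have "\<dots> = (\<integral>\<^sup>+x. \<integral>\<^sup>+y. C * ((u y)\<^sup>2 / ennreal (h y)) * (k x y * ennreal (h x)) \<partial>M \<partial>M)"
    by (intro nn_integral_cong, subst nn_integral_cmult[symmetric]) (auto simp: mult_ac)
  also have "\<dots> = (\<integral>\<^sup>+y. \<integral>\<^sup>+x. C * ((u y)\<^sup>2 / ennreal (h y)) * (k x y * ennreal (h x)) \<partial>M \<partial>M)"
    by (rule prod.Fubini'[symmetric]) measurable
  also have "\<dots> = (\<integral>\<^sup>+y. C * ((u y)\<^sup>2 / ennreal (h y)) * (\<integral>\<^sup>+x. k x y * ennreal (h x) \<partial>M) \<partial>M)"
    by (intro nn_integral_cong nn_integral_cmult) measurable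
  also have "\<dots> \<le> (\<integral>\<^sup>+y. C\<^sup>2 * (u y)\<^sup>2 \<partial>M)"
  proof (rule nn_integral_mono_AE)
    show "AE y in M. C * ((u y)\<^sup>2 / ennreal (h y)) * (\<integral>\<^sup>+x. k x y * ennreal (h x) \<partial>M) \<le> C\<^sup>2 * (u y)\<^sup>2"
      using C2 h_pos
    proof eventually_elim
      case (elim y)
      have "C * ((u y)\<^sup>2 / ennreal (h y)) * (\<integral>\<^sup>+x. k x y * ennreal (h x) \<partial>M)
          \<le> C * ((u y)\<^sup>2 / ennreal (h y)) * (C * ennreal (h y))"
        by (intro mult_left_mono elim) simp
      also have "\<dots> = C\<^sup>2 * ((u y)\<^sup>2 / ennreal (h y) * ennreal (h y))"
        by (simp add: power2_eq_square mult_ac)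
      also have "(u y)\<^sup>2 / ennreal (h y) * ennreal (h y) = (u y)\<^sup>2"
        using elim by (simp add: ennreal_divide_times ennreal_mult_divide_eq)
      finally show ?case .
    qed
  qed
  also have "\<dots> = C\<^sup>2 * (\<integral>\<^sup>+y. (u y)\<^sup>2 \<partial>M)" by (rule nn_integral_cmult) measurable
  finally show ?thesis .
qed

definition schur_kernel :: "('a \<Rightarrow> 'a \<Rightarrow> complex) \<Rightarrow> bool" where
  "schur_kernel K \<longleftrightarrow> (\<lambda>(x, y). K x y) \<in> borel_measurable (M \<Otimes>\<^sub>M M) \<and>
     (\<exists>C. schur_bound (\<lambda>x y. ennreal (cmod (K x y))) C)"

lemma schur_kernel_measurable: "schur_kernel K \<Longrightarrow> (\<lambda>(x, y). K x y) \<in> borel_measurable (M \<Otimes>\<^sub>M M)"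
  by (simp add: schur_kernel_def)

lemma schur_kernel_norm_measurable:
  "schur_kernel K \<Longrightarrow> (\<lambda>(x, y). ennreal (cmod (K x y))) \<in> borel_measurable (M \<Otimes>\<^sub>M M)"
  using schur_kernel_measurable[of K] by simp

lemma schur_kernel_test:
  assumes K: "schur_kernel K" and [measurable]: "u \<in> borel_measurable M" and "(\<integral>\<^sup>+y. (u y)\<^sup>2 \<partial>M) < \<infinity>"
  shows "(\<integral>\<^sup>+x. (\<integral>\<^sup>+y. ennreal (cmod (K x y)) * u y \<partial>M)\<^sup>2 \<partial>M) < \<infinity>"
    and "AE x in M. (\<integral>\<^sup>+y. ennreal (cmod (K x y)) * u y \<partial>M) < \<infinity>"
proof -
  note [measurable] = schur_kernel_norm_measurable[OF K]
  obtain C where C: "schur_bound (\<lambda>x y. ennreal (cmod (K x y))) C" using K by (auto simp: schur_kernel_def)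
  have "C < \<infinity>" using C by (simp add: schur_bound_def)
  then have "C\<^sup>2 * (\<integral>\<^sup>+y. (u y)\<^sup>2 \<partial>M) < \<infinity>"
    using assms(3) by (simp add: ennreal_mult_less_top power2_eq_square)
  then show fin: "(\<integral>\<^sup>+x. (\<integral>\<^sup>+y. ennreal (cmod (K x y)) * u y \<partial>M)\<^sup>2 \<partial>M) < \<infinity>"
    by (rule le_less_trans[OF schur_test[OF schur_kernel_norm_measurable[OF K] assms(2) C]])
  have "AE x in M. (\<integral>\<^sup>+y. ennreal (cmod (K x y)) * u y \<partial>M)\<^sup>2 \<noteq> \<infinity>"
    using fin by (intro nn_integral_noteq_infinite) auto
  then show "AE x in M. (\<integral>\<^sup>+y. ennreal (cmod (K x y)) * u y \<partial>M) < \<infinity>"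
    by eventually_elim (auto simp: less_top[symmetric] power2_eq_square ennreal_mult_eq_top_iff)
qed

lemma L2_nn_sq_finite: "f \<in> L2 M \<Longrightarrow> (\<integral>\<^sup>+y. (ennreal (cmod (f y)))\<^sup>2 \<partial>M) < \<infinity>"
  by (simp add: L2_iff_nn_integral ennreal_power)

lemma integral_op_integrable:
  assumes K: "schur_kernel K" and f: "f \<in> L2 M"
  shows "AE x in M. integrable M (\<lambda>y. K x y * f y)"
proof -
  note [measurable] = schur_kernel_measurable[OF K] L2_measurable[OF f]
  have "AE x in M. (\<integral>\<^sup>+y. ennreal (cmod (K x y)) * ennreal (cmod (f y)) \<partial>M) < \<infinity>"
    using K L2_nn_sq_finite[OF f] by (intro schur_kernel_test) auto
  then show ?thesis using AE_space
    by eventually_elim (auto simp: integrable_iff_bounded norm_mult ennreal_mult)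
qed

lemma integral_op_measurable:
  assumes K: "schur_kernel K" and f: "f \<in> borel_measurable M"
  shows "integral_op M K f \<in> borel_measurable M"
proof -
  note [measurable] = schur_kernel_measurable[OF K] f
  show ?thesis unfolding integral_op_def[abs_def] by measurable
qed

lemma integral_op_L2:
  assumes K: "schur_kernel K" and f: "f \<in> L2 M"
  shows "integral_op M K f \<in> L2 M"
proof -
  note [measurable] = L2_measurable[OF f]
  have "(\<integral>\<^sup>+x. ennreal ((cmod (integral_op M K f x))\<^sup>2) \<partial>M) \<le>
      (\<integral>\<^sup>+x. (\<integral>\<^sup>+y. ennreal (cmod (K x y)) * ennreal (cmod (f y)) \<partial>M)\<^sup>2 \<partial>M)"
  proof (intro nn_integral_mono)
    fix x
    have "ennreal (cmod (integral_op M K f x)) \<le> (\<integral>\<^sup>+y. ennreal (cmod (K x y * f y)) \<partial>M)"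
      unfolding integral_op_def by (rule norm_integral_le_nn_integral)
    also have "\<dots> = (\<integral>\<^sup>+y. ennreal (cmod (K x y)) * ennreal (cmod (f y)) \<partial>M)"
      by (simp add: norm_mult ennreal_mult)
    finally show "ennreal ((cmod (integral_op M K f x))\<^sup>2) \<le>
        (\<integral>\<^sup>+y. ennreal (cmod (K x y)) * ennreal (cmod (f y)) \<partial>M)\<^sup>2"
      by (simp add: ennreal_power[symmetric] power_mono)
  qed
  also have "\<dots> < \<infinity>" using K L2_nn_sq_finite[OF f] by (intro schur_kernel_test) auto
  finally show ?thesis
    using integral_op_measurable[OF K L2_measurable[OF f]] by (simp add: L2_iff_nn_integral)
qed

lemma adjoint_kernel_schur: "schur_kernel K \<Longrightarrow> schur_kernel (adjoint_kernel K)"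
proof -
  assume K: "schur_kernel K"
  note [measurable] = schur_kernel_measurable[OF K]
  have "(\<lambda>(x, y). K y x) \<in> borel_measurable (M \<Otimes>\<^sub>M M)"
    using schur_kernel_measurable[OF K] by (subst measurable_pair_swap_iff) (simp add: case_prod_unfold)
  then have "(\<lambda>(x, y). adjoint_kernel K x y) \<in> borel_measurable (M \<Otimes>\<^sub>M M)"
    unfolding adjoint_kernel_def case_prod_unfold by measurable
  then show ?thesis using K by (auto simp: schur_kernel_def schur_bound_def adjoint_kernel_def)
qed

lemma integral_op_adjoint:
  assumes K: "schur_kernel K" and f: "f \<in> L2 M" and g: "g \<in> L2 M"
  shows "L2_inner M (integral_op M K f) g = L2_inner M f (integral_op M (adjoint_kernel K) g)"
proof -
  note [measurable] = schur_kernel_measurable[OF K] L2_measurable[OF f] L2_measurable[OF g]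
  let ?F = "\<lambda>x y. K x y * f y * cnj (g x)"
  have "integrable (M \<Otimes>\<^sub>M M) (\<lambda>(x, y). ?F x y)"
  proof (rule integrableI_bounded)
    let ?u = "\<lambda>x. \<integral>\<^sup>+y. ennreal (cmod (K x y)) * ennreal (cmod (f y)) \<partial>M"
    have "(\<integral>\<^sup>+p. ennreal (norm (case p of (x, y) \<Rightarrow> ?F x y)) \<partial>(M \<Otimes>\<^sub>M M)) =
        (\<integral>\<^sup>+x. \<integral>\<^sup>+y. ennreal (cmod (g x)) * (ennreal (cmod (K x y)) * ennreal (cmod (f y))) \<partial>M \<partial>M)"
      using nn_integral_fst[of "\<lambda>(x, y). ennreal (cmod (?F x y))" M]
      by (simp add: norm_mult ennreal_mult mult_ac case_prod_unfold)
    also have "\<dots> = (\<integral>\<^sup>+x. ennreal (cmod (g x)) * ?u x \<partial>M)"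
      by (intro nn_integral_cong nn_integral_cmult) measurable
    finally have eq: "(\<integral>\<^sup>+p. ennreal (norm (case p of (x, y) \<Rightarrow> ?F x y)) \<partial>(M \<Otimes>\<^sub>M M)) = \<dots>" .
    have "(\<integral>\<^sup>+x. ennreal (cmod (g x)) * ?u x \<partial>M)\<^sup>2 \<le>
        (\<integral>\<^sup>+x. (ennreal (cmod (g x)))\<^sup>2 \<partial>M) * (\<integral>\<^sup>+x. (?u x)\<^sup>2 \<partial>M)"
      by (rule nn_integral_Cauchy_Schwarz) measurable
    also have "\<dots> < \<infinity>"
      using L2_nn_sq_finite[OF g] schur_kernel_test(1)[OF K _ L2_nn_sq_finite[OF f]]
      by (simp add: ennreal_mult_less_top)
    finally show "(\<integral>\<^sup>+p. ennreal (norm (case p of (x, y) \<Rightarrow> ?F x y)) \<partial>(M \<Otimes>\<^sub>M M)) < \<infinity>"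
      unfolding eq by (auto simp: power2_eq_square less_top[symmetric] ennreal_mult_eq_top_iff)
  qed measurable
  from prod.Fubini_integral[OF this]
  have "(LINT y|M. LINT x|M. ?F x y) = (LINT x|M. LINT y|M. ?F x y)" .
  moreover have "(LINT x|M. LINT y|M. ?F x y) = L2_inner M (integral_op M K f) g"
    unfolding L2_inner_def integral_op_def by simp
  moreover have "(LINT y|M. LINT x|M. ?F x y) = L2_inner M f (integral_op M (adjoint_kernel K) g)"
    unfolding L2_inner_def integral_op_def adjoint_kernel_def Bochner_Integration.integral_cnj[symmetric]
    by (simp add: mult_ac flip: integral_mult_right_zero)
  ultimately show ?thesis by simp
qed

text \<open>
  With one weight for all kernels the bounds multiply under composition. Compositions of Schur kernels
  are therefore Schur kernels again, and they converge absolutely almost everywhere.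
\<close>

lemma compose_kernel_row:
  assumes K: "schur_kernel K" and L: "schur_kernel L"
    and C: "schur_bound (\<lambda>x y. ennreal (cmod (K x y))) C" and D: "schur_bound (\<lambda>x y. ennreal (cmod (L x y))) D"
  shows "AE x in M. (\<integral>\<^sup>+z. (\<integral>\<^sup>+y. ennreal (cmod (K x y)) * ennreal (cmod (L y z)) \<partial>M) * ennreal (h z) \<partial>M)
    \<le> C * D * ennreal (h x)"
proof -
  note [measurable] = schur_kernel_measurable[OF K] schur_kernel_measurable[OF L]
  show ?thesis
    using conjunct1[OF conjunct2[OF C[unfolded schur_bound_def]]] AE_space
  proof eventually_elim
    case (elim x)
    note [measurable] = \<open>x \<in> space M\<close>
    have "(\<integral>\<^sup>+z. (\<integral>\<^sup>+y. ennreal (cmod (K x y)) * ennreal (cmod (L y z)) \<partial>M) * ennreal (h z) \<partial>M) =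
        (\<integral>\<^sup>+z. \<integral>\<^sup>+y. ennreal (cmod (K x y)) * (ennreal (cmod (L y z)) * ennreal (h z)) \<partial>M \<partial>M)"
      by (intro nn_integral_cong, subst nn_integral_multc[symmetric]) (auto simp: mult_ac)
    also have "\<dots> = (\<integral>\<^sup>+y. \<integral>\<^sup>+z. ennreal (cmod (K x y)) * (ennreal (cmod (L y z)) * ennreal (h z)) \<partial>M \<partial>M)"
      by (rule prod.Fubini') measurable
    also have "\<dots> = (\<integral>\<^sup>+y. ennreal (cmod (K x y)) * (\<integral>\<^sup>+z. ennreal (cmod (L y z)) * ennreal (h z) \<partial>M) \<partial>M)"
      by (intro nn_integral_cong nn_integral_cmult) measurable
    also have "\<dots> \<le> (\<integral>\<^sup>+y. ennreal (cmod (K x y)) * (D * ennreal (h y)) \<partial>M)"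
      using conjunct1[OF conjunct2[OF D[unfolded schur_bound_def]]]
      by (intro nn_integral_mono_AE) (auto elim!: eventually_mono intro!: mult_left_mono)
    also have "\<dots> = D * (\<integral>\<^sup>+y. ennreal (cmod (K x y)) * ennreal (h y) \<partial>M)"
      by (subst nn_integral_cmult[symmetric]) (auto simp: mult_ac)
    also have "\<dots> \<le> D * (C * ennreal (h x))" by (intro mult_left_mono elim) simp
    finally show ?case by (simp add: mult_ac)
  qed
qed

lemma compose_kernel_integrable:
  assumes K: "schur_kernel K" and L: "schur_kernel L"
  shows "AE x in M. AE z in M. integrable M (\<lambda>y. K x y * L y z)"
proof -
  note [measurable] = schur_kernel_measurable[OF K] schur_kernel_measurable[OF L]
  obtain C D where C: "schur_bound (\<lambda>x y. ennreal (cmod (K x y))) C"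
    and D: "schur_bound (\<lambda>x y. ennreal (cmod (L x y))) D"
    using K L by (auto simp: schur_kernel_def)
  have fin: "C * D * ennreal (h x) < \<infinity>" for x
    using C D by (simp add: schur_bound_def ennreal_mult_less_top)
  show ?thesis using compose_kernel_row[OF K L C D] AE_space
  proof eventually_elim
    case (elim x)
    note [measurable] = \<open>x \<in> space M\<close>
    have "AE z in M. (\<integral>\<^sup>+y. ennreal (cmod (K x y)) * ennreal (cmod (L y z)) \<partial>M) * ennreal (h z) \<noteq> \<infinity>"
      using le_less_trans[OF elim(1) fin] by (intro nn_integral_noteq_infinite) auto
    then show ?case using h_pos AE_space
    proof eventually_elim
      case (elim z)
      note [measurable] = \<open>z \<in> space M\<close>
      have "(\<integral>\<^sup>+y. ennreal (cmod (K x y)) * ennreal (cmod (L y z)) \<partial>M) < \<infinity>"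
        using elim by (auto simp: ennreal_mult_eq_top_iff less_top[symmetric])
      then show ?case by (auto simp: integrable_iff_bounded norm_mult ennreal_mult)
    qed
  qed
qed

lemma compose_kernel_schur:
  assumes K: "schur_kernel K" and L: "schur_kernel L"
  shows "schur_kernel (compose_kernel M K L)"
proof -
  note [measurable] = schur_kernel_measurable[OF K] schur_kernel_measurable[OF L]
  obtain C D where C: "schur_bound (\<lambda>x y. ennreal (cmod (K x y))) C"
    and D: "schur_bound (\<lambda>x y. ennreal (cmod (L x y))) D"
    using K L by (auto simp: schur_kernel_def)
  have le: "ennreal (cmod (compose_kernel M K L x z)) \<le> (\<integral>\<^sup>+y. ennreal (cmod (K x y)) * ennreal (cmod (L y z)) \<partial>M)" for x z
    unfolding compose_kernel_def by (rule order_trans[OF norm_integral_le_nn_integral]) (simp add: norm_mult ennreal_mult)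
  have "AE x in M. (\<integral>\<^sup>+z. ennreal (cmod (compose_kernel M K L x z)) * ennreal (h z) \<partial>M) \<le> C * D * ennreal (h x)"
    using compose_kernel_row[OF K L C D]
  proof eventually_elim
    case (elim x)
    have "(\<integral>\<^sup>+z. ennreal (cmod (compose_kernel M K L x z)) * ennreal (h z) \<partial>M) \<le>
        (\<integral>\<^sup>+z. (\<integral>\<^sup>+y. ennreal (cmod (K x y)) * ennreal (cmod (L y z)) \<partial>M) * ennreal (h z) \<partial>M)"
      by (intro nn_integral_mono mult_right_mono le) simp
    also have "\<dots> \<le> C * D * ennreal (h x)" by (rule elim)
    finally show ?case .
  qed
  moreover have "AE z in M. (\<integral>\<^sup>+x. ennreal (cmod (compose_kernel M K L x z)) * ennreal (h x) \<partial>M) \<le> C * D * ennreal (h z)"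
    using conjunct2[OF conjunct2[OF D[unfolded schur_bound_def]]] AE_space
  proof eventually_elim
    case (elim z)
    note [measurable] = \<open>z \<in> space M\<close>
    have "(\<integral>\<^sup>+x. ennreal (cmod (compose_kernel M K L x z)) * ennreal (h x) \<partial>M) \<le>
        (\<integral>\<^sup>+x. (\<integral>\<^sup>+y. ennreal (cmod (K x y)) * ennreal (cmod (L y z)) \<partial>M) * ennreal (h x) \<partial>M)"
      by (intro nn_integral_mono mult_right_mono le) simp
    also have "\<dots> = (\<integral>\<^sup>+x. \<integral>\<^sup>+y. ennreal (cmod (L y z)) * (ennreal (cmod (K x y)) * ennreal (h x)) \<partial>M \<partial>M)"
      by (intro nn_integral_cong, subst nn_integral_multc[symmetric]) (auto simp: mult_ac)
    also have "\<dots> = (\<integral>\<^sup>+y. \<integral>\<^sup>+x. ennreal (cmod (L y z)) * (ennreal (cmod (K x y)) * ennreal (h x)) \<partial>M \<partial>M)"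
      by (rule prod.Fubini'[symmetric]) measurable
    also have "\<dots> = (\<integral>\<^sup>+y. ennreal (cmod (L y z)) * (\<integral>\<^sup>+x. ennreal (cmod (K x y)) * ennreal (h x) \<partial>M) \<partial>M)"
      by (intro nn_integral_cong nn_integral_cmult) measurable
    also have "\<dots> \<le> (\<integral>\<^sup>+y. ennreal (cmod (L y z)) * (C * ennreal (h y)) \<partial>M)"
      using conjunct2[OF conjunct2[OF C[unfolded schur_bound_def]]]
      by (intro nn_integral_mono_AE) (auto elim!: eventually_mono intro!: mult_left_mono)
    also have "\<dots> = C * (\<integral>\<^sup>+y. ennreal (cmod (L y z)) * ennreal (h y) \<partial>M)"
      by (subst nn_integral_cmult[symmetric]) (auto simp: mult_ac)
    also have "\<dots> \<le> C * (D * ennreal (h z))" by (intro mult_left_mono elim) simp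
    finally show ?case by (simp add: mult_ac)
  qed
  moreover have "C * D < \<infinity>" using C D by (simp add: schur_bound_def ennreal_mult_less_top)
  ultimately have "schur_bound (\<lambda>x z. ennreal (cmod (compose_kernel M K L x z))) (C * D)"
    by (simp add: schur_bound_def)
  moreover have "(\<lambda>(x, z). compose_kernel M K L x z) \<in> borel_measurable (M \<Otimes>\<^sub>M M)"
    unfolding compose_kernel_def case_prod_unfold by measurable
  ultimately show ?thesis unfolding schur_kernel_def by blast
qed

lemma integral_op_compose:
  assumes K: "schur_kernel K" and L: "schur_kernel L" and f: "f \<in> L2 M"
  shows "AE x in M. integral_op M K (integral_op M L f) x = integral_op M (compose_kernel M K L) f x"
proof -
  note [measurable] = schur_kernel_measurable[OF K] schur_kernel_measurable[OF L] L2_measurable[OF f]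
  let ?u = "\<lambda>y. \<integral>\<^sup>+z. ennreal (cmod (L y z)) * ennreal (cmod (f z)) \<partial>M"
  have "AE x in M. (\<integral>\<^sup>+y. ennreal (cmod (K x y)) * ?u y \<partial>M) < \<infinity>"
    using L2_nn_sq_finite[OF f] by (intro schur_kernel_test(2)[OF K] schur_kernel_test(1)[OF L]) auto
  then show ?thesis using AE_space
  proof eventually_elim
    case (elim x)
    note [measurable] = \<open>x \<in> space M\<close>
    have "(\<integral>\<^sup>+p. ennreal (norm (case p of (y, z) \<Rightarrow> K x y * (L y z * f z))) \<partial>(M \<Otimes>\<^sub>M M)) =
        (\<integral>\<^sup>+y. \<integral>\<^sup>+z. ennreal (cmod (K x y)) * (ennreal (cmod (L y z)) * ennreal (cmod (f z))) \<partial>M \<partial>M)"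
      using nn_integral_fst[of "\<lambda>(y, z). ennreal (cmod (K x y * (L y z * f z)))" M]
      by (simp add: norm_mult ennreal_mult case_prod_unfold)
    also have "\<dots> = (\<integral>\<^sup>+y. ennreal (cmod (K x y)) * ?u y \<partial>M)"
      by (intro nn_integral_cong nn_integral_cmult) measurable
    finally have "integrable (M \<Otimes>\<^sub>M M) (\<lambda>(y, z). K x y * (L y z * f z))"
      using elim by (intro integrableI_bounded) (auto simp: case_prod_unfold)
    from prod.Fubini_integral[OF this]
    have "(LINT z|M. LINT y|M. K x y * (L y z * f z)) = (LINT y|M. LINT z|M. K x y * (L y z * f z))" .
    then show ?case
      unfolding integral_op_def compose_kernel_def
      by (simp add: mult.assoc flip: integral_mult_right_zero integral_mult_left_zero)
  qed
qed

lemma integral_op_cong_kernel: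
  assumes K: "(\<lambda>(x, y). K x y) \<in> borel_measurable (M \<Otimes>\<^sub>M M)"
    and L: "(\<lambda>(x, y). L x y) \<in> borel_measurable (M \<Otimes>\<^sub>M M)" and f: "f \<in> borel_measurable M"
    and eq: "AE x in M. AE y in M. K x y = L x y"
  shows "AE x in M. integral_op M K f x = integral_op M L f x"
  using eq AE_space
proof eventually_elim
  case (elim x)
  note [measurable] = K L f \<open>x \<in> space M\<close>
  show ?case unfolding integral_op_def
    using elim(1) by (intro integral_cong_AE) (measurable, auto elim: eventually_mono)
qed

lemma integral_op_cong:
  assumes K: "schur_kernel K" and f: "f \<in> borel_measurable M" and g: "g \<in> borel_measurable M"
    and eq: "AE y in M. f y = g y" and x: "x \<in> space M"
  shows "integral_op M K f x = integral_op M K g x"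
proof -
  note [measurable] = schur_kernel_measurable[OF K] f g x
  show ?thesis unfolding integral_op_def
    using eq by (intro integral_cong_AE) (measurable, auto elim: eventually_mono)
qed

end

section \<open>Explicit integrals\<close>

lemma integral_FTC_real_line:
  fixes f F :: "real \<Rightarrow> 'a::euclidean_space"
  assumes F: "\<And>x. (F has_vector_derivative f x) (at x)" and f: "\<And>x. isCont f x"
    and int: "integrable lborel f" and A: "(F \<longlongrightarrow> A) at_bot" and B: "(F \<longlongrightarrow> B) at_top"
  shows "(LINT x|lborel. f x) = B - A"
proof -
  have "(LBINT x=-\<infinity>..\<infinity>. f x) = B - A"
  proof (rule interval_integral_FTC_integrable[OF _ F f])
    show "set_integrable lborel (einterval (-\<infinity>) \<infinity>) f" using int by (simp add: set_integrable_def)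
    show "((F \<circ> real_of_ereal) \<longlongrightarrow> A) (at_right (-\<infinity>))" using A by (simp add: ereal_tendsto_simps)
    show "((F \<circ> real_of_ereal) \<longlongrightarrow> B) (at_left \<infinity>)" using B by (simp add: ereal_tendsto_simps)
  qed simp
  then show ?thesis by (simp add: interval_lebesgue_integral_def set_lebesgue_integral_def)
qed

lemma arctan_scaled_limits:
  assumes "(a::real) > 0"
  shows "((\<lambda>s. arctan ((s - u) / a)) \<longlongrightarrow> pi / 2) at_top" "((\<lambda>s. arctan ((s - u) / a)) \<longlongrightarrow> - (pi / 2)) at_bot"
proof -
  have "filterlim (\<lambda>s. (s - u) / a) at_top at_top" "filterlim (\<lambda>s. (s - u) / a) at_bot at_bot"
    using assms by real_asymp+
  from filterlim_compose[OF tendsto_arctan_at_top this(1)] filterlim_compose[OF tendsto_arctan_at_bot this(2)]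
  show "((\<lambda>s. arctan ((s - u) / a)) \<longlongrightarrow> pi / 2) at_top" "((\<lambda>s. arctan ((s - u) / a)) \<longlongrightarrow> - (pi / 2)) at_bot"
    by simp_all
qed

lemma arctan_scaled_deriv:
  assumes "(a::real) > 0"
  shows "((\<lambda>s. arctan ((s - u) / a)) has_real_derivative (a / (a\<^sup>2 + (s - u)\<^sup>2))) (at s)"
proof -
  have "1 + ((s - u) / a)\<^sup>2 = (a\<^sup>2 + (s - u)\<^sup>2) / a\<^sup>2" using assms by (simp add: field_simps)
  moreover have "a\<^sup>2 + (s - u)\<^sup>2 > 0" using assms by (simp add: add_pos_nonneg)
  ultimately show ?thesis using assms
    by (auto intro!: derivative_eq_intros simp: divide_simps power2_eq_square)
qed

lemma integral_Poisson:
  assumes a: "(a::real) > 0"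
  shows "integrable lborel (\<lambda>s. 1 / (a\<^sup>2 + (s - u)\<^sup>2))" "(LINT s|lborel. 1 / (a\<^sup>2 + (s - u)\<^sup>2)) = pi / a"
proof -
  let ?f = "\<lambda>s. a / (a\<^sup>2 + (s - u)\<^sup>2)" and ?F = "\<lambda>s. arctan ((s - u) / a)"
  have pos: "a\<^sup>2 + (s - u)\<^sup>2 > 0" for s using a by (simp add: add_pos_nonneg)
  have "set_integrable lborel (einterval (-\<infinity>) \<infinity>) ?f \<and> (LBINT s=-\<infinity>..\<infinity>. ?f s) = pi / 2 - - (pi / 2)"
  proof (intro conjI interval_integral_FTC_nonneg[where F = ?F])
    show "DERIV ?F s :> ?f s" "DERIV ?F s :> ?f s" for s by (rule arctan_scaled_deriv[OF a])+
    show "isCont ?f s" "isCont ?f s" for s using pos[of s] by (auto intro!: continuous_intros)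
    show "((?F \<circ> real_of_ereal) \<longlongrightarrow> - (pi / 2)) (at_right (-\<infinity>))" "((?F \<circ> real_of_ereal) \<longlongrightarrow> - (pi / 2)) (at_right (-\<infinity>))"
      using arctan_scaled_limits[OF a] by (simp_all add: ereal_tendsto_simps)
    show "((?F \<circ> real_of_ereal) \<longlongrightarrow> pi / 2) (at_left \<infinity>)" "((?F \<circ> real_of_ereal) \<longlongrightarrow> pi / 2) (at_left \<infinity>)"
      using arctan_scaled_limits[OF a] by (simp_all add: ereal_tendsto_simps)
  qed (use a in auto)
  then have int: "integrable lborel ?f" and val: "(LINT s|lborel. ?f s) = pi"
    by (simp_all add: set_integrable_def interval_lebesgue_integral_def set_lebesgue_integral_def)
  have eq: "(\<lambda>s. 1 / (a\<^sup>2 + (s - u)\<^sup>2)) = (\<lambda>s. (1 / a) * ?f s)" using a by (auto simp: fun_eq_iff)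
  show "integrable lborel (\<lambda>s. 1 / (a\<^sup>2 + (s - u)\<^sup>2))" unfolding eq using int by (rule integrable_mult_right)
  show "(LINT s|lborel. 1 / (a\<^sup>2 + (s - u)\<^sup>2)) = pi / a" unfolding eq integral_mult_right_zero val by simp
qed

lemma nn_integral_Poisson:
  assumes a: "(a::real) > 0"
  shows "(\<integral>\<^sup>+s. ennreal (1 / (a\<^sup>2 + (s - u)\<^sup>2)) \<partial>lborel) = ennreal (pi / a)"
  by (subst nn_integral_eq_integral[OF integral_Poisson(1)[OF a]]) (simp_all add: integral_Poisson(2)[OF a])

subsection \<open>The convolution formula along the real line\<close>

lemma norm_Complex_ge: "a > 0 \<Longrightarrow> a \<le> cmod (Complex a t)"
  by (simp add: cmod_def real_le_rsqrt)

lemma norm_Complex_power_ge: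
  assumes "a > 0"
  shows "a ^ k * (a\<^sup>2 + t\<^sup>2) \<le> cmod (Complex a t) ^ (k + 2)"
proof -
  have "a ^ k * (a\<^sup>2 + t\<^sup>2) = a ^ k * (cmod (Complex a t))\<^sup>2" by (simp add: cmod_power2)
  also have "\<dots> \<le> cmod (Complex a t) ^ k * (cmod (Complex a t))\<^sup>2"
    using assms norm_Complex_ge[OF assms] by (intro mult_right_mono power_mono) auto
  finally show ?thesis by (simp only: power_add)
qed

lemma norm_inverse_Complex_power_le:
  assumes "a > 0"
  shows "1 / cmod (Complex a t) ^ (k + 2) \<le> 1 / a ^ k * (1 / (a\<^sup>2 + t\<^sup>2))"
proof -
  have "a ^ k * (a\<^sup>2 + t\<^sup>2) > 0" using assms by (simp add: add_pos_nonneg)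
  then show ?thesis using norm_Complex_power_ge[OF assms, of k t]
    by (simp add: frac_le field_simps)
qed

lemma Complex_nonzero [simp]: "a > 0 \<Longrightarrow> Complex a t \<noteq> 0"
  by (simp add: complex_eq_iff)

lemma borel_measurable_Complex [measurable (raw)]:
  assumes "f \<in> borel_measurable M" "g \<in> borel_measurable M"
  shows "(\<lambda>x. Complex (f x) (g x)) \<in> borel_measurable M"
proof -
  have "(\<lambda>x. complex_of_real (f x) + \<i> * complex_of_real (g x)) \<in> borel_measurable M"
    using assms by measurable
  then show ?thesis by (simp add: complex_eq[symmetric] Complex_eq)
qed

lemma convolution_integrable:
  assumes a: "a > 0" and b: "b > 0" and pq: "p + q \<ge> 2"
  shows "integrable lborel (\<lambda>s. 1 / (Complex a (s - u) ^ p * Complex b (v - s) ^ q))"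
proof (rule Bochner_Integration.integrable_bound)
  let ?g = "\<lambda>s. 1 / (a\<^sup>2 + (s - u)\<^sup>2) + 1 / (b\<^sup>2 + (s - v)\<^sup>2)"
  define K where "K = 1 / (min a b) ^ (p + q - 2)"
  show "integrable lborel (\<lambda>s. K * ?g s)"
    by (intro integrable_mult_right Bochner_Integration.integrable_add integral_Poisson a b)
  have "cmod (1 / (Complex a (s - u) ^ p * Complex b (v - s) ^ q)) \<le> K * ?g s" for s
  proof -
    define x where "x = cmod (Complex a (s - u))"
    define y where "y = cmod (Complex b (v - s))"
    define m where "m = min x y"
    have m0: "m > 0" using a b by (auto simp: m_def x_def y_def)
    have xm: "m \<le> x" "m \<le> y" by (auto simp: m_def)
    have mm: "min a b \<le> m" "min a b > 0"
      using a b norm_Complex_ge[of a "s - u"] norm_Complex_ge[of b "v - s"] unfolding m_def x_def y_def by linarith+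
    have "m ^ (p + q) \<le> x ^ p * y ^ q"
      unfolding power_add using m0 xm by (intro mult_mono power_mono) auto
    then have "1 / (x ^ p * y ^ q) \<le> 1 / m ^ (p + q)" using m0 by (intro frac_le) auto
    also have "\<dots> = 1 / m ^ (p + q - 2) * (1 / m\<^sup>2)"
    proof -
      have "m ^ (p + q) = m ^ (p + q - 2) * m\<^sup>2" using pq by (simp only: power_add[symmetric] le_add_diff_inverse2)
      then show ?thesis by simp
    qed
    also have "\<dots> \<le> K * (1 / m\<^sup>2)"
      unfolding K_def using m0 mm by (intro mult_right_mono frac_le power_mono) auto
    also have "K * (1 / m\<^sup>2) \<le> K * (1 / x\<^sup>2 + 1 / y\<^sup>2)"
      using mm by (intro mult_left_mono) (auto simp: m_def min_def K_def)
    finally have "1 / (x ^ p * y ^ q) \<le> K * (1 / x\<^sup>2 + 1 / y\<^sup>2)" .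
    moreover have "1 / x\<^sup>2 + 1 / y\<^sup>2 = ?g s"
      by (simp add: x_def y_def cmod_power2 power2_commute)
    ultimately show ?thesis by (simp add: norm_divide norm_mult norm_power x_def y_def)
  qed
  then show "AE s in lborel. norm (1 / (Complex a (s - u) ^ p * Complex b (v - s) ^ q)) \<le> norm (K * ?g s)"
    by (intro AE_I2) (simp add: order_trans[OF _ abs_ge_self])
qed measurable

lemma inverse_Complex: "1 / Complex a t = Complex (a / (a\<^sup>2 + t\<^sup>2)) (- t / (a\<^sup>2 + t\<^sup>2))"
  by (simp add: complex_eq_iff Re_divide Im_divide power2_eq_square)

text \<open>
  An antiderivative is a multiple of \<open>ln Y - ln X\<close>, where \<open>X\<close> and \<open>Y\<close> are the two factors. It is written
  with real logarithms and arctangents (\<open>\<rho>\<close> and \<open>\<tau>\<close>), whose limits at both ends are elementary.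
\<close>

lemma convolution_integral_base:
  assumes a: "a > 0" and b: "b > 0"
  shows "(LINT s|lborel. 1 / (Complex a (s - u) * Complex b (v - s))) = 2 * pi / Complex (a + b) (v - u)"
proof -
  let ?D = "Complex (a + b) (v - u)"
  let ?f = "\<lambda>s. 1 / (Complex a (s - u) * Complex b (v - s))"
  let ?\<rho> = "\<lambda>s. ln (b\<^sup>2 + (s - v)\<^sup>2) / 2 - ln (a\<^sup>2 + (s - u)\<^sup>2) / 2"
  let ?\<tau> = "\<lambda>s. arctan ((s - v) / b) + arctan ((s - u) / a)"
  let ?F = "\<lambda>s. Complex (?\<tau> s) (?\<rho> s) / ?D"
  have D: "?D \<noteq> 0" using a b by simp
  have pos: "a\<^sup>2 + (s - u)\<^sup>2 > 0" "b\<^sup>2 + (s - v)\<^sup>2 > 0" for s using a b by (simp_all add: add_pos_nonneg)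
  have "(LINT s|lborel. ?f s) = Complex (pi / 2 + pi / 2) 0 / ?D - Complex (- (pi / 2) + - (pi / 2)) 0 / ?D"
  proof (rule integral_FTC_real_line[where F = ?F])
    show "(?F has_vector_derivative ?f s) (at s)" for s
    proof -
      have \<tau>: "(?\<tau> has_real_derivative (b / (b\<^sup>2 + (s - v)\<^sup>2) + a / (a\<^sup>2 + (s - u)\<^sup>2))) (at s)"
        by (intro DERIV_add arctan_scaled_deriv a b)
      have \<rho>: "(?\<rho> has_real_derivative ((s - v) / (b\<^sup>2 + (s - v)\<^sup>2) - (s - u) / (a\<^sup>2 + (s - u)\<^sup>2))) (at s)"
        using pos[of s] by (auto intro!: derivative_eq_intros simp: divide_simps algebra_simps)
      have "((\<lambda>s. of_real (?\<tau> s) + \<i> * of_real (?\<rho> s)) has_vector_derivative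
          (of_real (b / (b\<^sup>2 + (s - v)\<^sup>2) + a / (a\<^sup>2 + (s - u)\<^sup>2)) +
           \<i> * of_real ((s - v) / (b\<^sup>2 + (s - v)\<^sup>2) - (s - u) / (a\<^sup>2 + (s - u)\<^sup>2)))) (at s)"
        using \<tau> \<rho>
        by (intro has_vector_derivative_add has_vector_derivative_mult_right has_vector_derivative_of_real)
      moreover have "of_real (b / (b\<^sup>2 + (s - v)\<^sup>2) + a / (a\<^sup>2 + (s - u)\<^sup>2)) +
           \<i> * of_real ((s - v) / (b\<^sup>2 + (s - v)\<^sup>2) - (s - u) / (a\<^sup>2 + (s - u)\<^sup>2)) =
           1 / Complex a (s - u) + 1 / Complex b (v - s)"
        unfolding inverse_Complex power2_commute[of v s] by (simp add: complex_eq_iff diff_divide_distrib)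
      moreover have "1 / Complex a (s - u) + 1 / Complex b (v - s) = ?D * ?f s"
      proof -
        have "?D = Complex a (s - u) + Complex b (v - s)" by (simp add: complex_eq_iff)
        then show ?thesis using a b by (simp add: divide_simps)
      qed
      ultimately have "((\<lambda>s. (of_real (?\<tau> s) + \<i> * of_real (?\<rho> s)) / ?D) has_vector_derivative ?D * ?f s / ?D) (at s)"
        by (intro has_vector_derivative_divide) simp
      then show ?thesis using D by (simp add: Complex_eq)
    qed
    show "isCont ?f s" for s
      unfolding Complex_eq using Complex_nonzero[OF a, of "s - u"] Complex_nonzero[OF b, of "v - s"]
      by (intro continuous_intros) (auto simp: Complex_eq)
    show "integrable lborel ?f" using convolution_integrable[OF a b, of 1 1 u v] by simp
    have 1: "(?\<rho> \<longlongrightarrow> 0) at_top" using a b by real_asymp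
    have 2: "(?\<rho> \<longlongrightarrow> 0) at_bot" using a b by real_asymp
    show "(?F \<longlongrightarrow> Complex (pi / 2 + pi / 2) 0 / ?D) at_top"
      by (intro tendsto_divide tendsto_const D tendsto_Complex tendsto_add arctan_scaled_limits a b 1)
    show "(?F \<longlongrightarrow> Complex (- (pi / 2) + - (pi / 2)) 0 / ?D) at_bot"
      by (intro tendsto_divide tendsto_const D tendsto_Complex tendsto_add arctan_scaled_limits a b 2)
  qed
  also have "\<dots> = (Complex (pi / 2 + pi / 2) 0 - Complex (- (pi / 2) + - (pi / 2)) 0) / ?D"
    by (simp only: diff_divide_distrib)
  also have "Complex (pi / 2 + pi / 2) 0 - Complex (- (pi / 2) + - (pi / 2)) 0 = 2 * pi"
    by (simp add: complex_eq_iff)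
  finally show ?thesis .
qed

lemma inverse_power_integral_zero:
  assumes a: "a > 0"
  shows "(LINT s|lborel. 1 / Complex a (s - u) ^ (p + 2)) = 0"
    and "(LINT s|lborel. 1 / Complex a (u - s) ^ (p + 2)) = 0"
proof -
  have *: "(LINT s|lborel. 1 / (of_real a + c * (of_real s - of_real u)) ^ (p + 2)) = 0"
    if c: "c = \<i> \<or> c = - \<i>" for c
  proof -
    let ?X = "\<lambda>s. of_real a + c * (of_real s - of_real u)"
    have X: "?X s = Complex a ((s - u) * Im c)" for s using c by (auto simp: complex_eq_iff)
    have nz: "?X s \<noteq> 0" for s unfolding X using a by simp
    have c2: "c * c = -1" "c \<noteq> 0" using c by auto
    let ?F = "\<lambda>s. c / (of_nat (p + 1) * ?X s ^ (p + 1))"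
    have lim: "filterlim ?X at_infinity F" if "filterlim (\<lambda>s. s) at_infinity F" for F :: "real filter"
    proof -
      have "filterlim (\<lambda>s. of_real s :: complex) at_infinity F"
        using that by (simp add: filterlim_at_infinity_conv_norm_at_top)
      then have "filterlim (\<lambda>s. c * of_real s) at_infinity F"
        using c2 by (intro tendsto_mult_filterlim_at_infinity[OF tendsto_const]) auto
      then have "filterlim (\<lambda>s. (of_real a - c * of_real u) + c * of_real s) at_infinity F"
        by (rule tendsto_add_filterlim_at_infinity[OF tendsto_const])
      then show ?thesis by (simp add: algebra_simps)
    qed
    have Flim: "(?F \<longlongrightarrow> 0) F" if "filterlim (\<lambda>s. s) at_infinity F" for F :: "real filter"
    proof -
      have "of_nat (p + 1) \<noteq> (0::complex)" by (simp only: of_nat_eq_0_iff)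
      moreover have "filterlim (\<lambda>s. ?X s ^ (p + 1)) at_infinity F"
        by (rule Limits.filterlim_power_at_infinity[OF lim[OF that]]) simp
      ultimately show ?thesis
        by (intro tendsto_divide_0[OF tendsto_const] tendsto_mult_filterlim_at_infinity[OF tendsto_const])
    qed
    have "(LINT s|lborel. 1 / ?X s ^ (p + 2)) = 0 - 0"
    proof (rule integral_FTC_real_line[where F = ?F])
      show "(?F has_vector_derivative (1 / ?X s ^ (p + 2))) (at s)" for s
      proof -
        have "((\<lambda>z. c / (of_nat (p + 1) * (of_real a + c * (z - of_real u)) ^ (p + 1))) has_field_derivative
            (1 / ?X s ^ (p + 2))) (at (of_real s))"
        proof -
          define n y where "n = (of_nat (p + 1) :: complex)" and "y = ?X s"
          have n: "n \<noteq> 0" unfolding n_def by (simp only: of_nat_eq_0_iff)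
          have y: "y \<noteq> 0" using nz[of s] by (simp add: y_def)
          have "((\<lambda>z. (of_real a + c * (z - of_real u)) ^ (p + 1)) has_field_derivative n * (c * y ^ p)) (at (of_real s))"
            unfolding n_def y_def by (rule derivative_eq_intros refl | simp)+
          then have "((\<lambda>z. c / (n * (of_real a + c * (z - of_real u)) ^ (p + 1))) has_field_derivative
              (0 * (n * y ^ (p + 1)) - c * (n * (n * (c * y ^ p)))) / ((n * y ^ (p + 1)) * (n * y ^ (p + 1)))) (at (of_real s))"
            using n y unfolding y_def by (intro DERIV_divide DERIV_const DERIV_cmult) auto
          moreover have "(0 * (n * y ^ (p + 1)) - c * (n * (n * (c * y ^ p)))) / ((n * y ^ (p + 1)) * (n * y ^ (p + 1)))
              = - (c * c) * ((n * n * y ^ p) / ((n * n * y ^ p) * y ^ (p + 2)))"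
            by (simp add: power_add mult_ac)
          moreover have "\<dots> = 1 / y ^ (p + 2)" unfolding c2 using n y by simp
          ultimately show ?thesis by (simp only: n_def y_def)
        qed
        from has_vector_derivative_real_field[OF this] show ?thesis by simp
      qed
      show "isCont (\<lambda>s. 1 / ?X s ^ (p + 2)) s" for s
        using nz[of s] by (intro continuous_intros) auto
      show "integrable lborel (\<lambda>s. 1 / ?X s ^ (p + 2))"
        using c convolution_integrable[OF a zero_less_one, of "p + 2" 0 u 0]
          convolution_integrable[OF zero_less_one a, of 0 "p + 2" 0 u] by (auto simp: X)
      show "(?F \<longlongrightarrow> 0) at_bot" "(?F \<longlongrightarrow> 0) at_top"
        by (intro Flim; simp add: filterlim_def filtermap_ident at_bot_le_at_infinity at_top_le_at_infinity)+
    qed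
    then show ?thesis by simp
  qed
  have "Complex a (s - u) = of_real a + \<i> * (of_real s - of_real u)"
    "Complex a (u - s) = of_real a + - \<i> * (of_real s - of_real u)" for s
    by (auto simp: complex_eq_iff)
  then show "(LINT s|lborel. 1 / Complex a (s - u) ^ (p + 2)) = 0" "(LINT s|lborel. 1 / Complex a (u - s) ^ (p + 2)) = 0"
    using *[of \<i>] *[of "- \<i>"] by simp_all
qed

text \<open>
  Since \<open>X + Y\<close> does not depend on the variable of integration, \<open>1 / (X ^ p * Y ^ q)\<close> satisfies the
  recursion of Pascal's triangle up to powers of \<open>X + Y\<close>.
\<close>

theorem convolution_integral:
  assumes a: "a > 0" and b: "b > 0"
  shows "(LINT s|lborel. 1 / (Complex a (s - u) ^ (p + 1) * Complex b (v - s) ^ (q + 1))) =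
    2 * pi * of_nat (p + q choose p) / Complex (a + b) (v - u) ^ (p + q + 1)"
proof -
  let ?D = "Complex (a + b) (v - u)"
  let ?J = "\<lambda>p q. LINT s|lborel. 1 / (Complex a (s - u) ^ p * Complex b (v - s) ^ q)"
  have D: "?D \<noteq> 0" using a b by simp
  have rec: "?J (Suc p) (Suc q) = (?J p (Suc q) + ?J (Suc p) q) / ?D" if pq: "p + q \<ge> 1" for p q
  proof -
    have "1 / (Complex a (s - u) ^ Suc p * Complex b (v - s) ^ Suc q) =
        (1 / (Complex a (s - u) ^ p * Complex b (v - s) ^ Suc q) +
         1 / (Complex a (s - u) ^ Suc p * Complex b (v - s) ^ q)) / ?D" for s
    proof -
      have "?D = Complex a (s - u) + Complex b (v - s)" by (simp add: complex_eq_iff)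
      moreover have "Complex a (s - u) \<noteq> 0" "Complex b (v - s) \<noteq> 0" using a b by auto
      moreover have "X + Y \<noteq> 0 \<Longrightarrow> X \<noteq> 0 \<Longrightarrow> Y \<noteq> 0 \<Longrightarrow>
          1 / (X ^ Suc p * Y ^ Suc q) = (1 / (X ^ p * Y ^ Suc q) + 1 / (X ^ Suc p * Y ^ q)) / (X + Y)" for X Y :: complex
        by (simp add: divide_simps)
      ultimately show ?thesis using D by metis
    qed
    then have "?J (Suc p) (Suc q) = (LINT s|lborel. (1 / (Complex a (s - u) ^ p * Complex b (v - s) ^ Suc q) +
         1 / (Complex a (s - u) ^ Suc p * Complex b (v - s) ^ q)) / ?D)" by (rule Bochner_Integration.integral_cong[OF refl])
    also have "\<dots> = (?J p (Suc q) + ?J (Suc p) q) / ?D"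
      using convolution_integrable[OF a b, of p "Suc q" u v] convolution_integrable[OF a b, of "Suc p" q u v] pq
      by (simp only: integral_divide_zero Bochner_Integration.integral_add)
    finally show ?thesis .
  qed
  have zero: "?J (p + 2) 0 = 0" "?J 0 (p + 2) = 0" for p
    using inverse_power_integral_zero[OF a, of u p] inverse_power_integral_zero[OF b, of v p] by simp_all
  have base: "?J 1 1 = 2 * pi / ?D" using convolution_integral_base[OF a b, of u v] by simp
  have "?J (p + 1) (q + 1) = 2 * pi * of_nat (p + q choose p) / ?D ^ (p + q + 1)" for p q
  proof (induction "p + q" arbitrary: p q)
    case 0 then show ?case using base by simp
  next
    case (Suc n)
    show ?case
    proof (cases p; cases q)
      fix p' q' assume [simp]: "p = Suc p'" "q = Suc q'"
      have IH: "?J (p' + 1) (q + 1) = 2 * pi * of_nat (p' + q choose p') / ?D ^ (p' + q + 1)"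
        "?J (p + 1) (q' + 1) = 2 * pi * of_nat (p + q' choose p) / ?D ^ (p + q' + 1)"
        using Suc by (intro Suc(1); simp)+
      have "?J (p + 1) (q + 1) = (?J (p' + 1) (q + 1) + ?J (p + 1) (q' + 1)) / ?D"
        using rec[of "p' + 1" "q' + 1"] by simp
      also have "\<dots> = 2 * pi * of_nat (p + q choose p) / ?D ^ (p + q + 1)"
        unfolding IH using D by (simp add: field_simps)
      finally show ?thesis .
    next
      fix p' assume [simp]: "p = Suc p'" "q = 0"
      have "?J (p' + 1) (0 + 1) = 2 * pi * of_nat (p' + 0 choose p') / ?D ^ (p' + 0 + 1)"
        using Suc by (intro Suc(1); simp)
      then show ?thesis using rec[of "p' + 1" 0] zero(1)[of p'] by simp
    next
      fix q' assume [simp]: "p = 0" "q = Suc q'"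
      have "?J (0 + 1) (q' + 1) = 2 * pi * of_nat (0 + q' choose 0) / ?D ^ (0 + q' + 1)"
        using Suc by (intro Suc(1); simp)
      then show ?thesis using rec[of 0 "q' + 1"] zero(2)[of q'] by simp
    qed (use Suc in simp)
  qed
  then show ?thesis .
qed

subsection \<open>Gamma integrals and Laplace transforms\<close>

lemma nn_integral_powr_exp:
  fixes p b g :: real
  assumes p: "p > 0" and b: "b > 0" and g: "g > 0"
  shows "(\<integral>\<^sup>+x\<in>{0<..}. ennreal (x powr (p - 1) * exp (- (b * x powr g))) \<partial>lborel)
    = ennreal (Gamma (p / g) / g * b powr - (p / g))"
proof -
  define f where "f t = t powr (p / g - 1) / exp t" for t :: real
  have pg: "p / g > 0" using p g by simp
  have "(f has_integral Gamma (p / g)) {0..}" unfolding f_def by (rule Gamma_integral_real[OF pg])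
  then have f: "(f has_integral Gamma (p / g)) {0<..}"
    by (subst has_integral_spike_set_eq[where T = "{0..}"]) (auto intro: negligible_subset[of "{0}"])
  then have fa: "f absolutely_integrable_on {0<..}"
    by (intro nonnegative_absolutely_integrable_1) (auto simp: f_def has_integral_integrable)
  let ?h = "\<lambda>x. b * x powr g" and ?h' = "\<lambda>x. b * (g * x powr (g - 1))"
  have img: "?h ` {0<..} = {0<..}"
  proof (intro set_eqI iffI)
    fix t assume "t \<in> {0::real<..}"
    then have "t = ?h ((t / b) powr (1 / g))" "(t / b) powr (1 / g) \<in> {0<..}"
      using b g by (auto simp: powr_powr)
    then show "t \<in> ?h ` {0<..}" by blast
  qed (use b in auto)
  have inj: "inj_on ?h {0<..}"
  proof (rule inj_onI)
    fix x y :: real assume "x \<in> {0<..}" "y \<in> {0<..}" "?h x = ?h y"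
    then have "(x powr g) powr (1 / g) = (y powr g) powr (1 / g)" "x > 0" "y > 0" using b by auto
    then show "x = y" using g by (simp add: powr_powr)
  qed
  have "(\<lambda>x. \<bar>?h' x\<bar> * f (?h x)) absolutely_integrable_on {0<..} \<and>
      integral {0<..} (\<lambda>x. \<bar>?h' x\<bar> * f (?h x)) = Gamma (p / g)"
    using fa f
    by (subst has_absolute_integral_change_of_variables_1'[OF _ _ inj])
      (auto simp: img integral_unique intro!: derivative_eq_intros)
  then have I: "((\<lambda>x. \<bar>?h' x\<bar> * f (?h x)) has_integral Gamma (p / g)) {0<..}"
    by (auto simp: has_integral_iff absolutely_integrable_on_def)
  have eq: "x powr (p - 1) * exp (- (b * x powr g)) = (b powr - (p / g) / g) * (\<bar>?h' x\<bar> * f (?h x))" if x: "x > 0" for x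
  proof -
    have "f (?h x) = b powr (p / g - 1) * x powr (p - g) * exp (- (b * x powr g))"
    proof -
      have "g * (p / g - 1) = p - g" using g by (simp add: field_simps)
      then have "(b * x powr g) powr (p / g - 1) = b powr (p / g - 1) * x powr (p - g)"
        using x b by (simp add: powr_mult powr_powr)
      then show ?thesis by (simp add: f_def exp_minus divide_inverse)
    qed
    then have "(b powr - (p / g) / g) * (\<bar>?h' x\<bar> * f (?h x)) =
        (b powr - (p / g) * b * b powr (p / g - 1)) * (x powr (g - 1) * x powr (p - g)) * exp (- (b * x powr g))"
      using x b g by (simp add: abs_mult)
    also have "x powr (g - 1) * x powr (p - g) = x powr (p - 1)" by (simp flip: powr_add)
    also have "b powr - (p / g) * b * b powr (p / g - 1) = 1"
      using b by (simp add: powr_diff powr_minus)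
    finally show ?thesis by simp
  qed
  have "((\<lambda>x. (b powr - (p / g) / g) * (\<bar>?h' x\<bar> * f (?h x))) has_integral (b powr - (p / g) / g) * Gamma (p / g)) {0<..}"
    by (rule has_integral_mult_right[OF I])
  then have "((\<lambda>x. x powr (p - 1) * exp (- (b * x powr g))) has_integral (b powr - (p / g) / g) * Gamma (p / g)) {0<..}"
    by (rule has_integral_eq[rotated]) (simp add: eq)
  from nn_integral_has_integral_lebesgue[OF _ this]
  have "(\<integral>\<^sup>+x. ennreal (indicator {0<..} x * (x powr (p - 1) * exp (- (b * x powr g)))) \<partial>lborel)
    = ennreal ((b powr - (p / g) / g) * Gamma (p / g))" by simp
  also have "(\<integral>\<^sup>+x. ennreal (indicator {0<..} x * (x powr (p - 1) * exp (- (b * x powr g)))) \<partial>lborel) =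
    (\<integral>\<^sup>+x\<in>{0<..}. ennreal (x powr (p - 1) * exp (- (b * x powr g))) \<partial>lborel)"
    by (intro nn_integral_cong) (auto simp: indicator_def)
  finally show ?thesis by (simp add: mult.commute)
qed

lemma nn_integral_powr_exp_linear:
  fixes p c :: real
  assumes "p > 0" "c > 0"
  shows "(\<integral>\<^sup>+t\<in>{0<..}. ennreal (t powr (p - 1) * exp (- (c * t))) \<partial>lborel) = ennreal (Gamma p * c powr - p)"
proof -
  have "(\<integral>\<^sup>+t\<in>{0<..}. ennreal (t powr (p - 1) * exp (- (c * t))) \<partial>lborel) =
      (\<integral>\<^sup>+t\<in>{0<..}. ennreal (t powr (p - 1) * exp (- (c * t powr 1))) \<partial>lborel)"
    by (intro nn_integral_cong) (auto simp: indicator_def)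
  then show ?thesis using nn_integral_powr_exp[OF assms zero_less_one] by simp
qed

text \<open>
  For the principal power this is \<open>Gamma \<nu> / Z powr \<nu>\<close>. Values at noninteger \<open>\<nu>\<close> occur only between two
  radial integrations, so only the case of a positive integer \<open>\<nu>\<close> is ever evaluated.
\<close>

definition laplace_powr :: "real \<Rightarrow> complex \<Rightarrow> complex" where
  "laplace_powr \<nu> Z = (LINT t:{0<..}|lborel. of_real (t powr (\<nu> - 1)) * exp (- (of_real t * Z)))"

lemma laplace_powr_integrable:
  assumes "\<nu> > 0" "Re Z > 0"
  shows "set_integrable lborel {0<..} (\<lambda>t. of_real (t powr (\<nu> - 1)) * exp (- (of_real t * Z)))"
  unfolding set_integrable_def
proof (rule integrableI_bounded)
  have "(\<integral>\<^sup>+t. ennreal (norm (indicat_real {0<..} t *\<^sub>R (of_real (t powr (\<nu> - 1)) * exp (- (of_real t * Z))))) \<partial>lborel)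
      = (\<integral>\<^sup>+t\<in>{0<..}. ennreal (t powr (\<nu> - 1) * exp (- (Re Z * t))) \<partial>lborel)"
    by (intro nn_integral_cong) (auto simp: indicator_def norm_mult mult.commute)
  then show "(\<integral>\<^sup>+t. ennreal (norm (indicat_real {0<..} t *\<^sub>R (of_real (t powr (\<nu> - 1)) * exp (- (of_real t * Z))))) \<partial>lborel) < \<infinity>"
    using nn_integral_powr_exp_linear[OF assms] by simp
qed measurable

lemma laplace_powr_nat:
  assumes Z: "Re Z > 0"
  shows "laplace_powr (real n + 1) Z = fact n / Z ^ (n + 1)"
proof -
  have Z0: "Z \<noteq> 0" using Z by auto
  define I where "I n = (LBINT t=0..\<infinity>. of_real (t ^ n) * exp (- (of_real t * Z)))" for n :: nat
  have int: "set_integrable lborel {0<..} (\<lambda>t. of_real (t ^ n) * exp (- (of_real t * Z)))" for n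
  proof -
    have "set_integrable lborel {0<..} (\<lambda>t. of_real (t ^ n) * exp (- (of_real t * Z))) =
        set_integrable lborel {0<..} (\<lambda>t. of_real (t powr ((real n + 1) - 1)) * exp (- (of_real t * Z)))"
      by (intro set_integrable_cong) (auto simp: powr_realpow)
    then show ?thesis using laplace_powr_integrable[of "real n + 1" Z] Z by simp
  qed
  have lim: "((\<lambda>t. of_real (t ^ n) * exp (- (of_real t * Z))) \<longlongrightarrow> 0) at_top" for n
  proof (rule tendsto_norm_zero_cancel)
    have "((\<lambda>t. t ^ n * exp (- (t * Re Z))) \<longlongrightarrow> 0) at_top" using Z by real_asymp
    moreover have "\<forall>\<^sub>F t in at_top. norm (of_real (t ^ n) * exp (- (of_real t * Z))) = t ^ n * exp (- (t * Re Z))"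
      using eventually_ge_at_top[of 0] by eventually_elim (simp add: norm_mult norm_power)
    ultimately show "((\<lambda>t. norm (of_real (t ^ n) * exp (- (of_real t * Z)))) \<longlongrightarrow> 0) at_top"
      by (simp add: tendsto_cong)
  qed
  have deriv: "((\<lambda>t. exp (- (of_real t * Z))) has_vector_derivative (- Z * exp (- (of_real t * Z)))) (at t)" for t
    by (auto intro!: derivative_eq_intros has_vector_derivative_real_field)
  have I0: "I 0 = 1 / Z"
  proof -
    have "(LBINT t=0..\<infinity>. of_real (t ^ 0) * exp (- (of_real t * Z))) = 0 - (- 1 / Z)"
    proof (rule interval_integral_FTC_integrable[where F = "\<lambda>t. - exp (- (of_real t * Z)) / Z"])
      show "((\<lambda>t. - exp (- (of_real t * Z)) / Z) has_vector_derivative of_real (t ^ 0) * exp (- (of_real t * Z))) (at t)" for t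
        using has_vector_derivative_divide[OF has_vector_derivative_minus[OF deriv[of t]], of Z] Z0 by simp
      show "isCont (\<lambda>t. of_real (t ^ 0) * exp (- (of_real t * Z))) t" for t by (intro continuous_intros)
      show "set_integrable lborel (einterval 0 \<infinity>) (\<lambda>t. of_real (t ^ 0) * exp (- (of_real t * Z)))"
        using int[of 0] by (simp add: zero_ereal_def)
      have "((\<lambda>t. - exp (- (of_real t * Z)) / Z) \<longlongrightarrow> - exp (- (of_real 0 * Z)) / Z) (at_right 0)"
        using Z0 by (intro tendsto_intros) auto
      then show "(((\<lambda>t. - exp (- (of_real t * Z)) / Z) \<circ> real_of_ereal) \<longlongrightarrow> - 1 / Z) (at_right 0)"
        by (simp add: zero_ereal_def ereal_tendsto_simps)
      have "((\<lambda>t. - exp (- (of_real t * Z)) / Z) \<longlongrightarrow> - 0 / Z) at_top"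
        using lim[of 0] Z0 by (intro tendsto_intros) auto
      then show "(((\<lambda>t. - exp (- (of_real t * Z)) / Z) \<circ> real_of_ereal) \<longlongrightarrow> 0) (at_left \<infinity>)"
        by (simp add: ereal_tendsto_simps)
    qed simp
    then show ?thesis by (simp add: I_def)
  qed
  have rec: "Z * I (Suc n) = of_nat (Suc n) * I n" for n
  proof -
    let ?F = "\<lambda>t. of_real (t ^ Suc n) * exp (- (of_real t * Z))"
    let ?f = "\<lambda>t. of_nat (Suc n) * (of_real (t ^ n) * exp (- (of_real t * Z))) - Z * (of_real (t ^ Suc n) * exp (- (of_real t * Z)))"
    have "(LBINT t=0..\<infinity>. ?f t) = 0 - 0"
    proof (rule interval_integral_FTC_integrable[where F = ?F])
      show "(?F has_vector_derivative ?f t) (at t)" for t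
      proof -
        have "((\<lambda>t. complex_of_real (t ^ Suc n)) has_vector_derivative of_real (real (Suc n) * t ^ n)) (at t)"
          using DERIV_pow[of "Suc n" t UNIV] by (intro has_vector_derivative_of_real) simp
        from has_vector_derivative_mult[OF this deriv[of t]] show ?thesis
          by (rule has_vector_derivative_eq_rhs) (simp add: algebra_simps)
      qed
      show "isCont ?f t" for t by (intro continuous_intros)
      show "set_integrable lborel (einterval 0 \<infinity>) ?f"
        unfolding zero_ereal_def einterval_eq by (intro set_integral_diff set_integrable_mult_right int)
      have "(?F \<longlongrightarrow> of_real (0 ^ Suc n) * exp (- (of_real 0 * Z))) (at_right 0)"
        by (intro tendsto_intros)
      then show "((?F \<circ> real_of_ereal) \<longlongrightarrow> 0) (at_right 0)" by (simp add: zero_ereal_def ereal_tendsto_simps)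
      show "((?F \<circ> real_of_ereal) \<longlongrightarrow> 0) (at_left \<infinity>)" using lim[of "Suc n"] by (simp add: ereal_tendsto_simps)
    qed simp
    moreover have "(LBINT t=0..\<infinity>. ?f t) = of_nat (Suc n) * I n - Z * I (Suc n)"
    proof -
      have "(LBINT t=0..\<infinity>. ?f t) = (LINT t:{0<..}|lborel. ?f t)"
        unfolding zero_ereal_def by (rule interval_integral_to_infinity_eq)
      also have "\<dots> = (LINT t:{0<..}|lborel. of_nat (Suc n) * (of_real (t ^ n) * exp (- (of_real t * Z)))) -
          (LINT t:{0<..}|lborel. Z * (of_real (t ^ Suc n) * exp (- (of_real t * Z))))"
        by (intro set_integral_diff(2) set_integrable_mult_right int)
      also have "\<dots> = of_nat (Suc n) * I n - Z * I (Suc n)"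
        unfolding I_def zero_ereal_def interval_integral_to_infinity_eq set_integral_mult_right ..
      finally show ?thesis .
    qed
    ultimately show ?thesis by simp
  qed
  have "I n = fact n / Z ^ (n + 1)"
  proof (induction n)
    case (Suc n)
    have "I (Suc n) = of_nat (Suc n) * I n / Z" using rec[of n] Z0 by (simp add: field_simps)
    then show ?case unfolding Suc using Z0 by (simp add: field_simps)
  qed (simp add: I0)
  moreover have "laplace_powr (real n + 1) Z = I n"
  proof -
    have "I n = (LINT t:{0<..}|lborel. of_real (t ^ n) * exp (- (of_real t * Z)))"
      unfolding I_def zero_ereal_def by (rule interval_integral_to_infinity_eq)
    also have "\<dots> = laplace_powr (real n + 1) Z"
      unfolding laplace_powr_def by (intro set_lebesgue_integral_cong) (auto simp: powr_realpow)
    finally show ?thesis by simp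
  qed
  ultimately show ?thesis by simp
qed

lemma nn_integral_powr_laplace:
  fixes p a g \<nu> c :: real
  assumes p: "p > 0" and a: "a > 0" and g: "g > 0" and \<nu>: "p / g < \<nu>" and c: "c > 0"
  shows "(\<integral>\<^sup>+t\<in>{0<..}. \<integral>\<^sup>+x\<in>{0<..}. ennreal (x powr (p - 1) * (t powr (\<nu> - 1) * exp (- (t * (a * x powr g + c))))) \<partial>lborel \<partial>lborel)
    = ennreal (Gamma (p / g) / g * a powr - (p / g) * (Gamma (\<nu> - p / g) * c powr - (\<nu> - p / g)))"
proof -
  let ?K = "Gamma (p / g) / g * a powr - (p / g)"
  have K: "?K \<ge> 0" using p g by (simp add: Gamma_real_nonneg)
  have "(\<integral>\<^sup>+x\<in>{0<..}. ennreal (x powr (p - 1) * (t powr (\<nu> - 1) * exp (- (t * (a * x powr g + c))))) \<partial>lborel)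
      = ennreal ?K * ennreal (t powr (\<nu> - p / g - 1) * exp (- (c * t)))" if t: "t > 0" for t
  proof -
    have "(\<integral>\<^sup>+x\<in>{0<..}. ennreal (x powr (p - 1) * (t powr (\<nu> - 1) * exp (- (t * (a * x powr g + c))))) \<partial>lborel)
      = (\<integral>\<^sup>+x. ennreal (t powr (\<nu> - 1) * exp (- (c * t))) * (ennreal (x powr (p - 1) * exp (- ((a * t) * x powr g))) * indicator {0<..} x) \<partial>lborel)"
    proof (intro nn_integral_cong)
      fix x :: real
      have e: "exp (- (t * (a * x powr g + c))) = exp (- (c * t)) * exp (- ((a * t) * x powr g))"
        by (simp add: exp_add[symmetric] algebra_simps)
      show "ennreal (x powr (p - 1) * (t powr (\<nu> - 1) * exp (- (t * (a * x powr g + c))))) * indicator {0<..} x =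
          ennreal (t powr (\<nu> - 1) * exp (- (c * t))) * (ennreal (x powr (p - 1) * exp (- ((a * t) * x powr g))) * indicator {0<..} x)"
        unfolding e by (simp add: ennreal_mult mult_ac)
    qed
    also have "\<dots> = ennreal (t powr (\<nu> - 1) * exp (- (c * t))) * ennreal (Gamma (p / g) / g * (a * t) powr - (p / g))"
      using t a p g by (subst nn_integral_cmult) (auto simp: nn_integral_powr_exp)
    also have "\<dots> = ennreal (?K * (t powr (\<nu> - p / g - 1) * exp (- (c * t))))"
    proof -
      have "t powr (\<nu> - 1) * t powr - (p / g) = t powr (\<nu> - p / g - 1)" by (simp add: algebra_simps flip: powr_add)
      then have "t powr (\<nu> - 1) * exp (- (c * t)) * (Gamma (p / g) / g * (a * t) powr - (p / g)) =
          ?K * (t powr (\<nu> - p / g - 1) * exp (- (c * t)))"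
        using t a by (simp add: powr_mult)
      then show ?thesis using p g by (subst ennreal_mult[symmetric]) (auto simp: Gamma_real_nonneg)
    qed
    finally show ?thesis by (simp only: ennreal_mult'[OF K])
  qed
  then have "(\<integral>\<^sup>+t\<in>{0<..}. \<integral>\<^sup>+x\<in>{0<..}. ennreal (x powr (p - 1) * (t powr (\<nu> - 1) * exp (- (t * (a * x powr g + c))))) \<partial>lborel \<partial>lborel)
    = (\<integral>\<^sup>+t. ennreal ?K * (ennreal (t powr (\<nu> - p / g - 1) * exp (- (c * t))) * indicator {0<..} t) \<partial>lborel)"
    by (intro nn_integral_cong) (auto simp: indicator_def)
  also have "\<dots> = ennreal ?K * ennreal (Gamma (\<nu> - p / g) * c powr - (\<nu> - p / g))"
    using \<nu> c by (subst nn_integral_cmult) (auto simp: nn_integral_powr_exp_linear)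
  finally show ?thesis by (simp only: ennreal_mult'[OF K])
qed

text \<open>
  A radial integration lowers the exponent by \<open>p / g\<close> and removes the summand \<open>a * x powr g\<close>.
\<close>

lemma laplace_powr_integral:
  fixes p a g \<nu> :: real
  assumes p: "p > 0" and a: "a > 0" and g: "g > 0" and \<nu>: "p / g < \<nu>" and Z: "Re Z > 0"
  shows "(LINT x:{0<..}|lborel. of_real (x powr (p - 1)) * laplace_powr \<nu> (of_real (a * x powr g) + Z))
    = of_real (Gamma (p / g) / g * a powr - (p / g)) * laplace_powr (\<nu> - p / g) Z"
proof -
  let ?F = "\<lambda>t x. indicat_real {0<..} t *\<^sub>R (indicat_real {0<..} x *\<^sub>R
      (of_real (x powr (p - 1)) * (of_real (t powr (\<nu> - 1)) * exp (- (of_real t * (of_real (a * x powr g) + Z))))))"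
  have "integrable (lborel \<Otimes>\<^sub>M lborel) (\<lambda>(t, x). ?F t x)"
  proof (rule integrableI_bounded)
    have "(\<integral>\<^sup>+q. ennreal (norm (case q of (t, x) \<Rightarrow> ?F t x)) \<partial>(lborel \<Otimes>\<^sub>M lborel)) =
        (\<integral>\<^sup>+t. \<integral>\<^sup>+x. ennreal (norm (?F t x)) \<partial>lborel \<partial>lborel)"
      by (subst lborel.nn_integral_fst[symmetric]) auto
    also have "\<dots> = (\<integral>\<^sup>+t\<in>{0<..}. \<integral>\<^sup>+x\<in>{0<..}. ennreal (x powr (p - 1) * (t powr (\<nu> - 1) * exp (- (t * (a * x powr g + Re Z))))) \<partial>lborel \<partial>lborel)"
      by (intro nn_integral_cong, simp add: nn_integral_multc[symmetric] del: nn_integral_multc, intro nn_integral_cong)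
         (auto simp: indicator_def norm_mult)
    also have "\<dots> < \<infinity>" using nn_integral_powr_laplace[OF p a g \<nu> Z] by simp
    finally show "(\<integral>\<^sup>+q. ennreal (norm (case q of (t, x) \<Rightarrow> ?F t x)) \<partial>(lborel \<Otimes>\<^sub>M lborel)) < \<infinity>" .
  qed measurable
  from lborel_pair.Fubini_integral[OF this]
  have swap: "(LINT x|lborel. LINT t|lborel. ?F t x) = (LINT t|lborel. LINT x|lborel. ?F t x)" .
  have 1: "(LINT x|lborel. LINT t|lborel. ?F t x) =
      (LINT x:{0<..}|lborel. of_real (x powr (p - 1)) * laplace_powr \<nu> (of_real (a * x powr g) + Z))"
    unfolding laplace_powr_def set_lebesgue_integral_def
    by (intro Bochner_Integration.integral_cong refl)
      (auto simp: indicator_def simp flip: integral_mult_right_zero)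
  have 2: "(LINT x|lborel. ?F t x) = indicat_real {0<..} t *\<^sub>R (of_real (Gamma (p / g) / g * a powr - (p / g)) *
      (of_real (t powr (\<nu> - p / g - 1)) * exp (- (of_real t * Z))))" for t
  proof (cases "t > 0")
    case t: True
    have "(LINT x|lborel. ?F t x) = (LINT x|lborel. (of_real (t powr (\<nu> - 1)) * exp (- (of_real t * Z))) *
        of_real (indicat_real {0<..} x * (x powr (p - 1) * exp (- ((a * t) * x powr g)))))"
    proof (intro Bochner_Integration.integral_cong refl)
      fix x :: real
      have e: "exp (- (of_real t * (of_real (a * x powr g) + Z))) = exp (- (of_real t * Z)) * of_real (exp (- ((a * t) * x powr g)))"
        by (simp add: exp_add[symmetric] exp_of_real[symmetric] algebra_simps)
      show "?F t x = (of_real (t powr (\<nu> - 1)) * exp (- (of_real t * Z))) *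
        of_real (indicat_real {0<..} x * (x powr (p - 1) * exp (- ((a * t) * x powr g))))"
        unfolding e using t by (simp add: scaleR_conv_of_real mult_ac)
    qed
    also have "\<dots> = (of_real (t powr (\<nu> - 1)) * exp (- (of_real t * Z))) *
        of_real (LINT x|lborel. indicat_real {0<..} x * (x powr (p - 1) * exp (- ((a * t) * x powr g))))"
      by (simp only: integral_mult_right_zero integral_complex_of_real)
    also have "(LINT x|lborel. indicat_real {0<..} x * (x powr (p - 1) * exp (- ((a * t) * x powr g)))) =
        Gamma (p / g) / g * (a * t) powr - (p / g)"
    proof -
      have "(\<integral>\<^sup>+x. ennreal (indicat_real {0<..} x * (x powr (p - 1) * exp (- ((a * t) * x powr g)))) \<partial>lborel) =
          (\<integral>\<^sup>+x\<in>{0<..}. ennreal (x powr (p - 1) * exp (- ((a * t) * x powr g))) \<partial>lborel)"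
        by (intro nn_integral_cong) (auto simp: indicator_def)
      also have "\<dots> = ennreal (Gamma (p / g) / g * (a * t) powr - (p / g))"
        using p a g t by (intro nn_integral_powr_exp) auto
      finally show ?thesis
        using p g by (subst integral_eq_nn_integral) (auto simp: Gamma_real_nonneg)
    qed
    also have "(of_real (t powr (\<nu> - 1)) * exp (- (of_real t * Z))) * of_real (Gamma (p / g) / g * (a * t) powr - (p / g)) =
        of_real (Gamma (p / g) / g * a powr - (p / g) * (t powr (\<nu> - 1) * t powr - (p / g))) * exp (- (of_real t * Z))"
      using a t by (simp add: powr_mult)
    also have "t powr (\<nu> - 1) * t powr - (p / g) = t powr (\<nu> - p / g - 1)" by (simp add: algebra_simps flip: powr_add)
    finally show ?thesis using t by simp
  qed simp
  have "(LINT t|lborel. LINT x|lborel. ?F t x) = of_real (Gamma (p / g) / g * a powr - (p / g)) * laplace_powr (\<nu> - p / g) Z"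
    unfolding 2 laplace_powr_def set_lebesgue_integral_def integral_mult_right_zero[symmetric] by simp
  then show ?thesis using 1 swap by simp
qed

lemma nn_integral_powr_over_power:
  fixes p b g c :: real
  assumes p: "p > 0" and b: "b > 0" and g: "g > 0" and N: "p / g < real (Suc n)" and c: "c > 0"
  shows "(\<integral>\<^sup>+x\<in>{0<..}. ennreal (x powr (p - 1) / (b * x powr g + c) ^ Suc n) \<partial>lborel)
    = ennreal (Gamma (p / g) * Gamma (real (Suc n) - p / g) / (g * fact n) * b powr - (p / g) * c powr (p / g - real (Suc n)))"
proof -
  let ?\<nu> = "real (Suc n)"
  have *: "ennreal (x powr (p - 1) / (b * x powr g + c) ^ Suc n) * indicator {0<..} x =
      ennreal (1 / fact n) * (\<integral>\<^sup>+t. ennreal (x powr (p - 1) * (t powr (?\<nu> - 1) * exp (- (t * (b * x powr g + c)))))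
        * indicator {0<..} x * indicator {0<..} t \<partial>lborel)" for x
  proof (cases "x > 0")
    case x: True
    have pos: "b * x powr g + c > 0" using b c by (simp add: add_nonneg_pos)
    have "(\<integral>\<^sup>+t. ennreal (x powr (p - 1) * (t powr (?\<nu> - 1) * exp (- (t * (b * x powr g + c)))))
        * indicator {0<..} x * indicator {0<..} t \<partial>lborel) =
      (\<integral>\<^sup>+t. ennreal (x powr (p - 1)) * (ennreal (t powr (?\<nu> - 1) * exp (- ((b * x powr g + c) * t))) * indicator {0<..} t) \<partial>lborel)"
      using x by (intro nn_integral_cong) (auto simp: indicator_def ennreal_mult[symmetric] mult.commute)
    also have "\<dots> = ennreal (x powr (p - 1)) * ennreal (Gamma ?\<nu> * (b * x powr g + c) powr - ?\<nu>)"
      by (subst nn_integral_cmult, measurable, subst nn_integral_powr_exp_linear) (use pos in auto)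
    also have "Gamma ?\<nu> = fact n" using Gamma_fact[of n, where 'a = real] by (simp add: add.commute)
    also have "(b * x powr g + c) powr - ?\<nu> = 1 / (b * x powr g + c) ^ Suc n"
      using pos by (simp only: powr_minus powr_realpow) (simp add: field_simps)
    finally show ?thesis using x pos by (simp add: ennreal_mult[symmetric])
  qed simp
  have "(\<integral>\<^sup>+x\<in>{0<..}. ennreal (x powr (p - 1) / (b * x powr g + c) ^ Suc n) \<partial>lborel) =
      ennreal (1 / fact n) * (\<integral>\<^sup>+x. \<integral>\<^sup>+t. ennreal (x powr (p - 1) * (t powr (?\<nu> - 1) * exp (- (t * (b * x powr g + c)))))
        * indicator {0<..} x * indicator {0<..} t \<partial>lborel \<partial>lborel)"
    unfolding * by (rule nn_integral_cmult) measurable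
  also have "(\<integral>\<^sup>+x. \<integral>\<^sup>+t. ennreal (x powr (p - 1) * (t powr (?\<nu> - 1) * exp (- (t * (b * x powr g + c)))))
        * indicator {0<..} x * indicator {0<..} t \<partial>lborel \<partial>lborel) =
      (\<integral>\<^sup>+t. \<integral>\<^sup>+x. ennreal (x powr (p - 1) * (t powr (?\<nu> - 1) * exp (- (t * (b * x powr g + c)))))
        * indicator {0<..} x * indicator {0<..} t \<partial>lborel \<partial>lborel)"
    by (rule lborel_pair.Fubini') measurable
  also have "\<dots> = (\<integral>\<^sup>+t\<in>{0<..}. \<integral>\<^sup>+x\<in>{0<..}. ennreal (x powr (p - 1) * (t powr (?\<nu> - 1) * exp (- (t * (b * x powr g + c))))) \<partial>lborel \<partial>lborel)"
    by (intro nn_integral_cong nn_integral_multc) measurable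
  also have "\<dots> = ennreal (Gamma (p / g) / g * b powr - (p / g) * (Gamma (?\<nu> - p / g) * c powr - (?\<nu> - p / g)))"
    by (rule nn_integral_powr_laplace[OF p b g N c])
  finally show ?thesis
    using p g N by (subst (asm) ennreal_mult[symmetric]) (simp_all add: Gamma_real_nonneg mult_ac)
qed

section \<open>Integration over the hypersurface\<close>

lemma param_measurable [measurable]: "param \<gamma> \<in> borel_measurable borel"
proof -
  have [measurable]: "cis \<in> borel_measurable borel"
    by (intro borel_measurable_continuous_onI continuous_intros)
  show ?thesis unfolding param_def borel_prod[symmetric] by measurable
qed

lemma param_domain_sets [measurable]: "param_domain \<in> sets borel"
  unfolding param_domain_def borel_prod[symmetric] by measurable

lemma fst_param [simp]: "fst (param \<gamma> (s, \<alpha>, \<theta>)) = of_real \<alpha> * cis \<theta>"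
  and snd_param [simp]: "snd (param \<gamma> (s, \<alpha>, \<theta>)) = Complex s (\<alpha> powr \<gamma>)"
  by (simp_all add: param_def)

lemma param_hypersurface: "p \<in> param_domain \<Longrightarrow> param \<gamma> p \<in> hypersurface \<gamma>"
  by (auto simp: param_def param_domain_def hypersurface_def norm_mult)

lemma sets_mu [simp, measurable_cong]: "sets (mu \<gamma> r) = sets (restrict_space borel (hypersurface \<gamma>))"
  and space_mu [simp]: "space (mu \<gamma> r) = hypersurface \<gamma>"
  by (simp_all add: mu_def space_restrict_space)

lemma borel_measurable_mu: "f \<in> borel_measurable borel \<Longrightarrow> f \<in> borel_measurable (mu \<gamma> r)"
  unfolding measurable_cong_sets[OF sets_mu refl] by (rule measurable_restrict_space1)

lemma param_measurable_mu:
  "param \<gamma> \<in> restrict_space lborel param_domain \<rightarrow>\<^sub>M restrict_space borel (hypersurface \<gamma>)"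
  by (intro measurable_restrict_space3) (auto simp: param_hypersurface)

lemma pullback_measurable:
  fixes G :: "complex \<times> complex \<Rightarrow> 'a::{second_countable_topology, real_normed_vector}"
  assumes "G \<in> borel_measurable (mu \<gamma> r)"
  shows "(\<lambda>p. indicat_real param_domain p *\<^sub>R G (param \<gamma> p)) \<in> borel_measurable borel"
proof -
  have "(\<lambda>p. G (param \<gamma> p)) \<in> borel_measurable (restrict_space lborel param_domain)"
    by (rule measurable_compose[OF param_measurable_mu]) (use assms in \<open>simp only: measurable_cong_sets[OF sets_mu refl]\<close>)
  then show ?thesis by (subst (asm) borel_measurable_restrict_space_iff) auto
qed

lemma pullback_measurable_ennreal:
  fixes G :: "complex \<times> complex \<Rightarrow> ennreal"
  assumes "G \<in> borel_measurable (mu \<gamma> r)"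
  shows "(\<lambda>p. G (param \<gamma> p) * indicator param_domain p) \<in> borel_measurable borel"
proof -
  have "(\<lambda>p. G (param \<gamma> p)) \<in> borel_measurable (restrict_space lborel param_domain)"
    by (rule measurable_compose[OF param_measurable_mu]) (use assms in \<open>simp only: measurable_cong_sets[OF sets_mu refl]\<close>)
  then show ?thesis by (subst (asm) borel_measurable_restrict_space_iff_ennreal) auto
qed

lemma param_weight_measurable [measurable]:
  "(\<lambda>(s, \<alpha>, \<theta>). ennreal (\<alpha> powr r)) \<in> borel_measurable (borel :: (real \<times> real \<times> real) measure)"
  unfolding borel_prod[symmetric] by measurable

lemma indicator_param_domain:
  "indicator param_domain (s, \<alpha>, \<theta>) = (indicator {0<..} \<alpha> * indicator {0..<2 * pi} \<theta> :: 'a::comm_semiring_1)"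
  by (auto simp: param_domain_def indicator_def)

lemma nn_integral_mu:
  assumes G: "G \<in> borel_measurable (mu \<gamma> r)"
  shows "(\<integral>\<^sup>+z. G z \<partial>mu \<gamma> r) = (\<integral>\<^sup>+\<alpha>\<in>{0<..}. (\<integral>\<^sup>+s. (\<integral>\<^sup>+\<theta>\<in>{0..<2 * pi}.
    ennreal (\<alpha> powr r) * G (param \<gamma> (s, \<alpha>, \<theta>)) \<partial>lborel) \<partial>lborel) \<partial>lborel)"
proof -
  let ?w = "\<lambda>(s::real, \<alpha>, \<theta>::real). ennreal (\<alpha> powr r)"
  define F where "F p = ?w p * (G (param \<gamma> p) * indicator param_domain p)" for p
  have G': "G \<in> borel_measurable (restrict_space borel (hypersurface \<gamma>))"
    using G by (simp only: measurable_cong_sets[OF sets_mu refl])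
  have w: "?w \<in> borel_measurable (restrict_space lborel param_domain)"
    by (intro measurable_restrict_space1) simp
  have Gp: "(\<lambda>p. G (param \<gamma> p)) \<in> borel_measurable (restrict_space lborel param_domain)"
    by (rule measurable_compose[OF param_measurable_mu G'])
  have F: "F \<in> borel_measurable borel" unfolding F_def[abs_def]
    using param_weight_measurable pullback_measurable_ennreal[OF G] by (rule borel_measurable_times_ennreal)
  then have F2 [measurable]: "F \<in> borel_measurable (borel \<Otimes>\<^sub>M (borel \<Otimes>\<^sub>M borel))"
    by (simp add: borel_prod)
  have F3: "F \<in> borel_measurable (lborel \<Otimes>\<^sub>M (lborel :: (real \<times> real) measure))"
    unfolding lborel_prod using F by simp
  have "(\<integral>\<^sup>+z. G z \<partial>mu \<gamma> r) = (\<integral>\<^sup>+p. G (param \<gamma> p) \<partial>density (restrict_space lborel param_domain) ?w)"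
    unfolding mu_def using param_measurable_mu G' by (subst nn_integral_distr) simp_all
  also have "\<dots> = (\<integral>\<^sup>+p. ?w p * G (param \<gamma> p) \<partial>restrict_space lborel param_domain)"
    by (rule nn_integral_density[OF w Gp])
  also have "\<dots> = (\<integral>\<^sup>+p. F p \<partial>lborel)"
    by (subst nn_integral_restrict_space) (simp_all add: F_def[abs_def] mult.assoc)
  also have "\<dots> = (\<integral>\<^sup>+s. \<integral>\<^sup>+q. F (s, q) \<partial>lborel \<partial>lborel)"
    unfolding lborel_prod[symmetric, where 'a = real and 'b = "real \<times> real"]
    by (rule lborel.nn_integral_fst[symmetric, OF F3])
  also have "\<dots> = (\<integral>\<^sup>+s. \<integral>\<^sup>+\<alpha>. \<integral>\<^sup>+\<theta>. F (s, \<alpha>, \<theta>) \<partial>lborel \<partial>lborel \<partial>lborel)"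
    unfolding lborel_prod[symmetric, where 'a = real and 'b = real]
    by (intro nn_integral_cong lborel.nn_integral_fst[symmetric]) measurable
  also have "\<dots> = (\<integral>\<^sup>+\<alpha>. \<integral>\<^sup>+s. \<integral>\<^sup>+\<theta>. F (s, \<alpha>, \<theta>) \<partial>lborel \<partial>lborel \<partial>lborel)"
    by (rule lborel_pair.Fubini') measurable
  also have "\<dots> = (\<integral>\<^sup>+\<alpha>\<in>{0<..}. (\<integral>\<^sup>+s. (\<integral>\<^sup>+\<theta>\<in>{0..<2 * pi}.
    ennreal (\<alpha> powr r) * G (param \<gamma> (s, \<alpha>, \<theta>)) \<partial>lborel) \<partial>lborel) \<partial>lborel)"
  proof (intro nn_integral_cong)
    fix \<alpha> :: real
    show "(\<integral>\<^sup>+s. \<integral>\<^sup>+\<theta>. F (s, \<alpha>, \<theta>) \<partial>lborel \<partial>lborel) = (\<integral>\<^sup>+s. (\<integral>\<^sup>+\<theta>\<in>{0..<2 * pi}.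
      ennreal (\<alpha> powr r) * G (param \<gamma> (s, \<alpha>, \<theta>)) \<partial>lborel) \<partial>lborel) * indicator {0<..} \<alpha>"
      by (cases "\<alpha> > 0") (simp_all add: F_def indicator_param_domain mult_ac)
  qed
  finally show ?thesis .
qed

text \<open>
  The order of the variables is the one of the iterated integral in the definition of \<open>leray_mode\<close>; the
  angle comes last because the Fourier coefficient is an integral in \<open>\<theta>\<close>.
\<close>

lemma lborel_integral_rotate:
  fixes F :: "real \<times> real \<times> real \<Rightarrow> complex"
  assumes F: "integrable lborel F"
  shows "(LINT p|lborel. F p) = (LINT \<alpha>|lborel. LINT s|lborel. LINT \<theta>|lborel. F (s, \<alpha>, \<theta>))"
proof -
  have [measurable]: "F \<in> borel_measurable (borel \<Otimes>\<^sub>M (borel \<Otimes>\<^sub>M borel))"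
    using borel_measurable_integrable[OF F] by (simp add: borel_prod)
  have F2: "integrable (lborel \<Otimes>\<^sub>M lborel) (case_prod (\<lambda>s q. F (s, q)))"
    using F by (simp add: lborel_prod)
  have "(LINT p|lborel. F p) = (LINT q|lborel. LINT s|lborel. F (s, q))"
    using lborel_pair.integral_snd[OF F2] by (simp add: lborel_prod)
  also have "\<dots> = (LINT \<alpha>|lborel. LINT \<theta>|lborel. LINT s|lborel. F (s, \<alpha>, \<theta>))"
  proof -
    have "integrable lborel (\<lambda>q. LINT s|lborel. F (s, q))"
      using lborel_pair.integrable_snd[OF F2] .
    then have "integrable (lborel \<Otimes>\<^sub>M lborel) (case_prod (\<lambda>\<alpha> \<theta>. LINT s|lborel. F (s, \<alpha>, \<theta>)))"
      by (simp add: lborel_prod case_prod_unfold)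
    from lborel_pair.integral_fst[OF this] show ?thesis by (simp add: lborel_prod case_prod_unfold)
  qed
  also have "\<dots> = (LINT \<alpha>|lborel. LINT s|lborel. LINT \<theta>|lborel. F (s, \<alpha>, \<theta>))"
  proof (rule integral_cong_AE)
    have "(\<integral>\<^sup>+\<alpha>. \<integral>\<^sup>+s. \<integral>\<^sup>+\<theta>. ennreal (norm (F (s, \<alpha>, \<theta>))) \<partial>lborel \<partial>lborel \<partial>lborel) =
        (\<integral>\<^sup>+s. \<integral>\<^sup>+\<alpha>. \<integral>\<^sup>+\<theta>. ennreal (norm (F (s, \<alpha>, \<theta>))) \<partial>lborel \<partial>lborel \<partial>lborel)"
      by (rule lborel_pair.Fubini'[symmetric]) measurable
    also have "\<dots> = (\<integral>\<^sup>+s. \<integral>\<^sup>+q. ennreal (norm (F (s, q))) \<partial>lborel \<partial>lborel)"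
      unfolding lborel_prod[symmetric, where 'a = real and 'b = real]
      by (intro nn_integral_cong lborel.nn_integral_fst) measurable
    also have "\<dots> = (\<integral>\<^sup>+p. ennreal (norm (F p)) \<partial>lborel)"
      unfolding lborel_prod[symmetric, where 'a = real and 'b = "real \<times> real"]
      by (rule lborel.nn_integral_fst) (use borel_measurable_integrable[OF F2] in simp)
    also have "\<dots> < \<infinity>" using F by (simp add: integrable_iff_bounded)
    finally have "AE \<alpha> in lborel. (\<integral>\<^sup>+s. \<integral>\<^sup>+\<theta>. ennreal (norm (F (s, \<alpha>, \<theta>))) \<partial>lborel \<partial>lborel) \<noteq> \<infinity>"
      by (intro nn_integral_noteq_infinite) auto
    then show "AE \<alpha> in lborel. (LINT \<theta>|lborel. LINT s|lborel. F (s, \<alpha>, \<theta>)) = (LINT s|lborel. LINT \<theta>|lborel. F (s, \<alpha>, \<theta>))"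
    proof eventually_elim
      case (elim \<alpha>)
      have "integrable (lborel \<Otimes>\<^sub>M lborel) (case_prod (\<lambda>s \<theta>. F (s, \<alpha>, \<theta>)))"
      proof (rule integrableI_bounded)
        have "(\<integral>\<^sup>+p. ennreal (norm (case_prod (\<lambda>s \<theta>. F (s, \<alpha>, \<theta>)) p)) \<partial>(lborel \<Otimes>\<^sub>M lborel)) =
            (\<integral>\<^sup>+s. \<integral>\<^sup>+\<theta>. ennreal (norm (F (s, \<alpha>, \<theta>))) \<partial>lborel \<partial>lborel)"
          by (subst lborel.nn_integral_fst[symmetric]) (simp_all, measurable)
        then show "(\<integral>\<^sup>+p. ennreal (norm (case_prod (\<lambda>s \<theta>. F (s, \<alpha>, \<theta>)) p)) \<partial>(lborel \<Otimes>\<^sub>M lborel)) < \<infinity>"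
          using elim by (simp add: less_top)
      qed measurable
      from lborel_pair.Fubini_integral[OF this] show ?case .
    qed
  qed measurable
  finally show ?thesis .
qed

lemma integral_mu:
  fixes G :: "complex \<times> complex \<Rightarrow> complex"
  assumes G: "integrable (mu \<gamma> r) G"
  shows "(LINT z|(mu \<gamma> r). G z) = (LINT \<alpha>:{0<..}|lborel. (LINT s|lborel. (LINT \<theta>:{0..<2 * pi}|lborel.
    of_real (\<alpha> powr r) * G (param \<gamma> (s, \<alpha>, \<theta>)))))"
proof -
  let ?w = "\<lambda>p::real \<times> real \<times> real. fst (snd p) powr r"
  let ?R = "restrict_space lborel param_domain"
  have mu: "mu \<gamma> r = distr (density ?R (\<lambda>p. ennreal (?w p))) (restrict_space borel (hypersurface \<gamma>)) (param \<gamma>)"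
    by (simp add: mu_def case_prod_unfold)
  have G': "G \<in> borel_measurable (restrict_space borel (hypersurface \<gamma>))"
    using borel_measurable_integrable[OF G] by (simp only: measurable_cong_sets[OF sets_mu refl])
  have Gp: "(\<lambda>p. G (param \<gamma> p)) \<in> borel_measurable ?R"
    by (rule measurable_compose[OF param_measurable_mu G'])
  have w: "?w \<in> borel_measurable ?R"
    by (intro measurable_restrict_space1) (simp add: borel_prod[symmetric], measurable)
  have pm: "param \<gamma> \<in> density ?R (\<lambda>p. ennreal (?w p)) \<rightarrow>\<^sub>M restrict_space borel (hypersurface \<gamma>)"
    using param_measurable_mu by simp
  define F where "F p = indicat_real param_domain p *\<^sub>R (?w p *\<^sub>R G (param \<gamma> p))" for p
  have "integrable (density ?R (\<lambda>p. ennreal (?w p))) (\<lambda>p. G (param \<gamma> p))"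
    using G unfolding mu by (subst (asm) integrable_distr_eq[OF pm G'])
  then have "integrable ?R (\<lambda>p. ?w p *\<^sub>R G (param \<gamma> p))"
    by (subst (asm) integrable_density[OF Gp w]) simp_all
  then have F: "integrable lborel F"
    by (subst (asm) integrable_restrict_space) (simp_all add: F_def[abs_def])
  have "(LINT z|(mu \<gamma> r). G z) = (LINT p|density ?R (\<lambda>p. ennreal (?w p)). G (param \<gamma> p))"
    unfolding mu by (rule integral_distr[OF pm G'])
  also have "\<dots> = (LINT p|?R. ?w p *\<^sub>R G (param \<gamma> p))"
    by (rule integral_density[OF Gp w]) simp
  also have "\<dots> = (LINT p|lborel. F p)"
    by (subst integral_restrict_space) (simp_all add: F_def[abs_def])
  also have "\<dots> = (LINT \<alpha>|lborel. LINT s|lborel. LINT \<theta>|lborel. F (s, \<alpha>, \<theta>))"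
    by (rule lborel_integral_rotate[OF F])
  also have "\<dots> = (LINT \<alpha>:{0<..}|lborel. (LINT s|lborel. (LINT \<theta>:{0..<2 * pi}|lborel.
    of_real (\<alpha> powr r) * G (param \<gamma> (s, \<alpha>, \<theta>)))))"
    unfolding set_lebesgue_integral_def
  proof (intro Bochner_Integration.integral_cong refl)
    fix \<alpha> :: real
    show "(LINT s|lborel. LINT \<theta>|lborel. F (s, \<alpha>, \<theta>)) = indicat_real {0<..} \<alpha> *\<^sub>R (LINT s|lborel. LINT \<theta>|lborel.
      indicat_real {0..<2 * pi} \<theta> *\<^sub>R (of_real (\<alpha> powr r) * G (param \<gamma> (s, \<alpha>, \<theta>))))"
      by (cases "\<alpha> > 0") (simp_all add: F_def indicator_param_domain scaleR_conv_of_real)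
  qed
  finally show ?thesis .
qed

lemma AE_mu_nonzero: "AE z in mu \<gamma> r. fst z \<noteq> 0"
proof -
  have [measurable]: "(\<lambda>z. indicator {z. fst z = (0::complex)} z) \<in> borel_measurable (mu \<gamma> r)"
    by (intro borel_measurable_mu borel_measurable_indicator borel_closed closed_Collect_eq continuous_intros)
  have "(\<integral>\<^sup>+z. indicator {z. fst z = (0::complex)} z \<partial>mu \<gamma> r) = (\<integral>\<^sup>+\<alpha>. 0 \<partial>(lborel :: real measure))"
    by (subst nn_integral_mu, measurable, intro nn_integral_cong) (auto simp: indicator_def)
  then have "AE z in mu \<gamma> r. (indicator {z. fst z = (0::complex)} z :: ennreal) = 0"
    using nn_integral_0_iff_AE[of "\<lambda>z. indicator {z. fst z = (0::complex)} z" "mu \<gamma> r"] by simp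
  then show ?thesis by eventually_elim (auto simp: indicator_def split: if_splits)
qed

lemma sigma_finite_mu: "sigma_finite_measure (mu \<gamma> r)"
proof
  define A where "A n = {z \<in> hypersurface \<gamma>. (1 / real (Suc n) \<le> cmod (fst z) \<and> cmod (fst z) \<le> real (Suc n) \<and>
    \<bar>Re (snd z)\<bar> \<le> real (Suc n)) \<or> fst z = 0}" for n
  have [measurable]: "A n \<in> sets (mu \<gamma> r)" for n
  proof -
    have "{z. (1 / real (Suc n) \<le> cmod (fst z) \<and> cmod (fst z) \<le> real (Suc n) \<and>
      \<bar>Re (snd z)\<bar> \<le> real (Suc n)) \<or> fst z = (0::complex)} \<in> sets (borel :: (complex \<times> complex) measure)"
      by (intro borel_closed closed_Collect_disj closed_Collect_conj closed_Collect_le closed_Collect_eq continuous_intros)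
    moreover have "A n = hypersurface \<gamma> \<inter> {z. (1 / real (Suc n) \<le> cmod (fst z) \<and> cmod (fst z) \<le> real (Suc n) \<and>
      \<bar>Re (snd z)\<bar> \<le> real (Suc n)) \<or> fst z = (0::complex)}" by (auto simp: A_def)
    ultimately show ?thesis unfolding sets_mu by (auto simp: sets_restrict_space)
  qed
  have "emeasure (mu \<gamma> r) (A n) \<noteq> \<infinity>" for n
  proof -
    define m where "m = real (Suc n)"
    have m: "m \<ge> 1" by (simp add: m_def)
    have pw: "\<alpha> powr r \<le> m powr \<bar>r\<bar>" if "1 / m \<le> \<alpha>" "\<alpha> \<le> m" for \<alpha>
    proof (cases "r \<ge> 0")
      case True
      have "0 < 1 / m" using m by simp
      then have "\<alpha> > 0" using that by linarith
      then show ?thesis using True that by (simp add: powr_mono2)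
    next
      case False
      have "\<alpha> powr r \<le> (1 / m) powr r" using that m False by (intro powr_mono2') auto
      also have "\<dots> = m powr (- r)" using m by (simp add: powr_divide powr_minus inverse_eq_divide)
      finally show ?thesis using False by simp
    qed
    have "emeasure (mu \<gamma> r) (A n) = (\<integral>\<^sup>+z. indicator (A n) z \<partial>mu \<gamma> r)"
      by (rule nn_integral_indicator[symmetric]) measurable
    also have "\<dots> = (\<integral>\<^sup>+\<alpha>\<in>{0<..}. (\<integral>\<^sup>+s. (\<integral>\<^sup>+\<theta>\<in>{0..<2 * pi}.
        ennreal (\<alpha> powr r) * indicator (A n) (param \<gamma> (s, \<alpha>, \<theta>)) \<partial>lborel) \<partial>lborel) \<partial>lborel)"
      by (rule nn_integral_mu) measurable
    also have "\<dots> \<le> (\<integral>\<^sup>+\<alpha>. (\<integral>\<^sup>+s. (\<integral>\<^sup>+\<theta>. ennreal (m powr \<bar>r\<bar>) * indicator {1/m..m} \<alpha> * indicator {-m..m} s * indicator {0..2 * pi} \<theta>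
        \<partial>lborel) \<partial>lborel) \<partial>lborel)"
    proof (intro nn_integral_mono)
      fix \<alpha> :: real
      have *: "(\<integral>\<^sup>+\<theta>\<in>{0..<2 * pi}. ennreal (\<alpha> powr r) * indicator (A n) (param \<gamma> (s, \<alpha>, \<theta>)) \<partial>lborel) \<le>
          (\<integral>\<^sup>+\<theta>. ennreal (m powr \<bar>r\<bar>) * indicator {1/m..m} \<alpha> * indicator {-m..m} s * indicator {0..2 * pi} \<theta> \<partial>lborel)"
        if "\<alpha> > 0" for s
        using that pw by (intro nn_integral_mono) (auto simp: indicator_def A_def m_def norm_mult intro!: ennreal_leI)
      show "(\<integral>\<^sup>+s. (\<integral>\<^sup>+\<theta>\<in>{0..<2 * pi}. ennreal (\<alpha> powr r) * indicator (A n) (param \<gamma> (s, \<alpha>, \<theta>)) \<partial>lborel) \<partial>lborel) * indicator {0<..} \<alpha> \<le>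
          (\<integral>\<^sup>+s. (\<integral>\<^sup>+\<theta>. ennreal (m powr \<bar>r\<bar>) * indicator {1/m..m} \<alpha> * indicator {-m..m} s * indicator {0..2 * pi} \<theta> \<partial>lborel) \<partial>lborel)"
        by (cases "\<alpha> > 0") (auto intro!: nn_integral_mono *)
    qed
    also have "\<dots> = ennreal (m powr \<bar>r\<bar>) * (ennreal (m - 1 / m) * (ennreal (2 * m) * ennreal (2 * pi)))"
    proof -
      have "1 / m \<le> 1" using m by simp
      then have "1 / m \<le> m" using m by linarith
      then show ?thesis using m by (simp add: nn_integral_cmult nn_integral_multc mult.assoc emeasure_lborel_Icc_eq)
    qed
    also have "\<dots> < \<infinity>" by (simp add: ennreal_mult_less_top)
    finally show ?thesis by simp
  qed
  moreover have "(\<Union>n. A n) = hypersurface \<gamma>"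
  proof (intro set_eqI iffI)
    fix z :: "complex \<times> complex" assume z: "z \<in> hypersurface \<gamma>"
    obtain n where n: "1 / cmod (fst z) + cmod (fst z) + \<bar>Re (snd z)\<bar> < real n" using reals_Archimedean2 by blast
    have nn: "0 \<le> 1 / cmod (fst z)" "0 \<le> cmod (fst z)" by simp_all
    have "1 / cmod (fst z) \<le> real (Suc n)" using n nn by linarith
    then have "fst z \<noteq> 0 \<Longrightarrow> 1 / real (Suc n) \<le> cmod (fst z)" by (simp add: field_simps)
    moreover have "cmod (fst z) \<le> real (Suc n)" "\<bar>Re (snd z)\<bar> \<le> real (Suc n)" using n nn by linarith+
    ultimately have "z \<in> A n" using z unfolding A_def by blast
    then show "z \<in> (\<Union>n. A n)" by blast
  qed (auto simp: A_def)
  moreover have "range A \<subseteq> sets (mu \<gamma> r)" using \<open>\<And>n. A n \<in> sets (mu \<gamma> r)\<close> by blast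
  ultimately show "\<exists>B. countable B \<and> B \<subseteq> sets (mu \<gamma> r) \<and> \<Union>B = space (mu \<gamma> r) \<and> (\<forall>a\<in>B. emeasure (mu \<gamma> r) a \<noteq> \<infinity>)"
    unfolding space_mu by (intro exI[of _ "range A"]) auto
qed

section \<open>The kernels of the Fourier modes\<close>

definition radius :: "complex \<times> complex \<Rightarrow> real" where "radius z = cmod (fst z)"
definition height :: "complex \<times> complex \<Rightarrow> real" where "height z = Re (snd z)"
definition phase :: "complex \<times> complex \<Rightarrow> complex" where "phase z = sgn (fst z)"

lemma borel_measurable_coordinates [measurable]:
  "radius \<in> borel_measurable (mu \<gamma> r)" "height \<in> borel_measurable (mu \<gamma> r)" "phase \<in> borel_measurable (mu \<gamma> r)"
proof -
  have "radius \<in> borel_measurable borel" "height \<in> borel_measurable borel" "phase \<in> borel_measurable borel"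
    unfolding radius_def[abs_def] height_def[abs_def] phase_def[abs_def] sgn_div_norm borel_prod[symmetric]
    by measurable
  then show "radius \<in> borel_measurable (mu \<gamma> r)" "height \<in> borel_measurable (mu \<gamma> r)" "phase \<in> borel_measurable (mu \<gamma> r)"
    by (auto intro: borel_measurable_mu)
qed

lemma coordinates_param [simp]:
  "\<alpha> > 0 \<Longrightarrow> radius (param \<gamma> (s, \<alpha>, \<theta>)) = \<alpha>" "height (param \<gamma> (s, \<alpha>, \<theta>)) = s"
  "\<alpha> > 0 \<Longrightarrow> phase (param \<gamma> (s, \<alpha>, \<theta>)) = cis \<theta>"
  by (simp_all add: radius_def height_def phase_def norm_mult sgn_mult sgn_of_real)

lemma AE_radius_pos: "AE z in mu \<gamma> r. radius z > 0"
  using AE_mu_nonzero by eventually_elim (simp add: radius_def)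

lemma norm_phase: "radius z > 0 \<Longrightarrow> cmod (phase z) = 1"
  by (auto simp: radius_def phase_def norm_sgn)

lemma nn_integral_mu_le:
  assumes G: "G \<in> borel_measurable (mu \<gamma> r)"
    and le: "\<And>t \<beta> \<phi>. \<beta> > 0 \<Longrightarrow> G (param \<gamma> (t, \<beta>, \<phi>)) \<le> ennreal (w \<beta> * (1 / ((a \<beta>)\<^sup>2 + (t - s)\<^sup>2)))"
    and w: "\<And>\<beta>. \<beta> > 0 \<Longrightarrow> w \<beta> \<ge> 0" and a: "\<And>\<beta>. \<beta> > 0 \<Longrightarrow> a \<beta> > 0"
  shows "(\<integral>\<^sup>+z. G z \<partial>mu \<gamma> r) \<le> (\<integral>\<^sup>+\<beta>\<in>{0<..}. ennreal (2 * pi\<^sup>2 * (\<beta> powr r * w \<beta> / a \<beta>)) \<partial>lborel)"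
proof -
  have "(\<integral>\<^sup>+t. (\<integral>\<^sup>+\<phi>\<in>{0..<2 * pi}. ennreal (\<beta> powr r) * G (param \<gamma> (t, \<beta>, \<phi>)) \<partial>lborel) \<partial>lborel)
      \<le> ennreal (2 * pi\<^sup>2 * (\<beta> powr r * w \<beta> / a \<beta>))" if \<beta>: "\<beta> > 0" for \<beta>
  proof -
    let ?c = "\<beta> powr r * w \<beta>"
    have c: "?c \<ge> 0" using w[OF \<beta>] by simp
    have "(\<integral>\<^sup>+t. (\<integral>\<^sup>+\<phi>\<in>{0..<2 * pi}. ennreal (\<beta> powr r) * G (param \<gamma> (t, \<beta>, \<phi>)) \<partial>lborel) \<partial>lborel) \<le>
        (\<integral>\<^sup>+t. (\<integral>\<^sup>+\<phi>. ennreal (?c * (1 / ((a \<beta>)\<^sup>2 + (t - s)\<^sup>2))) * indicator {0..<2 * pi} \<phi> \<partial>lborel) \<partial>lborel)"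
    proof (intro nn_integral_mono mult_right_mono)
      fix t \<phi> :: real
      have "ennreal (\<beta> powr r) * G (param \<gamma> (t, \<beta>, \<phi>)) \<le> ennreal (\<beta> powr r) * ennreal (w \<beta> * (1 / ((a \<beta>)\<^sup>2 + (t - s)\<^sup>2)))"
        by (intro mult_left_mono le \<beta>) simp
      also have "\<dots> = ennreal (?c * (1 / ((a \<beta>)\<^sup>2 + (t - s)\<^sup>2)))"
        by (subst ennreal_mult'[symmetric]) (simp_all add: mult.assoc)
      finally show "ennreal (\<beta> powr r) * G (param \<gamma> (t, \<beta>, \<phi>)) \<le> ennreal (?c * (1 / ((a \<beta>)\<^sup>2 + (t - s)\<^sup>2)))" .
    qed simp
    also have "\<dots> = (\<integral>\<^sup>+t. ennreal (2 * pi * ?c) * ennreal (1 / ((a \<beta>)\<^sup>2 + (t - s)\<^sup>2)) \<partial>lborel)"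
    proof (intro nn_integral_cong)
      fix t :: real
      have "(\<integral>\<^sup>+\<phi>. ennreal (?c * (1 / ((a \<beta>)\<^sup>2 + (t - s)\<^sup>2))) * indicator {0..<2 * pi} \<phi> \<partial>lborel) =
          ennreal (?c * (1 / ((a \<beta>)\<^sup>2 + (t - s)\<^sup>2))) * ennreal (2 * pi)"
        by (subst nn_integral_cmult_indicator) simp_all
      also have "\<dots> = ennreal ((?c * (1 / ((a \<beta>)\<^sup>2 + (t - s)\<^sup>2))) * (2 * pi))"
        by (rule ennreal_mult''[symmetric]) simp
      also have "(?c * (1 / ((a \<beta>)\<^sup>2 + (t - s)\<^sup>2))) * (2 * pi) = (2 * pi * ?c) * (1 / ((a \<beta>)\<^sup>2 + (t - s)\<^sup>2))"
        by (simp add: mult_ac)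
      also have "ennreal \<dots> = ennreal (2 * pi * ?c) * ennreal (1 / ((a \<beta>)\<^sup>2 + (t - s)\<^sup>2))"
        using c by (intro ennreal_mult') simp
      finally show "(\<integral>\<^sup>+\<phi>. ennreal (?c * (1 / ((a \<beta>)\<^sup>2 + (t - s)\<^sup>2))) * indicator {0..<2 * pi} \<phi> \<partial>lborel) =
          ennreal (2 * pi * ?c) * ennreal (1 / ((a \<beta>)\<^sup>2 + (t - s)\<^sup>2))" .
    qed
    also have "\<dots> = ennreal (2 * pi * ?c) * ennreal (pi / a \<beta>)"
      by (subst nn_integral_cmult) (simp_all add: nn_integral_Poisson[OF a[OF \<beta>]])
    also have "\<dots> = ennreal (2 * pi * ?c * (pi / a \<beta>))"
      using a[OF \<beta>] by (intro ennreal_mult''[symmetric]) simp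
    finally show ?thesis by (simp add: power2_eq_square mult_ac)
  qed
  then show ?thesis
    unfolding nn_integral_mu[OF G] by (intro nn_integral_mono) (auto simp: indicator_def)
qed

text \<open>
  The common form of the estimates for rows, columns and products of the mode kernels: the integral in \<open>s\<close> contributes
  \<open>pi / (b * \<beta> powr \<gamma> + c)\<close>, and the radial integral is a Beta integral.
\<close>

lemma nn_integral_mu_power_le:
  assumes G: "G \<in> borel_measurable (mu \<gamma> r)"
    and le: "\<And>t \<beta> \<phi>. \<beta> > 0 \<Longrightarrow> G (param \<gamma> (t, \<beta>, \<phi>)) \<le>
      ennreal (K * \<beta> powr m / (b * \<beta> powr \<gamma> + c) ^ k * (1 / ((b * \<beta> powr \<gamma> + c)\<^sup>2 + (t - s)\<^sup>2)))"
    and pos: "\<gamma> > 0" "b > 0" "c > 0" "K \<ge> 0"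
    and p: "p = r + m + 1" "p > 0" "p / \<gamma> < real (Suc k)"
  shows "(\<integral>\<^sup>+z. G z \<partial>mu \<gamma> r) \<le> ennreal (2 * pi\<^sup>2 * K *
    (Gamma (p / \<gamma>) * Gamma (real (Suc k) - p / \<gamma>) / (\<gamma> * fact k) * b powr - (p / \<gamma>) * c powr (p / \<gamma> - real (Suc k))))"
proof -
  have D: "b * \<beta> powr \<gamma> + c > 0" for \<beta> using pos by (simp add: add_nonneg_pos)
  have X0: "0 \<le> 2 * pi\<^sup>2 * K" using pos by simp
  have "(\<integral>\<^sup>+z. G z \<partial>mu \<gamma> r) \<le> (\<integral>\<^sup>+\<beta>\<in>{0<..}. ennreal (2 * pi\<^sup>2 *
      (\<beta> powr r * (K * \<beta> powr m / (b * \<beta> powr \<gamma> + c) ^ k) / (b * \<beta> powr \<gamma> + c))) \<partial>lborel)"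
    using D pos by (intro nn_integral_mu_le[OF G le]) (auto simp: less_imp_le)
  also have "\<dots> = (\<integral>\<^sup>+\<beta>. ennreal (2 * pi\<^sup>2 * K) *
      (ennreal (\<beta> powr (p - 1) / (b * \<beta> powr \<gamma> + c) ^ Suc k) * indicator {0<..} \<beta>) \<partial>lborel)"
  proof (intro nn_integral_cong)
    fix \<beta> :: real
    have "\<beta> powr (p - 1) = \<beta> powr r * \<beta> powr m" unfolding p by (simp flip: powr_add)
    then have e: "2 * pi\<^sup>2 * (\<beta> powr r * (K * \<beta> powr m / (b * \<beta> powr \<gamma> + c) ^ k) / (b * \<beta> powr \<gamma> + c))
        = (2 * pi\<^sup>2 * K) * (\<beta> powr (p - 1) / (b * \<beta> powr \<gamma> + c) ^ Suc k)" by (simp add: mult_ac)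
    show "ennreal (2 * pi\<^sup>2 * (\<beta> powr r * (K * \<beta> powr m / (b * \<beta> powr \<gamma> + c) ^ k) / (b * \<beta> powr \<gamma> + c))) * indicator {0<..} \<beta>
        = ennreal (2 * pi\<^sup>2 * K) * (ennreal (\<beta> powr (p - 1) / (b * \<beta> powr \<gamma> + c) ^ Suc k) * indicator {0<..} \<beta>)"
      unfolding e ennreal_mult'[OF X0] by (simp only: mult.assoc)
  qed
  also have "\<dots> = ennreal (2 * pi\<^sup>2 * K) * ennreal (Gamma (p / \<gamma>) * Gamma (real (Suc k) - p / \<gamma>) / (\<gamma> * fact k) *
      b powr - (p / \<gamma>) * c powr (p / \<gamma> - real (Suc k)))"
    by (subst nn_integral_cmult, measurable, subst nn_integral_powr_over_power[OF p(2) pos(2,1) p(3) pos(3)]) auto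
  finally show ?thesis by (simp only: ennreal_mult'[OF X0])
qed

lemma integral_cis_eq_0:
  assumes "m \<noteq> 0"
  shows "(LINT \<theta>:{0..<2 * pi}|lborel. cis (of_int m * \<theta>)) = 0"
proof -
  let ?F = "\<lambda>\<theta>. cis (of_int m * \<theta>) / (\<i> * of_int m)"
  have "(LINT \<theta>:{0..2 * pi}|lborel. cis (of_int m * \<theta>)) = ?F (2 * pi) - ?F 0"
    unfolding set_lebesgue_integral_def
  proof (rule integral_FTC_atLeastAtMost)
    show "(?F has_vector_derivative cis (of_int m * \<theta>)) (at \<theta> within {0..2 * pi})" for \<theta>
    proof -
      have "((\<lambda>z. exp (\<i> * (of_int m * z))) has_field_derivative exp (\<i> * (of_int m * of_real \<theta>)) * (\<i> * of_int m)) (at (of_real \<theta>))"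
        by (auto intro!: derivative_eq_intros)
      from DERIV_cdivide[OF this, of "\<i> * of_int m"]
      have "((\<lambda>z. exp (\<i> * (of_int m * z)) / (\<i> * of_int m)) has_field_derivative exp (\<i> * (of_int m * of_real \<theta>))) (at (of_real \<theta>))"
        using assms by simp
      from has_vector_derivative_real_field[OF this] show ?thesis by (simp add: cis_conv_exp)
    qed
  qed (auto intro!: continuous_intros)
  also have "\<dots> = 0"
    using cis_multiple_2pi[of "of_int m"] by (simp add: mult.commute mult.left_commute)
  also have "(LINT \<theta>:{0..2 * pi}|lborel. cis (of_int m * \<theta>)) = (LINT \<theta>:{0..<2 * pi}|lborel. cis (of_int m * \<theta>))"
    unfolding set_lebesgue_integral_def
  proof (rule integral_cong_AE)
    show "AE \<theta> in lborel. indicat_real {0..2 * pi} \<theta> *\<^sub>R cis (of_int m * \<theta>) = indicat_real {0..<2 * pi} \<theta> *\<^sub>R cis (of_int m * \<theta>)"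
      using AE_lborel_singleton[of "2 * pi"] by eventually_elim (auto simp: indicator_def)
    have [measurable]: "cis \<in> borel_measurable borel" by (intro borel_measurable_continuous_onI continuous_intros)
    show "(\<lambda>\<theta>. indicat_real {0..2 * pi} \<theta> *\<^sub>R cis (of_int m * \<theta>)) \<in> borel_measurable lborel"
      "(\<lambda>\<theta>. indicat_real {0..<2 * pi} \<theta> *\<^sub>R cis (of_int m * \<theta>)) \<in> borel_measurable lborel" by measurable
  qed
  finally show ?thesis .
qed

lemma integral_mu_phase_eq_0:
  assumes "m \<noteq> 0" and G: "\<And>s \<alpha> \<theta>. \<alpha> > 0 \<Longrightarrow> G (param \<gamma> (s, \<alpha>, \<theta>)) = cis (of_int m * \<theta>) * g s \<alpha>"
  shows "(LINT z|(mu \<gamma> r). G z) = (0::complex)"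
proof (cases "integrable (mu \<gamma> r) G")
  case True
  have "(LINT \<theta>:{0..<2 * pi}|lborel. of_real (\<alpha> powr r) * G (param \<gamma> (s, \<alpha>, \<theta>))) = 0" if "\<alpha> > 0" for s \<alpha>
  proof -
    have "(LINT \<theta>:{0..<2 * pi}|lborel. of_real (\<alpha> powr r) * G (param \<gamma> (s, \<alpha>, \<theta>))) =
        (LINT \<theta>:{0..<2 * pi}|lborel. (of_real (\<alpha> powr r) * g s \<alpha>) * cis (of_int m * \<theta>))"
      using that by (intro set_lebesgue_integral_cong) (auto simp: G mult_ac)
    then show ?thesis by (simp only: set_integral_mult_right integral_cis_eq_0[OF assms(1)] mult_zero_right)
  qed
  then have zero: "indicat_real {0<..} \<alpha> *\<^sub>R (LINT s|lborel. (LINT \<theta>:{0..<2 * pi}|lborel. of_real (\<alpha> powr r) * G (param \<gamma> (s, \<alpha>, \<theta>)))) = 0" for \<alpha>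
    by (cases "\<alpha> > 0") simp_all
  show ?thesis unfolding integral_mu[OF True] set_lebesgue_integral_def[of lborel "{0<..}"] zero by simp
qed (simp add: not_integrable_integral_eq)

lemma integral_mu_phase_free:
  fixes G :: "complex \<times> complex \<Rightarrow> complex" and g :: "real \<Rightarrow> real \<Rightarrow> complex"
  assumes int: "integrable (mu \<gamma> r) G" and G: "\<And>s \<alpha> \<theta>. \<alpha> > 0 \<Longrightarrow> G (param \<gamma> (s, \<alpha>, \<theta>)) = g s \<alpha>"
  shows "(LINT z|(mu \<gamma> r). G z) = (LINT \<alpha>:{0<..}|lborel. of_real (2 * pi * \<alpha> powr r) * (LINT s|lborel. g s \<alpha>))"
  unfolding integral_mu[OF int]
proof (intro set_lebesgue_integral_cong allI impI)
  fix \<alpha> :: real assume "\<alpha> \<in> {0<..}"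
  then have "(LINT \<theta>:{0..<2 * pi}|lborel. of_real (\<alpha> powr r) * G (param \<gamma> (s, \<alpha>, \<theta>))) = of_real (2 * pi * \<alpha> powr r) * g s \<alpha>" for s
    by (simp add: G set_lebesgue_integral_def scaleR_conv_of_real)
  then show "(LINT s|lborel. (LINT \<theta>:{0..<2 * pi}|lborel. of_real (\<alpha> powr r) * G (param \<gamma> (s, \<alpha>, \<theta>)))) =
      of_real (2 * pi * \<alpha> powr r) * (LINT s|lborel. g s \<alpha>)" by (simp only: integral_mult_right_zero)
qed simp

locale leray_setting =
  fixes \<gamma> r :: real
  assumes \<gamma>: "\<gamma> > 1" and r: "-1 < r" "r < 2 * \<gamma> - 1"
begin

abbreviation "\<mu> \<equiv> mu \<gamma> r"

text \<open>
  With respect to \<open>\<mu>\<close> the mode \<open>k\<close> has the kernel \<open>B ^ k / A ^ (k + 2) * \<beta> powr (\<gamma> - 1 - r)\<close> up to constants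
  and phases, since \<open>\<beta> powr (\<gamma> - 1)\<close> is the density of the Leray integral and \<open>\<beta> powr r\<close> that of \<open>\<mu>\<close>. The
  exponent of \<open>\<beta>\<close> is \<open>(\<gamma> - 1) * k\<close> from \<open>B ^ k\<close> plus \<open>\<gamma> - 1 - r\<close>, which is \<open>expo k\<close>. The constant \<open>coeff k\<close>
  contains \<open>\<gamma> ^ k\<close> from \<open>B ^ k\<close> and \<open>1 / (2 * pi)\<close> from the Fourier coefficient.
\<close>

definition coeff :: "nat \<Rightarrow> real" where
  "coeff k = \<gamma> ^ (k + 2) * (real k + 1) / (4 * pi\<^sup>2)"

definition expo :: "nat \<Rightarrow> real" where
  "expo k = (\<gamma> - 1) * (real k + 1) - r"

definition denominator :: "real \<Rightarrow> real \<Rightarrow> real" where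
  "denominator \<alpha> \<beta> = (\<gamma> - 1) * \<beta> powr \<gamma> + \<alpha> powr \<gamma>"

definition radial_kernel :: "nat \<Rightarrow> real \<Rightarrow> real \<Rightarrow> real \<Rightarrow> complex" where
  "radial_kernel k \<alpha> \<beta> t = of_real (coeff k * \<alpha> powr real k * \<beta> powr expo k) / Complex (denominator \<alpha> \<beta>) t ^ (k + 2)"

definition mode_kernel :: "nat \<Rightarrow> complex \<times> complex \<Rightarrow> complex \<times> complex \<Rightarrow> complex" where
  "mode_kernel k z \<zeta> = phase z ^ k * cnj (phase \<zeta>) ^ k *
     radial_kernel k (radius z) (radius \<zeta>) (height \<zeta> - height z)"

lemma coeff_pos: "coeff k > 0"
  using \<gamma> by (simp add: coeff_def)

lemma denominator_pos: "\<alpha> > 0 \<Longrightarrow> \<beta> > 0 \<Longrightarrow> denominator \<alpha> \<beta> > 0"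
  using \<gamma> by (simp add: denominator_def add_pos_pos)

lemma mode_kernel_measurable [measurable]: "(\<lambda>(z, \<zeta>). mode_kernel k z \<zeta>) \<in> borel_measurable (\<mu> \<Otimes>\<^sub>M \<mu>)"
  unfolding mode_kernel_def radial_kernel_def denominator_def by measurable

lemma norm_radial_kernel_le:
  assumes "\<alpha> > 0" "\<beta> > 0"
  shows "cmod (radial_kernel k \<alpha> \<beta> t) \<le>
    coeff k * \<alpha> powr real k * \<beta> powr expo k / denominator \<alpha> \<beta> ^ k * (1 / ((denominator \<alpha> \<beta>)\<^sup>2 + t\<^sup>2))"
proof -
  have "cmod (radial_kernel k \<alpha> \<beta> t) =
      (coeff k * \<alpha> powr real k * \<beta> powr expo k) * (1 / cmod (Complex (denominator \<alpha> \<beta>) t) ^ (k + 2))"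
    unfolding radial_kernel_def norm_divide norm_power norm_of_real using coeff_pos[of k] by (simp add: abs_mult)
  also have "\<dots> \<le> (coeff k * \<alpha> powr real k * \<beta> powr expo k) *
      (1 / denominator \<alpha> \<beta> ^ k * (1 / ((denominator \<alpha> \<beta>)\<^sup>2 + t\<^sup>2)))"
    using coeff_pos[of k] denominator_pos[OF assms]
    by (intro mult_left_mono norm_inverse_Complex_power_le) auto
  finally show ?thesis by simp
qed

lemma mode_kernel_param_right:
  "\<beta> > 0 \<Longrightarrow> mode_kernel k z (param \<gamma> (t, \<beta>, \<phi>)) =
    phase z ^ k * cis (- (real k * \<phi>)) * radial_kernel k (radius z) \<beta> (t - height z)"
  by (simp add: mode_kernel_def cis_cnj Complex.DeMoivre)

lemma mode_kernel_param_left: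
  "\<alpha> > 0 \<Longrightarrow> mode_kernel k (param \<gamma> (s, \<alpha>, \<theta>)) \<zeta> =
    cis (real k * \<theta>) * cnj (phase \<zeta>) ^ k * radial_kernel k \<alpha> (radius \<zeta>) (height \<zeta> - s)"
  by (simp add: mode_kernel_def Complex.DeMoivre)

text \<open>
  After integration in \<open>s\<close> and \<open>\<theta>\<close> the kernel is homogeneous of degree \<open>-1 - r\<close> in the two radii, and the
  measure has degree \<open>r + 1\<close>. So every power of the radius that makes the integrals converge is a Schur
  weight. With the exponent \<open>- (r + 1) / 2\<close> both integrals converge for all \<open>k\<close> if \<open>-1 < r < 2 * \<gamma> - 1\<close>.
\<close>

definition weight :: "complex \<times> complex \<Rightarrow> real" where
  "weight z = radius z powr (- ((r + 1) / 2))"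

lemma weight_measurable [measurable]: "weight \<in> borel_measurable \<mu>"
  unfolding weight_def[abs_def] by measurable

sublocale schur_weight \<mu> weight
proof -
  interpret sigma_finite_measure \<mu> by (rule sigma_finite_mu)
  show "schur_weight \<mu> weight"
  proof
    show "AE z in \<mu>. weight z > 0" using AE_radius_pos by eventually_elim (simp add: weight_def)
  qed measurable
qed

lemma mode_kernel_row:
  "\<exists>C\<ge>0. \<forall>z. radius z > 0 \<longrightarrow> (\<integral>\<^sup>+\<zeta>. ennreal (cmod (mode_kernel k z \<zeta>)) * ennreal (weight \<zeta>) \<partial>\<mu>) \<le> ennreal (C * weight z)"
proof -
  define q where "q = (r + 1) / 2"
  define p where "p = r + (expo k - q) + 1"
  have p: "p = (\<gamma> - 1) * (real k + 1) + 1 - q" by (simp add: p_def expo_def)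
  have p_pos: "p > 0"
  proof -
    have "(\<gamma> - 1) * 1 \<le> (\<gamma> - 1) * (real k + 1)" using \<gamma> by (intro mult_left_mono) auto
    then show ?thesis using r unfolding p q_def by (simp add: field_simps)
  qed
  have pg: "p / \<gamma> < real (Suc k)"
  proof -
    have "p < \<gamma> * (real k + 1)" using r unfolding p q_def by (simp add: field_simps)
    then show ?thesis using \<gamma> by (simp add: field_simps)
  qed
  define D where "D = Gamma (p / \<gamma>) * Gamma (real (Suc k) - p / \<gamma>) / (\<gamma> * fact k) * (\<gamma> - 1) powr - (p / \<gamma>)"
  have D: "D \<ge> 0" unfolding D_def using p_pos pg \<gamma> by (simp add: Gamma_real_nonneg)
  define C where "C = 2 * pi\<^sup>2 * coeff k * D"
  have C: "C \<ge> 0" unfolding C_def using D coeff_pos[of k] by simp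
  have "(\<integral>\<^sup>+\<zeta>. ennreal (cmod (mode_kernel k z \<zeta>)) * ennreal (weight \<zeta>) \<partial>\<mu>) \<le> ennreal (C * weight z)" if z: "radius z > 0" for z
  proof -
    define \<alpha> where "\<alpha> = radius z"
    have \<alpha>: "\<alpha> > 0" using z by (simp add: \<alpha>_def)
    have "(\<integral>\<^sup>+\<zeta>. ennreal (cmod (mode_kernel k z \<zeta>)) * ennreal (weight \<zeta>) \<partial>\<mu>) \<le>
        ennreal (2 * pi\<^sup>2 * (coeff k * \<alpha> powr real k) * (D * (\<alpha> powr \<gamma>) powr (p / \<gamma> - real (Suc k))))"
      unfolding D_def
    proof (rule nn_integral_mu_power_le[where s = "height z" and m = "expo k - q"])
      show "(\<lambda>\<zeta>. ennreal (cmod (mode_kernel k z \<zeta>)) * ennreal (weight \<zeta>)) \<in> borel_measurable \<mu>"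
        unfolding mode_kernel_def radial_kernel_def denominator_def by measurable
      fix t \<beta> \<phi> :: real assume \<beta>: "\<beta> > 0"
      have "cmod (mode_kernel k z (param \<gamma> (t, \<beta>, \<phi>))) * weight (param \<gamma> (t, \<beta>, \<phi>)) =
          cmod (radial_kernel k \<alpha> \<beta> (t - height z)) * \<beta> powr (- q)"
        using \<beta> z by (simp add: mode_kernel_param_right norm_mult norm_power norm_phase weight_def q_def \<alpha>_def)
      also have "\<dots> \<le> coeff k * \<alpha> powr real k * \<beta> powr expo k / denominator \<alpha> \<beta> ^ k * (1 / ((denominator \<alpha> \<beta>)\<^sup>2 + (t - height z)\<^sup>2)) * \<beta> powr (- q)"
        by (intro mult_right_mono norm_radial_kernel_le \<alpha> \<beta>) simp
      also have "\<dots> = coeff k * \<alpha> powr real k * \<beta> powr (expo k - q) / denominator \<alpha> \<beta> ^ k * (1 / ((denominator \<alpha> \<beta>)\<^sup>2 + (t - height z)\<^sup>2))"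
        using powr_add[of \<beta> "expo k" "- q"] by simp
      finally show "ennreal (cmod (mode_kernel k z (param \<gamma> (t, \<beta>, \<phi>)))) * ennreal (weight (param \<gamma> (t, \<beta>, \<phi>))) \<le>
          ennreal (coeff k * \<alpha> powr real k * \<beta> powr (expo k - q) / ((\<gamma> - 1) * \<beta> powr \<gamma> + \<alpha> powr \<gamma>) ^ k *
            (1 / (((\<gamma> - 1) * \<beta> powr \<gamma> + \<alpha> powr \<gamma>)\<^sup>2 + (t - height z)\<^sup>2)))"
        unfolding denominator_def by (subst ennreal_mult'[symmetric]) (auto intro: ennreal_leI)
    qed (use \<gamma> \<alpha> p_pos pg coeff_pos[of k] in \<open>auto simp: p_def\<close>)
    also have "2 * pi\<^sup>2 * (coeff k * \<alpha> powr real k) * (D * (\<alpha> powr \<gamma>) powr (p / \<gamma> - real (Suc k))) = C * weight z"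
    proof -
      have "\<alpha> powr real k * (\<alpha> powr \<gamma>) powr (p / \<gamma> - real (Suc k)) = \<alpha> powr (real k + \<gamma> * (p / \<gamma> - real (Suc k)))"
        by (simp only: powr_powr powr_add)
      also have "real k + \<gamma> * (p / \<gamma> - real (Suc k)) = - q"
        using \<gamma> unfolding p by (simp add: field_simps)
      finally show ?thesis unfolding C_def weight_def \<alpha>_def q_def by (simp add: mult_ac)
    qed
    finally show ?thesis .
  qed
  then show ?thesis using C by blast
qed

lemma mode_kernel_column:
  "\<exists>C\<ge>0. \<forall>\<zeta>. radius \<zeta> > 0 \<longrightarrow> (\<integral>\<^sup>+z. ennreal (cmod (mode_kernel k z \<zeta>)) * ennreal (weight z) \<partial>\<mu>) \<le> ennreal (C * weight \<zeta>)"
proof -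
  define q where "q = (r + 1) / 2"
  define p where "p = r + (real k - q) + 1"
  have p: "p = real k + q" by (simp add: p_def q_def field_simps)
  have p_pos: "p > 0" using r unfolding p q_def by (intro add_nonneg_pos) auto
  have pg: "p / \<gamma> < real (Suc k)"
  proof -
    have "q < \<gamma>" using r by (simp add: q_def)
    moreover have "real k \<le> \<gamma> * real k" using \<gamma> mult_right_mono[of 1 \<gamma> "real k"] by simp
    ultimately have "p < \<gamma> * (real k + 1)" unfolding p by (simp add: algebra_simps)
    then show ?thesis using \<gamma> by (simp add: field_simps)
  qed
  define D where "D = Gamma (p / \<gamma>) * Gamma (real (Suc k) - p / \<gamma>) / (\<gamma> * fact k) * 1 powr - (p / \<gamma>)"
  have D: "D \<ge> 0" unfolding D_def using p_pos pg \<gamma> by (simp add: Gamma_real_nonneg)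
  define C where "C = 2 * pi\<^sup>2 * coeff k * D * (\<gamma> - 1) powr (p / \<gamma> - real (Suc k))"
  have C: "C \<ge> 0" unfolding C_def using D coeff_pos[of k] by simp
  have "(\<integral>\<^sup>+z. ennreal (cmod (mode_kernel k z \<zeta>)) * ennreal (weight z) \<partial>\<mu>) \<le> ennreal (C * weight \<zeta>)" if z: "radius \<zeta> > 0" for \<zeta>
  proof -
    define \<beta> where "\<beta> = radius \<zeta>"
    have \<beta>: "\<beta> > 0" using z by (simp add: \<beta>_def)
    have "(\<integral>\<^sup>+z. ennreal (cmod (mode_kernel k z \<zeta>)) * ennreal (weight z) \<partial>\<mu>) \<le>
        ennreal (2 * pi\<^sup>2 * (coeff k * \<beta> powr expo k) * (D * ((\<gamma> - 1) * \<beta> powr \<gamma>) powr (p / \<gamma> - real (Suc k))))"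
      unfolding D_def
    proof (rule nn_integral_mu_power_le[where s = "height \<zeta>" and m = "real k - q"])
      show "(\<lambda>z. ennreal (cmod (mode_kernel k z \<zeta>)) * ennreal (weight z)) \<in> borel_measurable \<mu>"
        unfolding mode_kernel_def radial_kernel_def denominator_def by measurable
      fix s \<alpha> \<theta> :: real assume \<alpha>: "\<alpha> > 0"
      have den: "1 * \<alpha> powr \<gamma> + (\<gamma> - 1) * \<beta> powr \<gamma> = denominator \<alpha> \<beta>" by (simp add: denominator_def)
      have "cmod (mode_kernel k (param \<gamma> (s, \<alpha>, \<theta>)) \<zeta>) * weight (param \<gamma> (s, \<alpha>, \<theta>)) =
          cmod (radial_kernel k \<alpha> \<beta> (height \<zeta> - s)) * \<alpha> powr (- q)"
        using \<alpha> z by (simp add: mode_kernel_param_left norm_mult norm_power norm_phase weight_def q_def \<beta>_def)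
      also have "\<dots> \<le> coeff k * \<alpha> powr real k * \<beta> powr expo k / denominator \<alpha> \<beta> ^ k * (1 / ((denominator \<alpha> \<beta>)\<^sup>2 + (height \<zeta> - s)\<^sup>2)) * \<alpha> powr (- q)"
        by (intro mult_right_mono norm_radial_kernel_le \<alpha> \<beta>) simp
      also have "\<dots> = coeff k * \<beta> powr expo k * \<alpha> powr (real k - q) / denominator \<alpha> \<beta> ^ k * (1 / ((denominator \<alpha> \<beta>)\<^sup>2 + (s - height \<zeta>)\<^sup>2))"
        using powr_add[of \<alpha> "real k" "- q"] by (simp add: power2_commute)
      finally show "ennreal (cmod (mode_kernel k (param \<gamma> (s, \<alpha>, \<theta>)) \<zeta>)) * ennreal (weight (param \<gamma> (s, \<alpha>, \<theta>))) \<le>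
          ennreal (coeff k * \<beta> powr expo k * \<alpha> powr (real k - q) / (1 * \<alpha> powr \<gamma> + (\<gamma> - 1) * \<beta> powr \<gamma>) ^ k *
            (1 / ((1 * \<alpha> powr \<gamma> + (\<gamma> - 1) * \<beta> powr \<gamma>)\<^sup>2 + (s - height \<zeta>)\<^sup>2)))"
        unfolding den by (subst ennreal_mult'[symmetric]) (auto intro: ennreal_leI)
    qed (use \<gamma> \<beta> p_pos pg coeff_pos[of k] in \<open>auto simp: p_def\<close>)
    also have "2 * pi\<^sup>2 * (coeff k * \<beta> powr expo k) * (D * ((\<gamma> - 1) * \<beta> powr \<gamma>) powr (p / \<gamma> - real (Suc k))) = C * weight \<zeta>"
    proof -
      have "\<beta> powr expo k * ((\<gamma> - 1) * \<beta> powr \<gamma>) powr (p / \<gamma> - real (Suc k)) =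
          (\<gamma> - 1) powr (p / \<gamma> - real (Suc k)) * \<beta> powr (expo k + \<gamma> * (p / \<gamma> - real (Suc k)))"
        using \<gamma> by (simp add: powr_mult powr_powr powr_add)
      also have "expo k + \<gamma> * (p / \<gamma> - real (Suc k)) = - q"
        using \<gamma> unfolding p expo_def q_def by (simp add: field_simps)
      finally show ?thesis unfolding C_def weight_def \<beta>_def q_def by (simp add: mult_ac)
    qed
    finally show ?thesis .
  qed
  then show ?thesis using C by blast
qed

lemma mode_kernel_schur: "schur_kernel (mode_kernel k)"
proof -
  obtain C where C: "C \<ge> 0" "\<And>z. radius z > 0 \<Longrightarrow>
      (\<integral>\<^sup>+\<zeta>. ennreal (cmod (mode_kernel k z \<zeta>)) * ennreal (weight \<zeta>) \<partial>\<mu>) \<le> ennreal (C * weight z)"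
    using mode_kernel_row by blast
  obtain D where D: "D \<ge> 0" "\<And>\<zeta>. radius \<zeta> > 0 \<Longrightarrow>
      (\<integral>\<^sup>+z. ennreal (cmod (mode_kernel k z \<zeta>)) * ennreal (weight z) \<partial>\<mu>) \<le> ennreal (D * weight \<zeta>)"
    using mode_kernel_column by blast
  have w: "weight z \<ge> 0" for z by (simp add: weight_def)
  have "schur_bound (\<lambda>z \<zeta>. ennreal (cmod (mode_kernel k z \<zeta>))) (ennreal (max C D))"
    unfolding schur_bound_def
  proof (intro conjI)
    show "AE z in \<mu>. (\<integral>\<^sup>+\<zeta>. ennreal (cmod (mode_kernel k z \<zeta>)) * ennreal (weight \<zeta>) \<partial>\<mu>) \<le> ennreal (max C D) * ennreal (weight z)"
      using AE_radius_pos
    proof eventually_elim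
      case (elim z)
      have "ennreal (C * weight z) \<le> ennreal (max C D * weight z)"
        using w by (intro ennreal_leI mult_right_mono) auto
      with C(2)[OF elim] show ?case using C(1) by (subst ennreal_mult'[symmetric]) (auto intro: order_trans)
    qed
    show "AE z in \<mu>. (\<integral>\<^sup>+x. ennreal (cmod (mode_kernel k x z)) * ennreal (weight x) \<partial>\<mu>) \<le> ennreal (max C D) * ennreal (weight z)"
      using AE_radius_pos
    proof eventually_elim
      case (elim z)
      have "ennreal (D * weight z) \<le> ennreal (max C D * weight z)"
        using w by (intro ennreal_leI mult_right_mono) auto
      with D(2)[OF elim] show ?case using C(1) by (subst ennreal_mult'[symmetric]) (auto intro: order_trans)
    qed
  qed simp
  then show ?thesis unfolding schur_kernel_def using mode_kernel_measurable by blast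
qed

text \<open>
  The integrand has a nonzero frequency in the angle of the intermediate point.
\<close>

lemma compose_different_modes:
  assumes "j \<noteq> k"
  shows "compose_kernel \<mu> (adjoint_kernel (mode_kernel j)) (mode_kernel k) z w = 0"
    and "compose_kernel \<mu> (mode_kernel j) (adjoint_kernel (mode_kernel k)) z w = 0"
proof -
  have cis: "cis a * (cis b * x) = cis (a + b) * x" for a b x by (simp add: cis_mult flip: mult.assoc)
  show "compose_kernel \<mu> (adjoint_kernel (mode_kernel j)) (mode_kernel k) z w = 0"
    unfolding compose_kernel_def adjoint_kernel_def
  proof (rule integral_mu_phase_eq_0[where m = "int k - int j"])
    fix s \<alpha> \<theta> :: real assume "\<alpha> > 0"
    then show "cnj (mode_kernel j (param \<gamma> (s, \<alpha>, \<theta>)) z) * mode_kernel k (param \<gamma> (s, \<alpha>, \<theta>)) w =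
      cis (real_of_int (int k - int j) * \<theta>) *
      (phase z ^ j * cnj (radial_kernel j \<alpha> (radius z) (height z - s)) *
       (cnj (phase w) ^ k * radial_kernel k \<alpha> (radius w) (height w - s)))"
      by (simp add: mode_kernel_param_left cis_cnj mult_ac cis cis_mult) (simp add: algebra_simps)
  qed (use assms in simp)
  show "compose_kernel \<mu> (mode_kernel j) (adjoint_kernel (mode_kernel k)) z w = 0"
    unfolding compose_kernel_def adjoint_kernel_def
  proof (rule integral_mu_phase_eq_0[where m = "int k - int j"])
    fix s \<alpha> \<theta> :: real assume "\<alpha> > 0"
    then show "mode_kernel j z (param \<gamma> (s, \<alpha>, \<theta>)) * cnj (mode_kernel k w (param \<gamma> (s, \<alpha>, \<theta>))) =
      cis (real_of_int (int k - int j) * \<theta>) *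
      (phase z ^ j * radial_kernel j (radius z) \<alpha> (s - height z) *
       (cnj (phase w) ^ k * cnj (radial_kernel k (radius w) \<alpha> (s - height w))))"
      by (simp add: mode_kernel_param_right cis_cnj mult_ac cis cis_mult) (simp add: algebra_simps)
  qed (use assms in simp)
qed

end

section \<open>The composition of three mode kernels\<close>

text \<open>
  The integrand is dominated by the product of an integrable function of \<open>t\<close> and one of \<open>x\<close>, because
  the modulus of a complex number is at least its real part.
\<close>

lemma integral_power_product_swap:
  fixes a c q g u v :: real
  assumes a: "a > 0" and c: "c > 0" and g: "g > 0" and q: "q > 0" "q / g < real (Suc n)"
  shows "(LINT t|lborel. 1 / Complex a (t - u) ^ (m + 2) *
      (LINT x:{0<..}|lborel. of_real (x powr (q - 1)) / Complex (c + 2 * x powr g) (v - t) ^ Suc n)) =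
    (LINT x:{0<..}|lborel. of_real (x powr (q - 1)) *
      (LINT t|lborel. 1 / (Complex a (t - u) ^ (m + 2) * Complex (c + 2 * x powr g) (v - t) ^ Suc n)))"
proof -
  let ?F = "\<lambda>t x. 1 / Complex a (t - u) ^ (m + 2) *
      (indicat_real {0<..} x *\<^sub>R (of_real (x powr (q - 1)) / Complex (c + 2 * x powr g) (v - t) ^ Suc n))"
  have "integrable (lborel \<Otimes>\<^sub>M lborel) (\<lambda>(t, x). ?F t x)"
  proof (rule integrableI_bounded)
    have "(\<integral>\<^sup>+p. ennreal (norm (case p of (t, x) \<Rightarrow> ?F t x)) \<partial>(lborel \<Otimes>\<^sub>M lborel)) =
        (\<integral>\<^sup>+t. \<integral>\<^sup>+x. ennreal (norm (?F t x)) \<partial>lborel \<partial>lborel)"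
      by (subst lborel.nn_integral_fst[symmetric]) auto
    also have "\<dots> \<le> (\<integral>\<^sup>+t. \<integral>\<^sup>+x. ennreal (1 / a ^ m * (1 / (a\<^sup>2 + (t - u)\<^sup>2))) *
        (ennreal (x powr (q - 1) / (2 * x powr g + c) ^ Suc n) * indicator {0<..} x) \<partial>lborel \<partial>lborel)"
    proof (intro nn_integral_mono)
      fix t x :: real
      have 1: "norm (1 / Complex a (t - u) ^ (m + 2)) \<le> 1 / a ^ m * (1 / (a\<^sup>2 + (t - u)\<^sup>2))"
        using norm_inverse_Complex_power_le[OF a, of "t - u" m] by (simp only: norm_divide norm_one norm_power)
      have 2: "norm (of_real (x powr (q - 1)) / Complex (c + 2 * x powr g) (v - t) ^ Suc n) \<le> x powr (q - 1) / (2 * x powr g + c) ^ Suc n"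
      proof -
        have pos: "c + 2 * x powr g > 0" using c by (simp add: add_pos_nonneg)
        have "x powr (q - 1) / cmod (Complex (c + 2 * x powr g) (v - t)) ^ Suc n \<le> x powr (q - 1) / (c + 2 * x powr g) ^ Suc n"
          using norm_Complex_ge[OF pos] pos by (intro divide_left_mono power_mono mult_pos_pos zero_less_power) auto
        then show ?thesis by (simp only: norm_divide norm_power norm_of_real abs_of_nonneg[OF powr_ge_zero] add.commute)
      qed
      have "norm (?F t x) = norm (1 / Complex a (t - u) ^ (m + 2)) *
          (indicat_real {0<..} x * norm (of_real (x powr (q - 1)) / Complex (c + 2 * x powr g) (v - t) ^ Suc n))"
        by (simp only: norm_mult norm_scaleR) (simp add: indicator_def)
      also have "\<dots> \<le> (1 / a ^ m * (1 / (a\<^sup>2 + (t - u)\<^sup>2))) * (indicat_real {0<..} x * (x powr (q - 1) / (2 * x powr g + c) ^ Suc n))"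
        using a by (intro mult_mono 1 2 mult_left_mono) auto
      finally show "ennreal (norm (?F t x)) \<le> ennreal (1 / a ^ m * (1 / (a\<^sup>2 + (t - u)\<^sup>2))) *
        (ennreal (x powr (q - 1) / (2 * x powr g + c) ^ Suc n) * indicator {0<..} x)"
        using a by (cases "x > 0") (auto simp del: power_Suc simp flip: ennreal_mult' intro: ennreal_leI)
    qed
    also have "\<dots> = (\<integral>\<^sup>+t. ennreal (1 / a ^ m * (1 / (a\<^sup>2 + (t - u)\<^sup>2))) \<partial>lborel) *
        (\<integral>\<^sup>+x\<in>{0<..}. ennreal (x powr (q - 1) / (2 * x powr g + c) ^ Suc n) \<partial>lborel)"
      by (simp add: nn_integral_cmult nn_integral_multc del: power_Suc)
    also have "(\<integral>\<^sup>+t. ennreal (1 / a ^ m * (1 / (a\<^sup>2 + (t - u)\<^sup>2))) \<partial>lborel) = ennreal (1 / a ^ m) * ennreal (pi / a)"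
      using a by (subst ennreal_mult', simp, subst nn_integral_cmult) (simp_all add: nn_integral_Poisson)
    also have "(\<integral>\<^sup>+x\<in>{0<..}. ennreal (x powr (q - 1) / (2 * x powr g + c) ^ Suc n) \<partial>lborel) =
        ennreal (Gamma (q / g) * Gamma (real (Suc n) - q / g) / (g * fact n) * 2 powr - (q / g) * c powr (q / g - real (Suc n)))"
      by (rule nn_integral_powr_over_power[OF q(1) _ g q(2) c]) simp
    also have "ennreal (1 / a ^ m) * ennreal (pi / a) * \<dots> < \<infinity>"
      by (simp add: ennreal_mult_less_top)
    finally show "(\<integral>\<^sup>+p. ennreal (norm (case p of (t, x) \<Rightarrow> ?F t x)) \<partial>(lborel \<Otimes>\<^sub>M lborel)) < \<infinity>" .
  qed measurable
  from lborel_pair.Fubini_integral[OF this]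
  have swap: "(LINT x|lborel. LINT t|lborel. ?F t x) = (LINT t|lborel. LINT x|lborel. ?F t x)" .
  have "(LINT t|lborel. LINT x|lborel. ?F t x) = (LINT t|lborel. 1 / Complex a (t - u) ^ (m + 2) *
      (LINT x:{0<..}|lborel. of_real (x powr (q - 1)) / Complex (c + 2 * x powr g) (v - t) ^ Suc n))"
    unfolding set_lebesgue_integral_def by (simp only: integral_mult_right_zero)
  moreover have "(LINT x|lborel. LINT t|lborel. ?F t x) = (LINT x:{0<..}|lborel. of_real (x powr (q - 1)) *
      (LINT t|lborel. 1 / (Complex a (t - u) ^ (m + 2) * Complex (c + 2 * x powr g) (v - t) ^ Suc n)))"
    unfolding set_lebesgue_integral_def
  proof (intro Bochner_Integration.integral_cong refl)
    fix x :: real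
    have "(LINT t|lborel. ?F t x) = (LINT t|lborel. (indicat_real {0<..} x *\<^sub>R of_real (x powr (q - 1))) *
        (1 / (Complex a (t - u) ^ (m + 2) * Complex (c + 2 * x powr g) (v - t) ^ Suc n)))"
      by (intro Bochner_Integration.integral_cong refl) (simp add: scaleR_conv_of_real)
    also have "\<dots> = indicat_real {0<..} x *\<^sub>R (of_real (x powr (q - 1)) *
      (LINT t|lborel. 1 / (Complex a (t - u) ^ (m + 2) * Complex (c + 2 * x powr g) (v - t) ^ Suc n)))"
      unfolding integral_mult_right_zero by (simp only: mult_scaleR_left)
    finally show "(LINT t|lborel. ?F t x) = indicat_real {0<..} x *\<^sub>R (of_real (x powr (q - 1)) *
      (LINT t|lborel. 1 / (Complex a (t - u) ^ (m + 2) * Complex (c + 2 * x powr g) (v - t) ^ Suc n)))" .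
  qed
  ultimately show ?thesis using swap by simp
qed

context leray_setting
begin

text \<open>
  The arguments of the two Gamma factors of \<open>leray_const r \<gamma> k\<close>.
\<close>

definition exponent_X :: "nat \<Rightarrow> real" where "exponent_X k = (2 * real k + 1 + r) / \<gamma>"
definition exponent_Y :: "nat \<Rightarrow> real" where "exponent_Y k = 2 * real k + 2 - exponent_X k"

lemma exponent_X_pos: "exponent_X k > 0"
  using r \<gamma> by (simp add: exponent_X_def)

lemma exponent_Y_eq: "exponent_Y k = (r + 2 * expo k + 1) / \<gamma>"
  using \<gamma> by (simp add: exponent_Y_def exponent_X_def expo_def field_simps)

lemma exponent_Y_pos: "exponent_Y k > 0"
proof -
  define m where "m = (\<gamma> - 1) * (real k + 1)"
  have "(\<gamma> - 1) * 1 \<le> m" unfolding m_def using \<gamma> by (intro mult_left_mono) auto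
  then have "r + 2 * expo k + 1 > 0" using r unfolding expo_def m_def[symmetric] by simp
  then show ?thesis using \<gamma> by (simp add: exponent_Y_eq)
qed

lemma leray_const_pos: "leray_const r \<gamma> k > 0"
proof -
  have "Gamma (exponent_X k) > 0" "Gamma (exponent_Y k) > 0" "Gamma (real k + 1) > 0"
    using exponent_X_pos[of k] exponent_Y_pos[of k] by (auto intro: Gamma_real_pos)
  then show ?thesis using \<gamma>
    unfolding leray_const_def exponent_X_def exponent_Y_def
    by (intro mult_pos_pos divide_pos_pos zero_less_power) auto
qed

text \<open>
  The right-hand side collects the constants that come out of the integrations: the convolution
  formula is used twice, then the two radial integrals and a Laplace transform.
\<close>

lemma leray_const_eq:
  "leray_const r \<gamma> k = 4 * pi\<^sup>2 * (coeff k)\<^sup>2 * of_nat (2 * k + 2 choose (k + 1)) *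
    (4 * pi\<^sup>2 * of_nat (3 * k + 3 choose (k + 1)) / fact (3 * k + 3)) *
    (Gamma (exponent_X k) / \<gamma> * 2 powr - exponent_X k) *
    (Gamma (exponent_Y k) / \<gamma> * (2 * (\<gamma> - 1)) powr - exponent_Y k) * fact (k + 1)"
proof -
  have b1: "real (2 * k + 2 choose (k + 1)) = fact (2 * k + 2) / (fact (k + 1) * fact (k + 1))"
    using binomial_fact[of "k + 1" "2 * k + 2", where 'a = real] by simp
  have b2: "real (3 * k + 3 choose (k + 1)) = fact (3 * k + 3) / (fact (k + 1) * fact (2 * k + 2))"
    using binomial_fact[of "k + 1" "3 * k + 3", where 'a = real] by simp
  have f1: "fact (k + 1) = (real k + 1) * (fact k :: real)" by simp
  have G: "Gamma (real k + 1) = fact k" using Gamma_fact[of k, where 'a = real] by (simp add: add.commute)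
  have "2 powr - exponent_X k * (2 * (\<gamma> - 1)) powr - exponent_Y k =
      2 powr (- exponent_X k - exponent_Y k) * (\<gamma> - 1) powr - exponent_Y k"
  proof -
    have "(2 * (\<gamma> - 1)) powr - exponent_Y k = 2 powr - exponent_Y k * (\<gamma> - 1) powr - exponent_Y k"
      by (rule powr_mult)
    moreover have "(2::real) powr - exponent_X k * 2 powr - exponent_Y k = 2 powr (- exponent_X k - exponent_Y k)"
      by (simp flip: powr_add)
    ultimately show ?thesis by (simp add: mult.assoc[symmetric])
  qed
  also have "- exponent_X k - exponent_Y k = - real (2 * k + 2)" by (simp add: exponent_Y_def)
  also have "2 powr - real (2 * k + 2) = 1 / 2 ^ (2 * k + 2)"
    by (simp only: powr_minus powr_realpow zero_less_numeral inverse_eq_divide)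
  finally have two: "2 powr - exponent_X k * (2 * (\<gamma> - 1)) powr - exponent_Y k =
      1 / 2 ^ (2 * k + 2) * (\<gamma> - 1) powr - exponent_Y k" .
  define P where "P = (\<gamma> - 1) powr - exponent_Y k"
  define A B where "A = Gamma (exponent_X k)" and "B = Gamma (exponent_Y k)"
  define n where "n = real k + 1"
  define w :: real where "w = fact k"
  define g where "g = \<gamma> ^ (k + 1)"
  have nz: "n \<noteq> 0" "w \<noteq> 0" "\<gamma> \<noteq> 0" "(fact (2 * k + 2) :: real) \<noteq> 0" "(fact (3 * k + 3) :: real) \<noteq> 0" "g \<noteq> 0"
    using \<gamma> by (simp_all add: n_def w_def g_def)
  have lc: "leray_const r \<gamma> k = A * B / w\<^sup>2 * (g\<^sup>2 / 2 ^ (2 * k + 2)) * P"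
  proof -
    have "\<gamma> ^ (2 * k + 2) = g\<^sup>2" 
    proof -
      have "2 * k + 2 = (k + 1) * 2" by simp
      then show ?thesis by (simp only: g_def power_mult)
    qed
    then show ?thesis unfolding leray_const_def G A_def B_def P_def w_def exponent_Y_def exponent_X_def
      by (simp add: power_divide del: power_Suc)
  qed
  have co: "coeff k = \<gamma> * g * n / (4 * pi\<^sup>2)" by (simp add: coeff_def g_def n_def)
  have "4 * pi\<^sup>2 * (coeff k)\<^sup>2 * of_nat (2 * k + 2 choose (k + 1)) *
    (4 * pi\<^sup>2 * of_nat (3 * k + 3 choose (k + 1)) / fact (3 * k + 3)) *
    (Gamma (exponent_X k) / \<gamma> * 2 powr - exponent_X k) *
    (Gamma (exponent_Y k) / \<gamma> * (2 * (\<gamma> - 1)) powr - exponent_Y k) * fact (k + 1) =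
    16 * pi ^ 4 * (coeff k)\<^sup>2 * (fact (2 * k + 2) / ((n * w) * (n * w))) *
    (fact (3 * k + 3) / ((n * w) * fact (2 * k + 2)) / fact (3 * k + 3)) * (A * B / \<gamma>\<^sup>2) *
    (2 powr - exponent_X k * (2 * (\<gamma> - 1)) powr - exponent_Y k) * (n * w)"
    unfolding b1 b2 f1 A_def[symmetric] B_def[symmetric] n_def[symmetric] w_def[symmetric]
    by (simp add: power2_eq_square power4_eq_xxxx mult_ac del: fact_Suc)
  also have "\<dots> = A * B / w\<^sup>2 * (g\<^sup>2 / 2 ^ (2 * k + 2)) * P"
    unfolding two co P_def[symmetric] using nz
    by (simp add: field_simps power2_eq_square power4_eq_xxxx del: power_Suc fact_Suc)
  finally show ?thesis unfolding lc ..
qed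

lemma norm_radial_kernel_le':
  assumes "\<alpha> > 0" "\<beta> > 0"
  shows "cmod (radial_kernel k \<alpha> \<beta> t) \<le> coeff k * \<alpha> powr real k * \<beta> powr expo k / denominator \<alpha> \<beta> ^ (k + 2)"
proof -
  have d: "denominator \<alpha> \<beta> > 0" by (rule denominator_pos[OF assms])
  have "cmod (radial_kernel k \<alpha> \<beta> t) =
      (coeff k * \<alpha> powr real k * \<beta> powr expo k) / cmod (Complex (denominator \<alpha> \<beta>) t) ^ (k + 2)"
    unfolding radial_kernel_def norm_divide norm_power norm_of_real using coeff_pos[of k] by (simp add: abs_mult)
  also have "\<dots> \<le> coeff k * \<alpha> powr real k * \<beta> powr expo k / denominator \<alpha> \<beta> ^ (k + 2)"
    using coeff_pos[of k] d norm_Complex_ge[OF d, of t]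
    by (intro divide_left_mono power_mono mult_pos_pos zero_less_power) auto
  finally show ?thesis .
qed

lemma adjoint_compose_integrable:
  assumes z: "radius z > 0" and w: "radius w > 0"
  shows "integrable \<mu> (\<lambda>\<zeta>. adjoint_kernel (mode_kernel k) z \<zeta> * mode_kernel k \<zeta> w)"
proof (rule integrableI_bounded)
  show meas: "(\<lambda>\<zeta>. adjoint_kernel (mode_kernel k) z \<zeta> * mode_kernel k \<zeta> w) \<in> borel_measurable \<mu>"
    unfolding adjoint_kernel_def mode_kernel_def radial_kernel_def denominator_def by measurable
  define a b where "a = radius z" and "b = radius w"
  have ab: "a > 0" "b > 0" using z w by (simp_all add: a_def b_def)
  define c where "c = min ((\<gamma> - 1) * a powr \<gamma>) ((\<gamma> - 1) * b powr \<gamma>)"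
  have c: "c > 0" using \<gamma> ab by (simp add: c_def)
  define K where "K = (coeff k)\<^sup>2 * a powr expo k * b powr expo k"
  have p: "r + 2 * real k + 1 > 0" "(r + 2 * real k + 1) / \<gamma> < real (Suc (2 * k + 2))"
  proof -
    show "r + 2 * real k + 1 > 0" using r by simp
    have "2 * real k \<le> \<gamma> * (2 * real k)" using \<gamma> mult_right_mono[of 1 \<gamma> "2 * real k"] by simp
    then have "r + 2 * real k + 1 < \<gamma> * (2 * real k + 3)" using r \<gamma> by (simp add: algebra_simps)
    then show "(r + 2 * real k + 1) / \<gamma> < real (Suc (2 * k + 2))" using \<gamma> by (simp add: field_simps)
  qed
  have "(\<integral>\<^sup>+\<zeta>. ennreal (norm (adjoint_kernel (mode_kernel k) z \<zeta> * mode_kernel k \<zeta> w)) \<partial>\<mu>) \<le>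
      ennreal (2 * pi\<^sup>2 * K * (Gamma ((r + 2 * real k + 1) / \<gamma>) * Gamma (real (Suc (2 * k + 2)) - (r + 2 * real k + 1) / \<gamma>) /
        (\<gamma> * fact (2 * k + 2)) * 1 powr - ((r + 2 * real k + 1) / \<gamma>) * c powr ((r + 2 * real k + 1) / \<gamma> - real (Suc (2 * k + 2)))))"
  proof (rule nn_integral_mu_power_le[where s = "height z" and m = "2 * real k"])
    show "(\<lambda>\<zeta>. ennreal (norm (adjoint_kernel (mode_kernel k) z \<zeta> * mode_kernel k \<zeta> w))) \<in> borel_measurable \<mu>"
      using meas by measurable
    fix t \<beta> \<phi> :: real assume \<beta>: "\<beta> > 0"
    define e where "e = 1 * \<beta> powr \<gamma> + c"
    have e: "e > 0" using c by (simp add: e_def add_nonneg_pos)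
    have de: "e \<le> denominator \<beta> a" "e \<le> denominator \<beta> b"
      by (simp_all add: e_def denominator_def c_def)
    have n: "coeff k * \<beta> powr real k * x powr expo k \<ge> 0" for x using coeff_pos[of k] by simp
    have "norm (adjoint_kernel (mode_kernel k) z (param \<gamma> (t, \<beta>, \<phi>)) * mode_kernel k (param \<gamma> (t, \<beta>, \<phi>)) w) =
        cmod (radial_kernel k \<beta> a (height z - t)) * cmod (radial_kernel k \<beta> b (height w - t))"
      using \<beta> z w by (simp add: adjoint_kernel_def mode_kernel_param_left norm_mult norm_power norm_phase a_def b_def)
    also have "\<dots> \<le> (coeff k * \<beta> powr real k * a powr expo k / e ^ k * (1 / (e\<^sup>2 + (height z - t)\<^sup>2))) *
        (coeff k * \<beta> powr real k * b powr expo k / e ^ (k + 2))"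
    proof (rule mult_mono)
      have "e\<^sup>2 \<le> (denominator \<beta> a)\<^sup>2" using e de by (intro power_mono) auto
      then have "1 / ((denominator \<beta> a)\<^sup>2 + (height z - t)\<^sup>2) \<le> 1 / (e\<^sup>2 + (height z - t)\<^sup>2)"
        using e by (intro divide_left_mono mult_pos_pos) (auto intro: add_pos_nonneg order_less_le_trans[OF zero_less_power[OF e]])
      moreover have "coeff k * \<beta> powr real k * a powr expo k / denominator \<beta> a ^ k \<le> coeff k * \<beta> powr real k * a powr expo k / e ^ k"
        using e de n by (intro divide_left_mono power_mono mult_pos_pos zero_less_power) auto
      ultimately show "cmod (radial_kernel k \<beta> a (height z - t)) \<le>
          coeff k * \<beta> powr real k * a powr expo k / e ^ k * (1 / (e\<^sup>2 + (height z - t)\<^sup>2))"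
        using e n[of a] by (intro order_trans[OF norm_radial_kernel_le[OF \<beta> ab(1)] mult_mono]) auto
      show "cmod (radial_kernel k \<beta> b (height w - t)) \<le> coeff k * \<beta> powr real k * b powr expo k / e ^ (k + 2)"
        using e de n by (intro order_trans[OF norm_radial_kernel_le'[OF \<beta> ab(2)] divide_left_mono] power_mono mult_pos_pos zero_less_power) auto
    qed (use e n[of a] in auto)
    also have "\<dots> = K * \<beta> powr (2 * real k) / e ^ (2 * k + 2) * (1 / (e\<^sup>2 + (t - height z)\<^sup>2))"
    proof -
      have "\<beta> powr (2 * real k) = \<beta> powr real k * \<beta> powr real k" by (simp flip: powr_add)
      moreover have "e ^ (2 * k + 2) = e ^ k * e ^ (k + 2)" by (simp flip: power_add add: mult_2)
      ultimately show ?thesis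
        unfolding K_def power2_commute[of "height z"] by (simp add: power2_eq_square mult_ac del: power_Suc)
    qed
    finally show "ennreal (norm (adjoint_kernel (mode_kernel k) z (param \<gamma> (t, \<beta>, \<phi>)) * mode_kernel k (param \<gamma> (t, \<beta>, \<phi>)) w))
        \<le> ennreal (K * \<beta> powr (2 * real k) / (1 * \<beta> powr \<gamma> + c) ^ (2 * k + 2) * (1 / ((1 * \<beta> powr \<gamma> + c)\<^sup>2 + (t - height z)\<^sup>2)))"
      unfolding e_def by (rule ennreal_leI)
  qed (use \<gamma> c p in \<open>auto simp: K_def\<close>)
  then show "(\<integral>\<^sup>+\<zeta>. ennreal (norm (adjoint_kernel (mode_kernel k) z \<zeta> * mode_kernel k \<zeta> w)) \<partial>\<mu>) < \<infinity>"
    by (rule le_less_trans) simp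
qed

lemma compose_adjoint_mode_kernel:
  assumes z: "radius z > 0" and w: "radius w > 0"
  shows "compose_kernel \<mu> (adjoint_kernel (mode_kernel k)) (mode_kernel k) z w =
    phase z ^ k * cnj (phase w) ^ k *
    of_real (4 * pi\<^sup>2 * (coeff k)\<^sup>2 * of_nat (2 * k + 2 choose (k + 1)) * radius z powr expo k * radius w powr expo k) *
    (LINT x:{0<..}|lborel. of_real (x powr ((r + 2 * real k + 1) - 1)) /
      Complex ((\<gamma> - 1) * (radius z powr \<gamma> + radius w powr \<gamma>) + 2 * x powr \<gamma>) (height w - height z) ^ Suc (2 * k + 2))"
    (is "?L = ?P * of_real ?c * _")
proof -
  define a b where "a = radius z" and "b = radius w"
  have ab: "a > 0" "b > 0" using z w by (simp_all add: a_def b_def)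
  let ?g = "\<lambda>s \<alpha>. ?P * (cnj (radial_kernel k \<alpha> a (height z - s)) * radial_kernel k \<alpha> b (height w - s))"
  have "?L = (LINT \<alpha>:{0<..}|lborel. of_real (2 * pi * \<alpha> powr r) * (LINT s|lborel. ?g s \<alpha>))"
    unfolding compose_kernel_def
  proof (rule integral_mu_phase_free[OF adjoint_compose_integrable[OF z w]])
    fix s \<alpha> \<theta> :: real assume \<alpha>: "\<alpha> > 0"
    have "cis (- (real k * \<theta>)) * cis (real k * \<theta>) = 1" by (simp add: cis_mult)
    then show "adjoint_kernel (mode_kernel k) z (param \<gamma> (s, \<alpha>, \<theta>)) * mode_kernel k (param \<gamma> (s, \<alpha>, \<theta>)) w = ?g s \<alpha>"
      using \<alpha> by (simp add: adjoint_kernel_def mode_kernel_param_left cis_cnj a_def b_def algebra_simps)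
  qed
  also have "\<dots> = (LINT \<alpha>:{0<..}|lborel. (?P * of_real ?c) * (of_real (\<alpha> powr ((r + 2 * real k + 1) - 1)) /
      Complex ((\<gamma> - 1) * (a powr \<gamma> + b powr \<gamma>) + 2 * \<alpha> powr \<gamma>) (height w - height z) ^ Suc (2 * k + 2)))"
  proof (intro set_lebesgue_integral_cong allI impI)
    fix \<alpha> :: real assume "\<alpha> \<in> {0<..}"
    then have \<alpha>: "\<alpha> > 0" by simp
    define A B where "A = denominator \<alpha> a" and "B = denominator \<alpha> b"
    have AB: "A > 0" "B > 0" using \<alpha> ab by (auto simp: A_def B_def intro: denominator_pos)
    let ?q = "?P * of_real ((coeff k * \<alpha> powr real k * a powr expo k) * (coeff k * \<alpha> powr real k * b powr expo k))"
    have "?g s \<alpha> = ?q * (1 / (Complex A (s - height z) ^ (k + 1 + 1) * Complex B (height w - s) ^ (k + 1 + 1)))" for s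
    proof -
      have "cnj (Complex A (height z - s)) = Complex A (s - height z)" by (simp add: complex_eq_iff)
      then show ?thesis unfolding radial_kernel_def A_def[symmetric] B_def[symmetric] by simp
    qed
    then have "(LINT s|lborel. ?g s \<alpha>) = ?q * (LINT s|lborel. 1 / (Complex A (s - height z) ^ (k + 1 + 1) * Complex B (height w - s) ^ (k + 1 + 1)))"
      by (simp only: integral_mult_right_zero)
    also have "\<dots> = ?q * (2 * pi * of_nat (k + 1 + (k + 1) choose (k + 1)) / Complex (A + B) (height w - height z) ^ (k + 1 + (k + 1) + 1))"
      unfolding convolution_integral[OF AB] ..
    also have "A + B = (\<gamma> - 1) * (a powr \<gamma> + b powr \<gamma>) + 2 * \<alpha> powr \<gamma>"
      by (simp add: A_def B_def denominator_def algebra_simps)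
    also have "k + 1 + (k + 1) = 2 * k + 2" by simp
    finally have I: "(LINT s|lborel. ?g s \<alpha>) = ?q * (2 * pi * of_nat (2 * k + 2 choose (k + 1)) /
        Complex ((\<gamma> - 1) * (a powr \<gamma> + b powr \<gamma>) + 2 * \<alpha> powr \<gamma>) (height w - height z) ^ (2 * k + 2 + 1))" .
    have pw: "\<alpha> powr ((r + 2 * real k + 1) - 1) = \<alpha> powr r * \<alpha> powr real k * \<alpha> powr real k"
      by (simp add: powr_add[symmetric] add_ac)
    show "of_real (2 * pi * \<alpha> powr r) * (LINT s|lborel. ?g s \<alpha>) = (?P * of_real ?c) * (of_real (\<alpha> powr ((r + 2 * real k + 1) - 1)) /
      Complex ((\<gamma> - 1) * (a powr \<gamma> + b powr \<gamma>) + 2 * \<alpha> powr \<gamma>) (height w - height z) ^ Suc (2 * k + 2))"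
      unfolding I pw a_def[symmetric] b_def[symmetric] Suc_eq_plus1
      by (simp add: power2_eq_square mult_ac del: power_Suc power_Suc2 binomial_Suc_Suc)
  qed simp
  also have "\<dots> = ?P * of_real ?c * (LINT \<alpha>:{0<..}|lborel. of_real (\<alpha> powr ((r + 2 * real k + 1) - 1)) /
      Complex ((\<gamma> - 1) * (a powr \<gamma> + b powr \<gamma>) + 2 * \<alpha> powr \<gamma>) (height w - height z) ^ Suc (2 * k + 2))"
    by (rule set_integral_mult_right)
  finally show ?thesis unfolding a_def b_def .
qed

text \<open>
  The integrals in \<open>s\<close> are convolutions of powers; after them only the radial integrals
  of a power of \<open>2 (\<gamma> - 1) \<beta> powr \<gamma> + 2 x powr \<gamma> + A\<close> are left, where \<open>A\<close> is the denominator of the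
  kernel at \<open>(z, w)\<close>. The Laplace transform separates the variables, and the exponents add up to
  reproduce the power of \<open>A\<close> in the kernel.
\<close>

lemma compose_three_mode_kernels:
  assumes z: "radius z > 0" and w: "radius w > 0"
    and int: "integrable \<mu> (\<lambda>\<zeta>. mode_kernel k z \<zeta> * compose_kernel \<mu> (adjoint_kernel (mode_kernel k)) (mode_kernel k) \<zeta> w)"
  shows "compose_kernel \<mu> (mode_kernel k) (compose_kernel \<mu> (adjoint_kernel (mode_kernel k)) (mode_kernel k)) z w =
    of_real (leray_const r \<gamma> k) * mode_kernel k z w"
    (is "?L = _")
proof -
  define a b where "a = radius z" and "b = radius w"
  have ab: "a > 0" "b > 0" using z w by (simp_all add: a_def b_def)
  define A where "A = Complex (denominator a b) (height w - height z)"
  have ReA: "Re A > 0" using denominator_pos[OF ab] by (simp add: A_def)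
  define P where "P = phase z ^ k * cnj (phase w) ^ k"
  define c where "c = 4 * pi\<^sup>2 * (coeff k)\<^sup>2 * of_nat (2 * k + 2 choose (k + 1))"
  define N where "N = real (3 * k + 3) + 1"
  define d where "d = 2 * pi * of_nat (3 * k + 3 choose (k + 1)) / fact (3 * k + 3)"
  let ?I = "\<lambda>\<beta> t. LINT x:{0<..}|lborel. of_real (x powr ((r + 2 * real k + 1) - 1)) /
      Complex ((\<gamma> - 1) * (\<beta> powr \<gamma> + b powr \<gamma>) + 2 * x powr \<gamma>) (height w - t) ^ Suc (2 * k + 2)"
  let ?g = "\<lambda>t \<beta>. P * (radial_kernel k a \<beta> (t - height z) * (of_real (c * \<beta> powr expo k * b powr expo k) * ?I \<beta> t))"
  have X: "r + 2 * real k + 1 > 0" "(r + 2 * real k + 1) / \<gamma> = exponent_X k"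
    using r by (simp_all add: exponent_X_def algebra_simps)
  have XY: "exponent_X k + exponent_Y k = 2 * real k + 2" by (simp add: exponent_Y_def)
  have "?L = (LINT \<beta>:{0<..}|lborel. of_real (2 * pi * \<beta> powr r) * (LINT t|lborel. ?g t \<beta>))"
    unfolding compose_kernel_def[of _ "mode_kernel k"]
  proof (rule integral_mu_phase_free[OF int[unfolded compose_kernel_def[of _ "mode_kernel k"]]])
    fix t \<beta> \<phi> :: real assume \<beta>: "\<beta> > 0"
    have "cis (- (real k * \<phi>)) * (cis (real k * \<phi>) * x) = x" for x
      by (simp add: mult.assoc[symmetric] cis_mult)
    moreover have "compose_kernel \<mu> (adjoint_kernel (mode_kernel k)) (mode_kernel k) (param \<gamma> (t, \<beta>, \<phi>)) w =
        cis (real k * \<phi>) * (cnj (phase w) ^ k * (of_real (c * \<beta> powr expo k * b powr expo k) * ?I \<beta> t))"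
      using \<beta> w by (subst compose_adjoint_mode_kernel) (simp_all add: c_def b_def Complex.DeMoivre mult.assoc)
    ultimately show "mode_kernel k z (param \<gamma> (t, \<beta>, \<phi>)) * compose_kernel \<mu> (adjoint_kernel (mode_kernel k)) (mode_kernel k) (param \<gamma> (t, \<beta>, \<phi>)) w = ?g t \<beta>"
      using \<beta> by (simp only: mode_kernel_param_right P_def a_def) (simp add: mult_ac)
  qed
  also have "\<dots> = (LINT \<beta>:{0<..}|lborel. (P * of_real (2 * pi * coeff k * c * d * a powr real k * b powr expo k * (Gamma (exponent_X k) / \<gamma> * 2 powr - exponent_X k))) *
      (of_real (\<beta> powr ((r + 2 * expo k + 1) - 1)) * laplace_powr (N - exponent_X k) (of_real (2 * (\<gamma> - 1) * \<beta> powr \<gamma>) + A)))"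
  proof (intro set_lebesgue_integral_cong allI impI)
    fix \<beta> :: real assume "\<beta> \<in> {0<..}"
    then have \<beta>: "\<beta> > 0" by simp
    define D where "D = denominator a \<beta>"
    have D: "D > 0" unfolding D_def using ab \<beta> by (intro denominator_pos)
    define e where "e = (\<gamma> - 1) * (\<beta> powr \<gamma> + b powr \<gamma>)"
    have e: "e > 0" using \<gamma> ab \<beta> by (simp add: e_def add_pos_pos)
    define Z where "Z = of_real (2 * (\<gamma> - 1) * \<beta> powr \<gamma>) + A"
    have ReZ: "Re Z > 0" using ReA \<gamma> by (simp add: Z_def add_nonneg_pos)
    have conv: "(LINT t|lborel. 1 / (Complex D (t - height z) ^ (k + 2) * Complex (e + 2 * x powr \<gamma>) (height w - t) ^ Suc (2 * k + 2))) =
        of_real d * laplace_powr N (of_real (2 * x powr \<gamma>) + Z)" if x: "x > 0" for x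
    proof -
      have e2: "e + 2 * x powr \<gamma> > 0" using e by (simp add: add_pos_nonneg)
      have "(LINT t|lborel. 1 / (Complex D (t - height z) ^ (k + 1 + 1) * Complex (e + 2 * x powr \<gamma>) (height w - t) ^ (2 * k + 2 + 1))) =
          2 * pi * of_nat (k + 1 + (2 * k + 2) choose (k + 1)) / Complex (D + (e + 2 * x powr \<gamma>)) (height w - height z) ^ (k + 1 + (2 * k + 2) + 1)"
        by (rule convolution_integral[OF D e2])
      also have "Complex (D + (e + 2 * x powr \<gamma>)) (height w - height z) = of_real (2 * x powr \<gamma>) + Z"
        by (simp add: complex_eq_iff Z_def A_def D_def e_def denominator_def algebra_simps)
      also have "k + 1 + (2 * k + 2) = 3 * k + 3" by simp
      also have "2 * pi * of_nat (3 * k + 3 choose (k + 1)) / (of_real (2 * x powr \<gamma>) + Z) ^ (3 * k + 3 + 1) =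
          of_real d * laplace_powr N (of_real (2 * x powr \<gamma>) + Z)"
      proof -
        have "Re (of_real (2 * x powr \<gamma>) + Z) > 0" using ReZ by (simp add: add_nonneg_pos)
        from laplace_powr_nat[OF this, of "3 * k + 3"] show ?thesis unfolding N_def d_def by simp
      qed
      finally show ?thesis by simp
    qed
    have "(LINT t|lborel. 1 / Complex D (t - height z) ^ (k + 2) * ?I \<beta> t) =
      (LINT x:{0<..}|lborel. of_real (x powr ((r + 2 * real k + 1) - 1)) *
        (LINT t|lborel. 1 / (Complex D (t - height z) ^ (k + 2) * Complex (e + 2 * x powr \<gamma>) (height w - t) ^ Suc (2 * k + 2))))"
      unfolding e_def[symmetric]
    proof (rule integral_power_product_swap[OF D e])
      show "(r + 2 * real k + 1) / \<gamma> < real (Suc (2 * k + 2))" unfolding X using XY exponent_Y_pos[of k] by simp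
    qed (use \<gamma> X in auto)
    also have "\<dots> = (LINT x:{0<..}|lborel. of_real d * (of_real (x powr ((r + 2 * real k + 1) - 1)) * laplace_powr N (of_real (2 * x powr \<gamma>) + Z)))"
      by (intro set_lebesgue_integral_cong allI impI) (simp_all only: conv greaterThan_iff mult.left_commute, simp)
    also have "\<dots> = of_real d * (LINT x:{0<..}|lborel. of_real (x powr ((r + 2 * real k + 1) - 1)) * laplace_powr N (of_real (2 * x powr \<gamma>) + Z))"
      by (rule set_integral_mult_right)
    also have "(LINT x:{0<..}|lborel. of_real (x powr ((r + 2 * real k + 1) - 1)) * laplace_powr N (of_real (2 * x powr \<gamma>) + Z)) =
        of_real (Gamma (exponent_X k) / \<gamma> * 2 powr - exponent_X k) * laplace_powr (N - exponent_X k) Z"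
      unfolding X(2)[symmetric]
    proof (rule laplace_powr_integral)
      show "(r + 2 * real k + 1) / \<gamma> < N" unfolding X N_def using XY exponent_Y_pos[of k] by simp
    qed (use X \<gamma> ReZ in auto)
    finally have J: "(LINT t|lborel. 1 / Complex D (t - height z) ^ (k + 2) * ?I \<beta> t) =
        of_real d * (of_real (Gamma (exponent_X k) / \<gamma> * 2 powr - exponent_X k) * laplace_powr (N - exponent_X k) Z)" .
    let ?q = "P * of_real ((coeff k * a powr real k * \<beta> powr expo k) * (c * \<beta> powr expo k * b powr expo k))"
    have "?g t \<beta> = ?q * (1 / Complex D (t - height z) ^ (k + 2) * ?I \<beta> t)" for t
      unfolding radial_kernel_def D_def[symmetric] by simp
    then have I: "(LINT t|lborel. ?g t \<beta>) = ?q * (of_real d * (of_real (Gamma (exponent_X k) / \<gamma> * 2 powr - exponent_X k) * laplace_powr (N - exponent_X k) Z))"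
      by (simp only: integral_mult_right_zero J)
    have pw: "\<beta> powr ((r + 2 * expo k + 1) - 1) = \<beta> powr r * \<beta> powr expo k * \<beta> powr expo k"
      by (simp add: powr_add[symmetric] add_ac)
    show "of_real (2 * pi * \<beta> powr r) * (LINT t|lborel. ?g t \<beta>) = (P * of_real (2 * pi * coeff k * c * d * a powr real k * b powr expo k * (Gamma (exponent_X k) / \<gamma> * 2 powr - exponent_X k))) *
      (of_real (\<beta> powr ((r + 2 * expo k + 1) - 1)) * laplace_powr (N - exponent_X k) (of_real (2 * (\<gamma> - 1) * \<beta> powr \<gamma>) + A))"
      unfolding I pw Z_def[symmetric] by (simp only: of_real_mult mult_ac)
  qed simp
  also have "\<dots> = (P * of_real (2 * pi * coeff k * c * d * a powr real k * b powr expo k * (Gamma (exponent_X k) / \<gamma> * 2 powr - exponent_X k))) *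
      (LINT \<beta>:{0<..}|lborel. of_real (\<beta> powr ((r + 2 * expo k + 1) - 1)) * laplace_powr (N - exponent_X k) (of_real (2 * (\<gamma> - 1) * \<beta> powr \<gamma>) + A))"
    by (rule set_integral_mult_right)
  also have "(LINT \<beta>:{0<..}|lborel. of_real (\<beta> powr ((r + 2 * expo k + 1) - 1)) * laplace_powr (N - exponent_X k) (of_real (2 * (\<gamma> - 1) * \<beta> powr \<gamma>) + A)) =
      of_real (Gamma (exponent_Y k) / \<gamma> * (2 * (\<gamma> - 1)) powr - exponent_Y k) * laplace_powr (N - exponent_X k - exponent_Y k) A"
    unfolding exponent_Y_eq
  proof (rule laplace_powr_integral)
    show "(r + 2 * expo k + 1) / \<gamma> < N - exponent_X k"
      unfolding exponent_Y_eq[symmetric] N_def using XY by simp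
    have "(r + 2 * expo k + 1) / \<gamma> > 0" using exponent_Y_pos[of k] by (simp add: exponent_Y_eq)
    then show "r + 2 * expo k + 1 > 0" using \<gamma> by (simp add: zero_less_divide_iff)
  qed (use \<gamma> ReA in auto)
  also have "N - exponent_X k - exponent_Y k = real (k + 1) + 1" using XY by (simp add: N_def)
  also have "laplace_powr (real (k + 1) + 1) A = fact (k + 1) / A ^ (k + 2)"
    using laplace_powr_nat[OF ReA, of "k + 1"] by simp
  also have "(P * of_real (2 * pi * coeff k * c * d * a powr real k * b powr expo k * (Gamma (exponent_X k) / \<gamma> * 2 powr - exponent_X k))) *
      (of_real (Gamma (exponent_Y k) / \<gamma> * (2 * (\<gamma> - 1)) powr - exponent_Y k) * (fact (k + 1) / A ^ (k + 2))) =
      of_real (2 * pi * c * d * (Gamma (exponent_X k) / \<gamma> * 2 powr - exponent_X k) * (Gamma (exponent_Y k) / \<gamma> * (2 * (\<gamma> - 1)) powr - exponent_Y k) * fact (k + 1)) *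
      (P * (of_real (coeff k * a powr real k * b powr expo k) / A ^ (k + 2)))"
    by (simp add: mult_ac del: fact_Suc power_Suc)
  also have "2 * pi * c * d * (Gamma (exponent_X k) / \<gamma> * 2 powr - exponent_X k) * (Gamma (exponent_Y k) / \<gamma> * (2 * (\<gamma> - 1)) powr - exponent_Y k) * fact (k + 1) = leray_const r \<gamma> k"
    unfolding leray_const_eq c_def d_def by (simp add: power2_eq_square mult_ac del: fact_Suc)
  also have "P * (of_real (coeff k * a powr real k * b powr expo k) / A ^ (k + 2)) = mode_kernel k z w"
    unfolding mode_kernel_def radial_kernel_def P_def A_def a_def b_def ..
  finally show ?thesis .
qed

end

section \<open>Boundedness of the eigenvalues\<close>

text \<open>
  Stirling's formula is needed only up to bounded factors, as an upper bound for all arguments and a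
  lower bound for integers. Both follow from the change of the remainder under \<open>x \<mapsto> x + 1\<close>, which is
  nonpositive and at least \<open>1 / (4 * (x + 1)) - 1 / (4 * x)\<close>, a telescoping quantity.
\<close>

definition stirling_remainder :: "real \<Rightarrow> real" where
  "stirling_remainder x = ln_Gamma x - (x - 1/2) * ln x + x"

lemma stirling_remainder_step:
  assumes x: "x > 0"
  shows "stirling_remainder x - stirling_remainder (x + 1) = (x + 1/2) * (ln (x + 1) - ln x) - 1"
proof -
  have "ln_Gamma (x + 1) = ln x + ln_Gamma x"
  proof -
    have G: "Gamma x > 0" using x by (rule Gamma_real_pos)
    have "Gamma (x + 1) = x * Gamma x" using x by (intro Gamma_plus1) (auto elim!: nonpos_Ints_cases)
    moreover have "ln (x * Gamma x) = ln x + ln (Gamma x)" using x G by (rule ln_mult_pos)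
    ultimately show ?thesis using x by (simp add: ln_Gamma_real_pos)
  qed
  then show ?thesis by (simp add: stirling_remainder_def algebra_simps)
qed

lemma stirling_remainder_step_bounds:
  assumes x: "x > 0"
  shows "stirling_remainder (x + 1) \<le> stirling_remainder x"
    and "stirling_remainder x - 1 / (4 * x) \<le> stirling_remainder (x + 1) - 1 / (4 * (x + 1))"
proof -
  have "2 / (2 * x + 1) \<le> ln (x + 1) - ln x"
    using ln_inverse_approx_ge[of x "x + 1"] x by (simp add: algebra_simps)
  then have le: "(x + 1/2) * (2 / (2 * x + 1)) \<le> (x + 1/2) * (ln (x + 1) - ln x)"
    using x by (intro mult_left_mono) auto
  have one: "(x + 1/2) * (2 / (2 * x + 1)) = 1" using x by (simp add: field_simps)
  show "stirling_remainder (x + 1) \<le> stirling_remainder x"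
    using stirling_remainder_step[OF x] le unfolding one by linarith
  have "ln (x + 1) - ln x \<le> (inverse x + inverse (x + 1)) / 2"
    using ln_inverse_approx_le[of x 1] x by simp
  then have "(x + 1/2) * (ln (x + 1) - ln x) \<le> (x + 1/2) * ((inverse x + inverse (x + 1)) / 2)"
    using x by (intro mult_left_mono) auto
  moreover have "(x + 1/2) * ((inverse x + inverse (x + 1)) / 2) - 1 = 1 / (4 * x) - 1 / (4 * (x + 1))"
    using x by (simp add: divide_simps) (simp add: algebra_simps)
  ultimately show "stirling_remainder x - 1 / (4 * x) \<le> stirling_remainder (x + 1) - 1 / (4 * (x + 1))"
    using stirling_remainder_step[OF x] by simp
qed

lemma stirling_remainder_bounded_above:
  assumes e: "e > 0"
  shows "\<exists>K. \<forall>x\<ge>e. stirling_remainder x \<le> K"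
proof -
  have "continuous_on {e..e + 1} stirling_remainder"
  proof (intro continuous_at_imp_continuous_on ballI)
    fix x assume "x \<in> {e..e + 1}"
    then have x: "x > 0" using e by simp
    have "isCont ln_Gamma x" by (rule DERIV_isCont[OF has_field_derivative_ln_Gamma_real[OF x]])
    then show "isCont stirling_remainder x"
      unfolding stirling_remainder_def[abs_def] using x by (intro continuous_intros) auto
  qed
  then have "compact (stirling_remainder ` {e..e + 1})" by (intro compact_continuous_image) auto
  then have "bdd_above (stirling_remainder ` {e..e + 1})" by (intro bounded_imp_bdd_above compact_imp_bounded)
  then obtain K where K: "\<And>x. x \<in> {e..e + 1} \<Longrightarrow> stirling_remainder x \<le> K"
    unfolding bdd_above_def by blast
  have shift: "stirling_remainder (x + real n) \<le> stirling_remainder x" if "x > 0" for x n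
  proof (induction n)
    case (Suc n)
    have "stirling_remainder (x + real n + 1) \<le> stirling_remainder (x + real n)"
      using that by (intro stirling_remainder_step_bounds) auto
    then show ?case using Suc by (simp add: add_ac)
  qed simp
  have "stirling_remainder x \<le> K" if x: "x \<ge> e" for x
  proof -
    define n where "n = nat \<lfloor>x - e\<rfloor>"
    have n: "real n \<le> x - e" "x - e < real n + 1" using x unfolding n_def by linarith+
    have "stirling_remainder (x - real n + real n) \<le> stirling_remainder (x - real n)"
      using n e by (intro shift) auto
    also have "\<dots> \<le> K" using n by (intro K) auto
    finally show ?thesis by simp
  qed
  then show ?thesis by blast
qed

lemma stirling_remainder_nat_ge: "3 / 4 \<le> stirling_remainder (real n + 1)"
proof -
  have "3 / 4 \<le> stirling_remainder (real n + 1) - 1 / (4 * (real n + 1))"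
  proof (induction n)
    case 0
    show ?case by (simp add: stirling_remainder_def ln_Gamma_real_pos)
  next
    case (Suc n)
    have "stirling_remainder (real n + 1) - 1 / (4 * (real n + 1)) \<le>
        stirling_remainder (real n + 1 + 1) - 1 / (4 * (real n + 1 + 1))"
      by (rule stirling_remainder_step_bounds) simp
    then show ?case using Suc by (simp add: add_ac)
  qed
  moreover have "0 \<le> 1 / (4 * (real n + 1))" by simp
  ultimately show ?thesis by linarith
qed

lemma ln_tangent:
  assumes "x > 0" "p > (0::real)"
  shows "x * ln x \<le> x * ln p + x * (x / p - 1)"
proof -
  have "ln (x / p) \<le> x / p - 1" using assms by (intro ln_le_minus_one) auto
  then have "x * ln (x / p) \<le> x * (x / p - 1)" using assms by (intro mult_left_mono) auto
  then show ?thesis using assms by (simp add: ln_div algebra_simps)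
qed

context leray_setting
begin

text \<open>
  By Stirling's formula the exponential factors of \<open>leray_const r \<gamma> k\<close> cancel: the Gamma arguments
  \<open>X\<close> and \<open>Y\<close> differ by a constant from \<open>p = 2 n / \<gamma>\<close> and \<open>q = 2 n (\<gamma> - 1) / \<gamma>\<close>, where \<open>n = k + 1\<close>,
  and for \<open>p\<close> and \<open>q\<close> in place of \<open>X\<close> and \<open>Y\<close> the logarithms add up to zero. What remains is
  \<open>n / sqrt (X * Y)\<close> up to bounded factors.
\<close>

lemma leray_const_bounded: "\<exists>K. \<forall>k. leray_const r \<gamma> k \<le> K"
proof -
  define c where "c = (r - 1) / \<gamma>"
  define e where "e = min (min (2 / \<gamma>) (2 / \<gamma> + c)) (min (2 * (\<gamma> - 1) / \<gamma>) (2 * (\<gamma> - 1) / \<gamma> - c))"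
  have X0: "2 / \<gamma> + c = exponent_X 0" using \<gamma> by (simp add: c_def exponent_X_def field_simps)
  have Y0: "2 * (\<gamma> - 1) / \<gamma> - c = exponent_Y 0"
    using \<gamma> by (simp add: c_def exponent_X_def exponent_Y_def field_simps)
  have e: "e > 0" unfolding e_def X0 Y0 using exponent_X_pos[of 0] exponent_Y_pos[of 0] \<gamma> by simp
  obtain K where K: "\<And>x. x \<ge> e \<Longrightarrow> stirling_remainder x \<le> K"
    using stirling_remainder_bounded_above[OF e] by blast
  define B where "B = 2 * K - 3 / 2 + c\<^sup>2 * (\<gamma> / 2) + c\<^sup>2 * (\<gamma> / (2 * (\<gamma> - 1))) - ln e"
  have "leray_const r \<gamma> k \<le> exp B" for k
  proof -
    define n where "n = real k + 1"
    define X Y where "X = exponent_X k" and "Y = exponent_Y k"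
    define p q where "p = 2 * n / \<gamma>" and "q = 2 * n * (\<gamma> - 1) / \<gamma>"
    have n: "n \<ge> 1" by (simp add: n_def)
    have XY: "X > 0" "Y > 0" "X + Y = 2 * n"
      by (simp_all add: X_def Y_def exponent_X_pos exponent_Y_pos) (simp add: exponent_Y_def n_def)
    have pq: "p > 0" "q > 0" using n \<gamma> by (simp_all add: p_def q_def)
    have Xp: "X = p + c" using \<gamma> by (simp add: X_def p_def c_def exponent_X_def n_def field_simps)
    have pq2: "p + q = 2 * n" using \<gamma> by (simp add: p_def q_def field_simps)
    have Yq: "Y = q - c" using XY(3) Xp pq2 by linarith
    have lin: "min s (s + d) * n \<le> s * n + d" for s d :: real
    proof (cases "d \<ge> 0")
      case True
      then show ?thesis using n by (simp add: min_def)
    next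
      case False
      then have "d * n \<le> d" using n mult_left_mono_neg[of 1 n d] by simp
      then show ?thesis using False by (simp add: min_def algebra_simps)
    qed
    have eX: "e * n \<le> X"
    proof -
      have "e * n \<le> min (2 / \<gamma>) (2 / \<gamma> + c) * n" using n by (intro mult_right_mono) (auto simp: e_def)
      also have "\<dots> \<le> 2 / \<gamma> * n + c" by (rule lin)
      also have "\<dots> = X" by (simp add: Xp p_def)
      finally show ?thesis .
    qed
    have eY: "e * n \<le> Y"
    proof -
      have "e * n \<le> min (2 * (\<gamma> - 1) / \<gamma>) (2 * (\<gamma> - 1) / \<gamma> + - c) * n"
        using n by (intro mult_right_mono) (auto simp: e_def)
      also have "\<dots> \<le> 2 * (\<gamma> - 1) / \<gamma> * n + - c" by (rule lin)
      also have "\<dots> = Y" by (simp add: Yq q_def mult_ac)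
      finally show ?thesis .
    qed
    have "e * 1 \<le> e * n" using e n by (intro mult_left_mono) auto
    then have "e \<le> X" "e \<le> Y" using eX eY by linarith+
    then have SX: "stirling_remainder X \<le> K" and SY: "stirling_remainder Y \<le> K" by (auto intro: K)
    have Sn: "3 / 4 \<le> stirling_remainder n" unfolding n_def by (rule stirling_remainder_nat_ge)
    have lnG: "ln_Gamma x = stirling_remainder x + (x - 1/2) * ln x - x" for x by (simp add: stirling_remainder_def)
    have "leray_const r \<gamma> k = exp (ln_Gamma X + ln_Gamma Y - 2 * ln_Gamma n + 2 * n * ln (\<gamma> / 2) - Y * ln (\<gamma> - 1))"
    proof -
      have e1: "exp (2 * n * ln (\<gamma> / 2)) = (\<gamma> / 2) ^ (2 * k + 2)"
      proof -
        have "2 * n = real (2 * k + 2)" by (simp add: n_def)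
        then have "exp (2 * n * ln (\<gamma> / 2)) = (\<gamma> / 2) powr real (2 * k + 2)" using \<gamma> by (simp add: powr_def)
        then show ?thesis using \<gamma> by (subst (asm) powr_realpow) auto
      qed
      have e2: "exp (- (Y * ln (\<gamma> - 1))) = (\<gamma> - 1) powr - Y" using \<gamma> by (simp add: powr_def)
      have G: "exp (ln_Gamma x) = Gamma x" if "x > 0" for x :: real
        using that Gamma_real_pos[OF that] by (simp add: ln_Gamma_real_pos)
      have "n > 0" using n by simp
      have "ln_Gamma X + ln_Gamma Y - 2 * ln_Gamma n + 2 * n * ln (\<gamma> / 2) - Y * ln (\<gamma> - 1) =
          ln_Gamma X + (ln_Gamma Y + (2 * n * ln (\<gamma> / 2) + (- (Y * ln (\<gamma> - 1)) - (ln_Gamma n + ln_Gamma n))))" by simp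
      then have "exp (ln_Gamma X + ln_Gamma Y - 2 * ln_Gamma n + 2 * n * ln (\<gamma> / 2) - Y * ln (\<gamma> - 1)) =
          Gamma X * (Gamma Y * ((\<gamma> / 2) ^ (2 * k + 2) * ((\<gamma> - 1) powr - Y / (Gamma n * Gamma n))))"
        by (simp only: exp_add exp_diff e1 e2 G[OF XY(1)] G[OF XY(2)] G[OF \<open>n > 0\<close>])
      moreover have "leray_const r \<gamma> k = Gamma X * Gamma Y / (Gamma n)\<^sup>2 * (\<gamma> / 2) ^ (2 * k + 2) * (\<gamma> - 1) powr - Y"
        by (simp only: leray_const_def X_def Y_def n_def exponent_X_def exponent_Y_def)
      ultimately show ?thesis by (simp add: power2_eq_square mult_ac del: power_Suc)
    qed
    also have "\<dots> \<le> exp B"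
    proof -
      have l2: "ln (\<gamma> / 2) = ln \<gamma> - ln 2" using \<gamma> by (simp add: ln_div)
      have lp: "ln p = ln 2 + ln n - ln \<gamma>" using n \<gamma> by (simp add: p_def ln_div ln_mult)
      have lq: "ln q = ln 2 + ln n + ln (\<gamma> - 1) - ln \<gamma>" using n \<gamma> by (simp add: q_def ln_div ln_mult)
      have tX: "X * ln X \<le> X * ln p + X * (X / p - 1)" and tY: "Y * ln Y \<le> Y * ln q + Y * (Y / q - 1)"
        using XY pq by (auto intro: ln_tangent)
      have "X / p - 1 = c / p" "Y / q - 1 = - c / q" using pq by (simp_all add: Xp Yq field_simps)
      then have "X * (X / p - 1) + Y * (Y / q - 1) = c\<^sup>2 / p + c\<^sup>2 / q"
        using pq by (simp add: Xp Yq field_simps power2_eq_square)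
      moreover have "c\<^sup>2 / p \<le> c\<^sup>2 * (\<gamma> / 2)"
      proof -
        have "1 / p \<le> \<gamma> / 2" using n \<gamma> by (simp add: p_def field_simps)
        then show ?thesis using mult_left_mono[of "1 / p" "\<gamma> / 2" "c\<^sup>2"] by simp
      qed
      moreover have "c\<^sup>2 / q \<le> c\<^sup>2 * (\<gamma> / (2 * (\<gamma> - 1)))"
      proof -
        have "1 / q = (\<gamma> / (2 * (\<gamma> - 1))) * (1 / n)" by (simp add: q_def)
        also have "\<dots> \<le> (\<gamma> / (2 * (\<gamma> - 1))) * 1" using n \<gamma> by (intro mult_left_mono) auto
        finally show ?thesis using mult_left_mono[of "1 / q" "\<gamma> / (2 * (\<gamma> - 1))" "c\<^sup>2"] by simp
      qed
      moreover have "X * ln p + Y * ln q = 2 * n * (ln 2 + ln n - ln \<gamma>) + Y * ln (\<gamma> - 1)"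
        unfolding lp lq XY(3)[symmetric] by (simp add: algebra_simps)
      ultimately have main: "X * ln X + Y * ln Y \<le> 2 * n * (ln 2 + ln n - ln \<gamma>) + Y * ln (\<gamma> - 1) +
          c\<^sup>2 * (\<gamma> / 2) + c\<^sup>2 * (\<gamma> / (2 * (\<gamma> - 1)))"
        using tX tY by linarith
      have "ln (e * n) \<le> ln X" "ln (e * n) \<le> ln Y" using eX eY e n XY by (auto intro!: ln_mono)
      then have half: "ln e + ln n \<le> ln X / 2 + ln Y / 2" using e n by (simp add: ln_mult)
      have "ln_Gamma X + ln_Gamma Y - 2 * ln_Gamma n + 2 * n * ln (\<gamma> / 2) - Y * ln (\<gamma> - 1) =
          stirling_remainder X + stirling_remainder Y - 2 * stirling_remainder n +
          (X * ln X + Y * ln Y) - (ln X / 2 + ln Y / 2) - (X + Y) - (2 * n * ln n - ln n - 2 * n) +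
          2 * n * (ln \<gamma> - ln 2) - Y * ln (\<gamma> - 1)"
        unfolding lnG l2 by (simp add: algebra_simps)
      also have "\<dots> \<le> B"
        unfolding XY(3) B_def using SX SY Sn main half by (simp add: algebra_simps)
      finally show ?thesis by simp
    qed
    finally show ?thesis .
  qed
  then show ?thesis by blast
qed

end

section \<open>The Leray transform as a sum of mode operators\<close>

context leray_setting
begin

lemma leray_mode_measurable:
  assumes f: "f \<in> borel_measurable \<mu>"
  shows "leray_mode \<gamma> k f \<in> borel_measurable \<mu>"
proof -
  define F where "F p = indicat_real param_domain p *\<^sub>R f (param \<gamma> p)" for p
  have "F \<in> borel_measurable borel" unfolding F_def[abs_def] by (rule pullback_measurable[OF f])
  then have [measurable]: "F \<in> borel_measurable (borel \<Otimes>\<^sub>M (borel \<Otimes>\<^sub>M borel))" by (simp add: borel_prod)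
  have [measurable]: "cis \<in> borel_measurable borel" by (intro borel_measurable_continuous_onI continuous_intros)
  let ?c = "\<lambda>s \<alpha>. (LINT \<theta>|lborel. F (s, \<alpha>, \<theta>) * cis (- (real k * \<theta>))) / of_real (2 * pi)"
  have coeff: "fourier_coeff \<gamma> f (int k) s \<alpha> = ?c s \<alpha>" if "\<alpha> > 0" for s \<alpha>
    unfolding fourier_coeff_def set_lebesgue_integral_def using that
    by (intro arg_cong2[where f = "(/)"] Bochner_Integration.integral_cong refl)
      (simp add: F_def indicator_param_domain)
  have "leray_mode \<gamma> k f = (\<lambda>z. phase z ^ k * of_real (\<gamma>\<^sup>2 * (real k + 1) / (2 * pi)) *
     (LINT \<alpha>|lborel. indicat_real {0<..} \<alpha> *\<^sub>R (LINT s|lborel.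
        complex_of_real (\<gamma> * radius z * \<alpha> powr (\<gamma> - 1)) ^ k /
        Complex ((\<gamma> - 1) * \<alpha> powr \<gamma> + radius z powr \<gamma>) (s - height z) ^ (k + 2) * ?c s \<alpha> * of_real (\<alpha> powr (\<gamma> - 1)))))"
  proof
    fix z :: "complex \<times> complex"
    have "indicat_real {0<..} \<alpha> *\<^sub>R (LINT s|lborel.
        complex_of_real (\<gamma> * radius z * \<alpha> powr (\<gamma> - 1)) ^ k /
        Complex ((\<gamma> - 1) * \<alpha> powr \<gamma> + radius z powr \<gamma>) (s - height z) ^ (k + 2) * fourier_coeff \<gamma> f (int k) s \<alpha> * of_real (\<alpha> powr (\<gamma> - 1))) =
      indicat_real {0<..} \<alpha> *\<^sub>R (LINT s|lborel.
        complex_of_real (\<gamma> * radius z * \<alpha> powr (\<gamma> - 1)) ^ k /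
        Complex ((\<gamma> - 1) * \<alpha> powr \<gamma> + radius z powr \<gamma>) (s - height z) ^ (k + 2) * ?c s \<alpha> * of_real (\<alpha> powr (\<gamma> - 1)))" for \<alpha>
      by (cases "\<alpha> > 0") (simp_all add: coeff)
    then show "leray_mode \<gamma> k f z = phase z ^ k * of_real (\<gamma>\<^sup>2 * (real k + 1) / (2 * pi)) *
     (LINT \<alpha>|lborel. indicat_real {0<..} \<alpha> *\<^sub>R (LINT s|lborel.
        complex_of_real (\<gamma> * radius z * \<alpha> powr (\<gamma> - 1)) ^ k /
        Complex ((\<gamma> - 1) * \<alpha> powr \<gamma> + radius z powr \<gamma>) (s - height z) ^ (k + 2) * ?c s \<alpha> * of_real (\<alpha> powr (\<gamma> - 1))))"
      by (cases z) (simp only: leray_mode_def prod.case Let_def set_lebesgue_integral_def phase_def radius_def height_def fst_conv snd_conv)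
  qed
  also have "\<dots> \<in> borel_measurable \<mu>" by measurable
  finally show ?thesis .
qed

lemma leray_mode_eq:
  assumes z: "radius z > 0" and int: "integrable \<mu> (\<lambda>\<zeta>. mode_kernel k z \<zeta> * f \<zeta>)"
  shows "leray_mode \<gamma> k f z = integral_op \<mu> (mode_kernel k) f z"
proof -
  define a u where "a = radius z" and "u = height z"
  have a: "a > 0" using z by (simp add: a_def)
  let ?A = "\<lambda>\<alpha> s. Complex ((\<gamma> - 1) * \<alpha> powr \<gamma> + a powr \<gamma>) (s - u)"
  let ?B = "\<lambda>\<alpha>. complex_of_real (\<gamma> * a * \<alpha> powr (\<gamma> - 1))"
  let ?c = "phase z ^ k * of_real (\<gamma>\<^sup>2 * (real k + 1) / (2 * pi))"
  have "integral_op \<mu> (mode_kernel k) f z = (LINT \<alpha>:{0<..}|lborel. (LINT s|lborel. (LINT \<theta>:{0..<2 * pi}|lborel.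
    of_real (\<alpha> powr r) * (mode_kernel k z (param \<gamma> (s, \<alpha>, \<theta>)) * f (param \<gamma> (s, \<alpha>, \<theta>))))))"
    unfolding integral_op_def by (rule integral_mu[OF int])
  also have "\<dots> = (LINT \<alpha>:{0<..}|lborel. ?c * (LINT s|lborel.
      ?B \<alpha> ^ k / ?A \<alpha> s ^ (k + 2) * fourier_coeff \<gamma> f (int k) s \<alpha> * of_real (\<alpha> powr (\<gamma> - 1))))"
  proof (intro set_lebesgue_integral_cong allI impI)
    fix \<alpha> :: real assume "\<alpha> \<in> {0<..}"
    then have \<alpha>: "\<alpha> > 0" by simp
    have const: "(2 * pi * \<alpha> powr r) * (coeff k * a powr real k * \<alpha> powr expo k) =
        \<gamma>\<^sup>2 * (real k + 1) / (2 * pi) * ((\<gamma> * a * \<alpha> powr (\<gamma> - 1)) ^ k * \<alpha> powr (\<gamma> - 1))"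
    proof -
      have "(\<alpha> powr (\<gamma> - 1)) ^ k * \<alpha> powr (\<gamma> - 1) = \<alpha> powr ((\<gamma> - 1) * real k + (\<gamma> - 1))"
        using \<alpha> by (simp add: powr_add powr_powr[symmetric] powr_realpow)
      also have "(\<gamma> - 1) * real k + (\<gamma> - 1) = r + expo k" by (simp add: expo_def algebra_simps)
      finally have p: "(\<alpha> powr (\<gamma> - 1)) ^ k * \<alpha> powr (\<gamma> - 1) = \<alpha> powr r * \<alpha> powr expo k" by (simp add: powr_add)
      have "(\<gamma> * a * \<alpha> powr (\<gamma> - 1)) ^ k * \<alpha> powr (\<gamma> - 1) = \<gamma> ^ k * a ^ k * ((\<alpha> powr (\<gamma> - 1)) ^ k * \<alpha> powr (\<gamma> - 1))"
        by (simp add: power_mult_distrib)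
      also have "\<dots> = \<gamma> ^ k * a ^ k * (\<alpha> powr r * \<alpha> powr expo k)" unfolding p ..
      finally show ?thesis using a by (simp add: coeff_def powr_realpow power_add power2_eq_square)
    qed
    have "(LINT \<theta>:{0..<2 * pi}|lborel. of_real (\<alpha> powr r) * (mode_kernel k z (param \<gamma> (s, \<alpha>, \<theta>)) * f (param \<gamma> (s, \<alpha>, \<theta>)))) =
        ?c * (?B \<alpha> ^ k / ?A \<alpha> s ^ (k + 2) * fourier_coeff \<gamma> f (int k) s \<alpha> * of_real (\<alpha> powr (\<gamma> - 1)))" for s
    proof -
      let ?q = "phase z ^ k * of_real (\<alpha> powr r) * radial_kernel k a \<alpha> (s - u)"
      have "(LINT \<theta>:{0..<2 * pi}|lborel. of_real (\<alpha> powr r) * (mode_kernel k z (param \<gamma> (s, \<alpha>, \<theta>)) * f (param \<gamma> (s, \<alpha>, \<theta>)))) =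
          (LINT \<theta>:{0..<2 * pi}|lborel. ?q * (f (param \<gamma> (s, \<alpha>, \<theta>)) * cis (- of_int (int k) * \<theta>)))"
        using \<alpha> by (intro set_lebesgue_integral_cong) (auto simp: mode_kernel_param_right a_def u_def)
      also have "\<dots> = ?q * (of_real (2 * pi) * fourier_coeff \<gamma> f (int k) s \<alpha>)"
        unfolding fourier_coeff_def by (simp only: set_integral_mult_right) simp
      also have "\<dots> = phase z ^ k * of_real ((2 * pi * \<alpha> powr r) * (coeff k * a powr real k * \<alpha> powr expo k)) /
          ?A \<alpha> s ^ (k + 2) * fourier_coeff \<gamma> f (int k) s \<alpha>"
        unfolding radial_kernel_def denominator_def by simp
      also have "\<dots> = ?c * (?B \<alpha> ^ k / ?A \<alpha> s ^ (k + 2) * fourier_coeff \<gamma> f (int k) s \<alpha> * of_real (\<alpha> powr (\<gamma> - 1)))"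
        unfolding const by (simp del: power_Suc)
      finally show ?thesis .
    qed
    then show "(LINT s|lborel. (LINT \<theta>:{0..<2 * pi}|lborel. of_real (\<alpha> powr r) * (mode_kernel k z (param \<gamma> (s, \<alpha>, \<theta>)) * f (param \<gamma> (s, \<alpha>, \<theta>))))) =
      ?c * (LINT s|lborel. ?B \<alpha> ^ k / ?A \<alpha> s ^ (k + 2) * fourier_coeff \<gamma> f (int k) s \<alpha> * of_real (\<alpha> powr (\<gamma> - 1)))"
      by (simp only: integral_mult_right_zero)
  qed simp
  also have "\<dots> = ?c * (LINT \<alpha>:{0<..}|lborel. (LINT s|lborel.
      ?B \<alpha> ^ k / ?A \<alpha> s ^ (k + 2) * fourier_coeff \<gamma> f (int k) s \<alpha> * of_real (\<alpha> powr (\<gamma> - 1))))"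
    by (rule set_integral_mult_right)
  also have "\<dots> = leray_mode \<gamma> k f z"
    by (cases z) (simp only: leray_mode_def prod.case Let_def phase_def radius_def height_def a_def u_def fst_conv snd_conv)
  finally show ?thesis ..
qed

lemma leray_mode_AE:
  assumes f: "f \<in> L2 \<mu>"
  shows "AE z in \<mu>. integral_op \<mu> (mode_kernel k) f z = leray_mode \<gamma> k f z"
  using integral_op_integrable[OF mode_kernel_schur f, of k] AE_radius_pos
  by eventually_elim (simp add: leray_mode_eq)

lemma leray_mode_L2: "f \<in> L2 \<mu> \<Longrightarrow> leray_mode \<gamma> k f \<in> L2 \<mu>"
  using L2_cong_AE[OF integral_op_L2[OF mode_kernel_schur] leray_mode_measurable leray_mode_AE] L2_measurable by blast

definition coordinate_box :: "real \<Rightarrow> (complex \<times> complex) set" where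
  "coordinate_box \<delta> = {z \<in> hypersurface \<gamma>. 1 < radius z \<and> radius z < 2 \<and> \<bar>height z\<bar> < \<delta>}"

lemma coordinate_box_sets [measurable]: "coordinate_box \<delta> \<in> sets \<mu>"
proof -
  have "coordinate_box \<delta> = {z \<in> space \<mu>. 1 < radius z \<and> radius z < 2 \<and> \<bar>height z\<bar> < \<delta>}" by (simp add: coordinate_box_def)
  also have "\<dots> \<in> sets \<mu>" by measurable
  finally show ?thesis .
qed

lemma param_in_coordinate_box:
  assumes \<alpha>: "\<alpha> > 0"
  shows "param \<gamma> (s, \<alpha>, \<theta>) \<in> coordinate_box \<delta> \<longleftrightarrow> 1 < \<alpha> \<and> \<alpha> < 2 \<and> \<bar>s\<bar> < \<delta>"
proof -
  have "param \<gamma> (s, \<alpha>, \<theta>) \<in> hypersurface \<gamma>" using \<alpha> by (simp add: param_def hypersurface_def norm_mult)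
  then show ?thesis using \<alpha> by (simp add: coordinate_box_def)
qed

lemma emeasure_coordinate_box:
  assumes "\<delta> > 0"
  shows "emeasure \<mu> (coordinate_box \<delta>) \<noteq> 0" "emeasure \<mu> (coordinate_box \<delta>) < \<infinity>"
proof -
  let ?J = "\<integral>\<^sup>+\<alpha>\<in>{1<..<2}. ennreal (\<alpha> powr r) \<partial>lborel"
  have "emeasure \<mu> (coordinate_box \<delta>) = (\<integral>\<^sup>+z. indicator (coordinate_box \<delta>) z \<partial>\<mu>)"
    by (rule nn_integral_indicator[symmetric]) measurable
  also have "\<dots> = (\<integral>\<^sup>+\<alpha>\<in>{0<..}. (\<integral>\<^sup>+s. (\<integral>\<^sup>+\<theta>\<in>{0..<2 * pi}.
      ennreal (\<alpha> powr r) * indicator (coordinate_box \<delta>) (param \<gamma> (s, \<alpha>, \<theta>)) \<partial>lborel) \<partial>lborel) \<partial>lborel)"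
    by (rule nn_integral_mu) measurable
  also have "\<dots> = (\<integral>\<^sup>+\<alpha>. ennreal (4 * pi * \<delta>) * (ennreal (\<alpha> powr r) * indicator {1<..<2} \<alpha>) \<partial>lborel)"
  proof (intro nn_integral_cong)
    fix \<alpha> :: real
    show "(\<integral>\<^sup>+s. (\<integral>\<^sup>+\<theta>\<in>{0..<2 * pi}. ennreal (\<alpha> powr r) * indicator (coordinate_box \<delta>) (param \<gamma> (s, \<alpha>, \<theta>)) \<partial>lborel) \<partial>lborel) * indicator {0<..} \<alpha>
        = ennreal (4 * pi * \<delta>) * (ennreal (\<alpha> powr r) * indicator {1<..<2} \<alpha>)"
    proof (cases "\<alpha> > 0")
      case True
      have "(\<integral>\<^sup>+s. (\<integral>\<^sup>+\<theta>\<in>{0..<2 * pi}. ennreal (\<alpha> powr r) * indicator (coordinate_box \<delta>) (param \<gamma> (s, \<alpha>, \<theta>)) \<partial>lborel) \<partial>lborel) =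
          (\<integral>\<^sup>+s. (\<integral>\<^sup>+\<theta>. (ennreal (\<alpha> powr r) * indicator {1<..<2} \<alpha>) * indicator {-\<delta><..<\<delta>} s * indicator {0..<2 * pi} \<theta> \<partial>lborel) \<partial>lborel)"
        using True by (intro nn_integral_cong) (auto simp: indicator_def param_in_coordinate_box)
      also have "\<dots> = (ennreal (\<alpha> powr r) * indicator {1<..<2} \<alpha>) * (ennreal (2 * \<delta>) * ennreal (2 * pi))"
        using assms by (simp add: nn_integral_cmult nn_integral_multc mult.assoc)
      also have "ennreal (2 * \<delta>) * ennreal (2 * pi) = ennreal (4 * pi * \<delta>)"
        using assms by (subst ennreal_mult[symmetric]) (auto simp: mult_ac)
      finally show ?thesis using True by (simp add: mult.commute)
    qed simp
  qed
  also have "\<dots> = ennreal (4 * pi * \<delta>) * ?J" by (rule nn_integral_cmult) measurable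
  finally have eq: "emeasure \<mu> (coordinate_box \<delta>) = ennreal (4 * pi * \<delta>) * ?J" .
  have "?J \<noteq> 0"
  proof
    assume "?J = 0"
    then have "AE \<alpha> in lborel. ennreal (\<alpha> powr r) * indicator {1<..<2} \<alpha> = 0"
      by (subst (asm) nn_integral_0_iff_AE) auto
    then have "AE \<alpha> in lborel. \<alpha> \<notin> {1<..<2::real}" by eventually_elim (auto simp: indicator_def split: if_splits)
    then have "emeasure lborel {1<..<2::real} = 0" by (subst AE_iff_measurable[symmetric, where P = "\<lambda>\<alpha>. \<alpha> \<notin> {1<..<2::real}"]) auto
    then show False by simp
  qed
  then show "emeasure \<mu> (coordinate_box \<delta>) \<noteq> 0" unfolding eq using assms by simp
  have "?J \<le> (\<integral>\<^sup>+\<alpha>. ennreal (max 1 (2 powr r)) * indicator {1<..<2} \<alpha> \<partial>(lborel :: real measure))"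
  proof (intro nn_integral_mono)
    fix \<alpha> :: real
    show "ennreal (\<alpha> powr r) * indicator {1<..<2} \<alpha> \<le> ennreal (max 1 (2 powr r)) * indicator {1<..<2} \<alpha>"
    proof (cases "\<alpha> \<in> {1<..<2}")
      case True
      have "\<alpha> powr r \<le> max 1 (2 powr r)"
      proof (cases "r \<ge> 0")
        case True
        then show ?thesis using \<open>\<alpha> \<in> {1<..<2}\<close> powr_mono2[of r \<alpha> 2] by simp
      next
        case False
        then show ?thesis using \<open>\<alpha> \<in> {1<..<2}\<close> powr_mono2'[of r 1 \<alpha>] by simp
      qed
      then show ?thesis using True by (simp add: ennreal_leI)
    qed simp
  qed
  also have "\<dots> < \<infinity>" by (simp add: nn_integral_cmult)
  finally have "?J < \<infinity>" .
  then show "emeasure \<mu> (coordinate_box \<delta>) < \<infinity>" unfolding eq by (simp add: ennreal_mult_less_top)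
qed

lemma box_function_L2:
  assumes "\<delta> > 0" and [measurable]: "g \<in> borel_measurable \<mu>" and g: "\<And>z. z \<in> coordinate_box \<delta> \<Longrightarrow> cmod (g z) = 1"
  shows "(\<lambda>z. indicat_real (coordinate_box \<delta>) z *\<^sub>R g z) \<in> L2 \<mu>" "norm_L2 \<mu> (\<lambda>z. indicat_real (coordinate_box \<delta>) z *\<^sub>R g z) \<noteq> 0"
proof -
  let ?f = "\<lambda>z. indicat_real (coordinate_box \<delta>) z *\<^sub>R g z"
  have eq: "(\<integral>\<^sup>+z. ennreal ((cmod (?f z))\<^sup>2) \<partial>\<mu>) = emeasure \<mu> (coordinate_box \<delta>)"
  proof -
    have "(\<integral>\<^sup>+z. ennreal ((cmod (?f z))\<^sup>2) \<partial>\<mu>) = (\<integral>\<^sup>+z. indicator (coordinate_box \<delta>) z \<partial>\<mu>)"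
      by (intro nn_integral_cong) (auto simp: indicator_def g)
    also have "\<dots> = emeasure \<mu> (coordinate_box \<delta>)" by (rule nn_integral_indicator) measurable
    finally show ?thesis .
  qed
  show f: "?f \<in> L2 \<mu>" unfolding L2_iff_nn_integral eq using emeasure_coordinate_box[OF assms(1)] by simp
  show "norm_L2 \<mu> ?f \<noteq> 0"
    using nn_integral_eq_norm_L2[OF f] emeasure_coordinate_box(1)[OF assms(1)] unfolding eq by auto
qed

lemma Re_inverse_power_pos: "\<exists>\<delta>>0. \<forall>v. \<bar>v\<bar> < \<delta> \<longrightarrow> Re (1 / Complex 1 v ^ m) > 0"
proof -
  have "isCont (\<lambda>v. 1 / Complex 1 v ^ m) 0"
    unfolding Complex_eq by (intro continuous_intros) simp
  then have "isCont (\<lambda>v. Re (1 / Complex 1 v ^ m)) 0" by (rule isCont_Re)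
  moreover have one: "Re (1 / Complex 1 0 ^ m) = 1"
  proof -
    have "Complex 1 0 = 1" by (simp add: complex_eq_iff)
    then show ?thesis by simp
  qed
  ultimately have "\<forall>\<^sub>F v in at 0. Re (1 / Complex 1 v ^ m) > 0"
    unfolding isCont_def using order_tendstoD(1)[of _ "Re (1 / Complex 1 0 ^ m)" "at 0" 0] by simp
  then obtain \<delta> where "\<delta> > 0" "\<And>v. v \<noteq> 0 \<Longrightarrow> dist v 0 < \<delta> \<Longrightarrow> Re (1 / Complex 1 v ^ m) > 0"
    unfolding eventually_at by auto
  then show ?thesis using \<open>Re (1 / Complex 1 0 ^ m) = 1\<close>
    by (intro exI[of _ \<delta>]) (metis dist_real_def diff_zero zero_less_one)
qed

text \<open>
  On a box that is short in the direction of \<open>s\<close> the kernel has, up to the phases, positive real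
  part, so it does not annihilate the function on the box whose phases cancel those of the
  kernel.
\<close>

lemma mode_operator_nonzero: "\<exists>f\<in>L2 \<mu>. norm_L2 \<mu> (integral_op \<mu> (mode_kernel k) f) \<noteq> 0"
proof -
  obtain \<delta> where \<delta>: "\<delta> > 0" "\<And>v. \<bar>v\<bar> < \<delta> \<Longrightarrow> Re (1 / Complex 1 v ^ (k + 2)) > 0"
    using Re_inverse_power_pos[of "k + 2"] by blast
  define E where "E = coordinate_box (\<delta> / 2)"
  have \<delta>2: "\<delta> / 2 > 0" using \<delta> by simp
  have E [measurable]: "E \<in> sets \<mu>" unfolding E_def by (rule coordinate_box_sets)
  define f where "f z = indicat_real E z *\<^sub>R phase z ^ k" for z
  have f: "f \<in> L2 \<mu>" unfolding f_def[abs_def] E_def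
    by (rule box_function_L2[OF \<delta>2]) (auto simp: coordinate_box_def norm_power norm_phase)
  have Re_mult: "Re (of_real c * w) = c * Re w" for c w by simp
  have pos: "Re (radial_kernel k (radius z) (radius \<zeta>) (height \<zeta> - height z)) > 0" if "z \<in> E" "\<zeta> \<in> E" for z \<zeta>
  proof -
    define D t where "D = denominator (radius z) (radius \<zeta>)" and "t = height \<zeta> - height z"
    have rad: "radius z > 1" "radius \<zeta> > 1" and t: "\<bar>t\<bar> < \<delta>"
      using that by (auto simp: E_def coordinate_box_def t_def)
    have "1 \<le> radius z powr \<gamma>" using rad \<gamma> by (intro ge_one_powr_ge_zero) auto
    then have D: "D \<ge> 1" using \<gamma> by (simp add: D_def denominator_def add_increasing)
    have "\<bar>t / D\<bar> \<le> \<bar>t\<bar>" using D by (simp add: abs_divide divide_le_eq mult_le_cancel_left1)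
    then have r1: "Re (1 / Complex 1 (t / D) ^ (k + 2)) > 0" using t by (intro \<delta>) simp
    have "Complex D t = of_real D * Complex 1 (t / D)" using D by (simp add: complex_eq_iff)
    then have "radial_kernel k (radius z) (radius \<zeta>) t =
        of_real (coeff k * radius z powr real k * radius \<zeta> powr expo k / D ^ (k + 2)) * (1 / Complex 1 (t / D) ^ (k + 2))"
      unfolding radial_kernel_def D_def[symmetric] by (simp only: power_mult_distrib) simp
    then have r2: "Re (radial_kernel k (radius z) (radius \<zeta>) t) =
        coeff k * radius z powr real k * radius \<zeta> powr expo k / D ^ (k + 2) * Re (1 / Complex 1 (t / D) ^ (k + 2))"
      by (simp only: Re_mult)
    have r3: "coeff k * radius z powr real k * radius \<zeta> powr expo k / D ^ (k + 2) > 0"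
      using D rad coeff_pos[of k] by (intro divide_pos_pos mult_pos_pos zero_less_power) auto
    show ?thesis unfolding t_def[symmetric] r2 by (rule mult_pos_pos[OF r3 r1])
  qed
  have null: "AE \<zeta> in \<mu>. \<zeta> \<notin> E" if z: "z \<in> E" and int: "integrable \<mu> (\<lambda>\<zeta>. mode_kernel k z \<zeta> * f \<zeta>)"
    and 0: "integral_op \<mu> (mode_kernel k) f z = 0" for z
  proof -
    let ?R = "\<lambda>\<zeta>. radial_kernel k (radius z) (radius \<zeta>) (height \<zeta> - height z)"
    have rz: "radius z > 0" using z by (auto simp: E_def coordinate_box_def)
    have ph: "phase z \<noteq> 0" using norm_phase[OF rz] by auto
    have eq: "mode_kernel k z \<zeta> * f \<zeta> = phase z ^ k * (indicat_real E \<zeta> *\<^sub>R ?R \<zeta>)" for \<zeta>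
    proof (cases "\<zeta> \<in> E")
      case True
      then have "cnj (phase \<zeta>) * phase \<zeta> = 1"
        using norm_phase[of \<zeta>] by (simp add: E_def coordinate_box_def complex_norm_square[symmetric] mult.commute)
      then have "cnj (phase \<zeta>) ^ k * phase \<zeta> ^ k = 1" by (simp flip: power_mult_distrib)
      then show ?thesis using True by (simp add: f_def mode_kernel_def)
    qed (simp add: f_def)
    have intR: "integrable \<mu> (\<lambda>\<zeta>. indicat_real E \<zeta> *\<^sub>R ?R \<zeta>)"
    proof -
      have "integrable \<mu> (\<lambda>\<zeta>. inverse (phase z ^ k) * (mode_kernel k z \<zeta> * f \<zeta>))"
        using int by (rule integrable_mult_right)
      moreover have "inverse (phase z ^ k) * (phase z ^ k * x) = x" for x using ph by simp
      ultimately show ?thesis by (simp only: eq)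
    qed
    have "phase z ^ k * (LINT \<zeta>|\<mu>. indicat_real E \<zeta> *\<^sub>R ?R \<zeta>) = 0"
      using 0 unfolding integral_op_def eq integral_mult_right_zero .
    then have "(LINT \<zeta>|\<mu>. indicat_real E \<zeta> *\<^sub>R ?R \<zeta>) = 0" using ph by simp
    then have "(LINT \<zeta>|\<mu>. Re (indicat_real E \<zeta> *\<^sub>R ?R \<zeta>)) = 0"
      using integral_Re[OF intR] by simp
    moreover have "0 \<le> Re (indicat_real E \<zeta> *\<^sub>R ?R \<zeta>)" for \<zeta>
      using pos[OF z, of \<zeta>] by (auto simp: indicator_def)
    ultimately have "AE \<zeta> in \<mu>. Re (indicat_real E \<zeta> *\<^sub>R ?R \<zeta>) = 0"
      using integral_nonneg_eq_0_iff_AE[OF integrable_Re[OF intR]] by simp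
    then show ?thesis
    proof eventually_elim
      case (elim \<zeta>)
      show ?case
      proof
        assume "\<zeta> \<in> E"
        then show False using pos[OF z, of \<zeta>] elim by simp
      qed
    qed
  qed
  have "norm_L2 \<mu> (integral_op \<mu> (mode_kernel k) f) \<noteq> 0"
  proof
    assume "norm_L2 \<mu> (integral_op \<mu> (mode_kernel k) f) = 0"
    then have "AE z in \<mu>. integral_op \<mu> (mode_kernel k) f z = 0"
      using norm_L2_eq_0_iff[OF integral_op_L2[OF mode_kernel_schur f]] by simp
    then have "AE z in \<mu>. z \<notin> E \<or> (AE \<zeta> in \<mu>. \<zeta> \<notin> E)"
      using integral_op_integrable[OF mode_kernel_schur f, of k] by eventually_elim (use null in blast)
    then have "AE z in \<mu>. z \<notin> E" by (cases "AE \<zeta> in \<mu>. \<zeta> \<notin> E") simp_all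
    then have "E \<in> null_sets \<mu>" using AE_iff_null_sets[OF E] by simp
    then have "emeasure \<mu> E = 0" by (rule null_setsD1)
    then show False using emeasure_coordinate_box(1)[OF \<delta>2] by (simp add: E_def)
  qed
  then show ?thesis using f by blast
qed

text \<open>
  A function of angular frequency \<open>-1\<close> is orthogonal to all the modes \<open>k \<ge> 0\<close>.
\<close>

lemma mode_operators_common_kernel:
  "\<exists>f\<in>L2 \<mu>. norm_L2 \<mu> f \<noteq> 0 \<and> (\<forall>k. norm_L2 \<mu> (integral_op \<mu> (mode_kernel k) f) = 0 \<and>
    norm_L2 \<mu> (integral_op \<mu> (adjoint_kernel (mode_kernel k)) f) = 0)"
proof -
  define f where "f z = indicat_real (coordinate_box 1) z *\<^sub>R cnj (phase z)" for z
  have f: "f \<in> L2 \<mu>" "norm_L2 \<mu> f \<noteq> 0" unfolding f_def[abs_def]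
    by (rule box_function_L2; auto simp: coordinate_box_def norm_phase)+
  have fp: "f (param \<gamma> (s, \<alpha>, \<theta>)) = cis (- \<theta>) * of_real (if 1 < \<alpha> \<and> \<alpha> < 2 \<and> \<bar>s\<bar> < 1 then 1 else 0)" if "\<alpha> > 0" for s \<alpha> \<theta>
    using that by (simp add: f_def param_in_coordinate_box indicator_def cis_cnj)
  have "integral_op \<mu> (mode_kernel k) f z = 0" for k z
    unfolding integral_op_def
  proof (rule integral_mu_phase_eq_0[where m = "- (int k + 1)"])
    fix s \<alpha> \<theta> :: real assume \<alpha>: "\<alpha> > 0"
    have c: "cis (of_int (- (int k + 1)) * \<theta>) = cis (- (real k * \<theta>)) * cis (- \<theta>)"
      by (simp add: cis_mult algebra_simps)
    show "mode_kernel k z (param \<gamma> (s, \<alpha>, \<theta>)) * f (param \<gamma> (s, \<alpha>, \<theta>)) = cis (of_int (- (int k + 1)) * \<theta>) *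
        (phase z ^ k * radial_kernel k (radius z) \<alpha> (s - height z) * of_real (if 1 < \<alpha> \<and> \<alpha> < 2 \<and> \<bar>s\<bar> < 1 then 1 else 0))"
      unfolding mode_kernel_param_right[OF \<alpha>] fp[OF \<alpha>] c by (simp only: mult_ac)
  qed simp
  moreover have "integral_op \<mu> (adjoint_kernel (mode_kernel k)) f z = 0" for k z
    unfolding integral_op_def adjoint_kernel_def
  proof (rule integral_mu_phase_eq_0[where m = "- (int k + 1)"])
    fix s \<alpha> \<theta> :: real assume \<alpha>: "\<alpha> > 0"
    have c: "cis (of_int (- (int k + 1)) * \<theta>) = cis (- (real k * \<theta>)) * cis (- \<theta>)"
      by (simp add: cis_mult algebra_simps)
    show "cnj (mode_kernel k (param \<gamma> (s, \<alpha>, \<theta>)) z) * f (param \<gamma> (s, \<alpha>, \<theta>)) = cis (of_int (- (int k + 1)) * \<theta>) *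
        (phase z ^ k * cnj (radial_kernel k \<alpha> (radius z) (height z - s)) * of_real (if 1 < \<alpha> \<and> \<alpha> < 2 \<and> \<bar>s\<bar> < 1 then 1 else 0))"
      unfolding mode_kernel_param_left[OF \<alpha>] fp[OF \<alpha>] complex_cnj_mult complex_cnj_power complex_cnj_cnj cis_cnj c
      by (simp only: mult_ac)
  qed simp
  ultimately have "norm_L2 \<mu> (integral_op \<mu> (mode_kernel k) f) = 0 \<and> norm_L2 \<mu> (integral_op \<mu> (adjoint_kernel (mode_kernel k)) f) = 0" for k
    by (simp add: norm_L2_def)
  then show ?thesis using f by blast
qed

lemma mode_operator_relation:
  assumes f: "f \<in> L2 \<mu>"
  shows "AE z in \<mu>. integral_op \<mu> (mode_kernel k) (integral_op \<mu> (adjoint_kernel (mode_kernel k)) (integral_op \<mu> (mode_kernel k) f)) z =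
    of_real (leray_const r \<gamma> k) * integral_op \<mu> (mode_kernel k) f z"
proof -
  let ?K = "mode_kernel k"
  let ?G = "compose_kernel \<mu> (adjoint_kernel ?K) ?K"
  have K: "schur_kernel ?K" and K': "schur_kernel (adjoint_kernel ?K)" by (intro adjoint_kernel_schur mode_kernel_schur)+
  have G: "schur_kernel ?G" by (rule compose_kernel_schur[OF K' K])
  have KG: "schur_kernel (compose_kernel \<mu> ?K ?G)" by (rule compose_kernel_schur[OF K G])
  have 1: "AE z in \<mu>. integral_op \<mu> ?K (integral_op \<mu> (adjoint_kernel ?K) (integral_op \<mu> ?K f)) z = integral_op \<mu> ?K (integral_op \<mu> ?G f) z"
    using AE_space
  proof eventually_elim
    case (elim z)
    show ?case
      using f by (intro integral_op_cong[OF K _ _ integral_op_compose[OF K' K f] elim] L2_measurable integral_op_L2 K K' G)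
  qed
  have 2: "AE z in \<mu>. integral_op \<mu> ?K (integral_op \<mu> ?G f) z = integral_op \<mu> (compose_kernel \<mu> ?K ?G) f z"
    by (rule integral_op_compose[OF K G f])
  have 3: "AE z in \<mu>. integral_op \<mu> (compose_kernel \<mu> ?K ?G) f z = integral_op \<mu> (\<lambda>z w. of_real (leray_const r \<gamma> k) * ?K z w) f z"
  proof (rule integral_op_cong_kernel[OF schur_kernel_measurable[OF KG] _ L2_measurable[OF f]])
    show "(\<lambda>(z, w). of_real (leray_const r \<gamma> k) * ?K z w) \<in> borel_measurable (\<mu> \<Otimes>\<^sub>M \<mu>)"
      using mode_kernel_measurable[of k] by measurable
    show "AE z in \<mu>. AE w in \<mu>. compose_kernel \<mu> ?K ?G z w = of_real (leray_const r \<gamma> k) * ?K z w"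
      using compose_kernel_integrable[OF K G] AE_radius_pos
    proof eventually_elim
      case (elim z)
      from elim(1) AE_radius_pos show ?case
        by eventually_elim (rule compose_three_mode_kernels[OF elim(2)])
    qed
  qed
  show ?thesis using 1 2 3 by eventually_elim (simp add: integral_op_def mult.assoc)
qed

sublocale modes: L2_modes \<mu> "\<lambda>k. integral_op \<mu> (mode_kernel k)"
  "\<lambda>k. integral_op \<mu> (adjoint_kernel (mode_kernel k))" "leray_const r \<gamma>"
proof
  note K = mode_kernel_schur and K' = adjoint_kernel_schur[OF mode_kernel_schur]
  fix f g :: "complex \<times> complex \<Rightarrow> complex" and j k :: nat
  show "\<exists>K. \<forall>k. leray_const r \<gamma> k \<le> K" by (rule leray_const_bounded)
  show "leray_const r \<gamma> k > 0" by (rule leray_const_pos)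
  show "\<exists>f\<in>L2 \<mu>. norm_L2 \<mu> (integral_op \<mu> (mode_kernel k) f) \<noteq> 0" by (rule mode_operator_nonzero)
  show "\<exists>f\<in>L2 \<mu>. norm_L2 \<mu> f \<noteq> 0 \<and> (\<forall>k. norm_L2 \<mu> (integral_op \<mu> (mode_kernel k) f) = 0 \<and>
    norm_L2 \<mu> (integral_op \<mu> (adjoint_kernel (mode_kernel k)) f) = 0)" by (rule mode_operators_common_kernel)
  assume f: "f \<in> L2 \<mu>"
  show "integral_op \<mu> (mode_kernel k) f \<in> L2 \<mu>" by (rule integral_op_L2[OF K f])
  show "integral_op \<mu> (adjoint_kernel (mode_kernel k)) f \<in> L2 \<mu>" by (rule integral_op_L2[OF K' f])
  assume g: "g \<in> L2 \<mu>"
  show "L2_inner \<mu> (integral_op \<mu> (mode_kernel k) f) g = L2_inner \<mu> f (integral_op \<mu> (adjoint_kernel (mode_kernel k)) g)"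
    using f g by (intro integral_op_adjoint K)
  show "L2_inner \<mu> (integral_op \<mu> (mode_kernel k) (integral_op \<mu> (adjoint_kernel (mode_kernel k)) (integral_op \<mu> (mode_kernel k) f))) g
      = of_real (leray_const r \<gamma> k) * L2_inner \<mu> (integral_op \<mu> (mode_kernel k) f) g"
    unfolding L2_inner_scale_left[symmetric] using f g
    by (intro L2_inner_cong[OF _ _ _ _ mode_operator_relation[OF f]] L2_measurable L2_scale integral_op_L2 K K') auto
  assume jk: "j \<noteq> k"
  show "L2_inner \<mu> (integral_op \<mu> (mode_kernel j) f) (integral_op \<mu> (mode_kernel k) g) = 0"
  proof -
    have "AE z in \<mu>. integral_op \<mu> (adjoint_kernel (mode_kernel j)) (integral_op \<mu> (mode_kernel k) g) z = 0"
      using integral_op_compose[OF K'[of j] K[of k] g] compose_different_modes(1)[OF jk] by (simp add: integral_op_def)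
    then have "L2_inner \<mu> f (integral_op \<mu> (adjoint_kernel (mode_kernel j)) (integral_op \<mu> (mode_kernel k) g)) = L2_inner \<mu> f (\<lambda>_. 0)"
      using f g by (intro L2_inner_cong L2_measurable integral_op_L2 K K') auto
    then show ?thesis using f g integral_op_adjoint[OF K[of j] f integral_op_L2[OF K[of k] g]] by simp
  qed
  show "L2_inner \<mu> (integral_op \<mu> (adjoint_kernel (mode_kernel j)) f) (integral_op \<mu> (adjoint_kernel (mode_kernel k)) g) = 0"
  proof -
    have adj: "adjoint_kernel (adjoint_kernel (mode_kernel j)) = mode_kernel j" by (simp add: adjoint_kernel_def fun_eq_iff)
    have "AE z in \<mu>. integral_op \<mu> (mode_kernel j) (integral_op \<mu> (adjoint_kernel (mode_kernel k)) g) z = 0"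
      using integral_op_compose[OF K[of j] K'[of k] g] compose_different_modes(2)[OF jk] by (simp add: integral_op_def)
    then have "L2_inner \<mu> f (integral_op \<mu> (mode_kernel j) (integral_op \<mu> (adjoint_kernel (mode_kernel k)) g)) = L2_inner \<mu> f (\<lambda>_. 0)"
      using f g by (intro L2_inner_cong L2_measurable integral_op_L2 K K') auto
    then show ?thesis using integral_op_adjoint[OF K'[of j] f integral_op_L2[OF K'[of k] g]] by (simp add: adj)
  qed
qed

lemma leray_sums:
  assumes f: "f \<in> L2 \<mu>"
  shows "L2_sums \<mu> (\<lambda>k. integral_op \<mu> (mode_kernel k) f) (leray \<gamma> r f)"
proof -
  obtain g where g: "L2_sums \<mu> (\<lambda>k. integral_op \<mu> (mode_kernel k) f) g"
    using modes.S_sums_exist[OF f] by blast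
  have "L2_sums \<mu> (\<lambda>k. leray_mode \<gamma> k f) g"
    by (rule L2_sums_cong_AE[OF g leray_mode_L2[OF f] leray_mode_AE[OF f] L2_sums_L2[OF g]]) simp
  then have l: "L2_sums \<mu> (\<lambda>k. leray_mode \<gamma> k f) (leray \<gamma> r f)"
    unfolding leray_def by (rule someI[where P = "L2_sums \<mu> (\<lambda>k. leray_mode \<gamma> k f)"])
  show ?thesis
  proof (rule L2_sums_cong_AE[OF l])
    show "AE z in \<mu>. leray_mode \<gamma> k f z = integral_op \<mu> (mode_kernel k) f z" for k
      using leray_mode_AE[OF f, of k] by eventually_elim simp
  qed (use f L2_sums_L2[OF l] in \<open>auto intro: integral_op_L2 mode_kernel_schur\<close>)
qed

end

theorem theorem1p8:
  fixes \<gamma> r :: real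
    and T :: "(complex \<times> complex \<Rightarrow> complex) \<Rightarrow> complex \<times> complex \<Rightarrow> complex"
  assumes "\<gamma> > 1"
    and "r \<in> {-1<..<2 * \<gamma> - 1}"
    and "T = leray_adjoint \<gamma> r \<circ> leray \<gamma> r \<or> T = leray \<gamma> r \<circ> leray_adjoint \<gamma> r"
  shows "(\<exists>B. L2_orthogonal_basis (mu \<gamma> r) B \<and>
              (\<forall>b\<in>B. \<exists>c. L2_eigenfunction (mu \<gamma> r) T c b)) \<and>
         L2_point_spectrum (mu \<gamma> r) T = {0} \<union> {complex_of_real (leray_const r \<gamma> k) | k. True} \<and>
         L2_spectrum (mu \<gamma> r) T = closure ({0} \<union> {complex_of_real (leray_const r \<gamma> k) | k. True})"
proof -
  interpret leray_setting \<gamma> r using assms(1,2) by unfold_locales auto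
  show ?thesis
    by (rule modes.spectral_theorem[OF leray_sums assms(3)[unfolded leray_adjoint_def]])
qed

end
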